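(* Let $\boldsymbol\Sigma$ be a symmetric non-negative definite matrix in $\mathbb R^{d\times d}$, let $\boldsymbol B=(\boldsymbol B_t)_{t\in[0,1]}$ be a standard Brownian motion on $\mathbb R^d$ independent of a pure-jump Lévy process $\boldsymbol S$ on $\mathbb R^d$ with Blumenthal–Getoor index $\beta$ and Lévy–Khintchine exponent $\psi_{\boldsymbol S}$. Let $\boldsymbol X=\boldsymbol\Sigma\boldsymbol B+\boldsymbol S$ and $\boldsymbol X^t=((\boldsymbol\Sigma\boldsymbol B_{st}+\boldsymbol S_{st})/\sqrt t)_{s\in[0,1]}$ for $t\in(0,1]$. (a) Suppose $\beta\in[0,2)$ and fix any $\beta_*\in(\beta,2]$ when $\boldsymbol S$ is of infinite variation, and $\beta_*=1$ otherwise. Then for any $q>0$ with $\mathbb E[|\boldsymbol X_1|^q]<\infty$, $$\mathcal W_q(\boldsymbol X^t,\boldsymbol\Sigma\boldsymbol B)=O\big(t^{(q\wedge1)(\min\{1/q,1/\beta_*\}-1/2)}\big)\quad\text{as }t\downarrow0.$$ (b) Pick any $\boldsymbol u_*\in\mathbb R^d\setminus\{\boldsymbol 0\}$ such that $C_*:=|\boldsymbol u_*|^{-1}|\psi_{\boldsymbol S}(\boldsymbol u_* )|>0$. Then for all $q\ge1$, $$\mathcal W_q(\boldsymbol X^t_1,\boldsymbol\Sigma\boldsymbol B_1)\ge\frac{C_*}{\sqrt2}\sqrt t+O(t^{3/2})\quad\text{as }t\downarrow0.$$ (c) Let $\lambda$ be the largest eigenvalue of $\boldsymbol\Sigma^2$.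 Suppose there exist $\delta\in[1,2)$ and vectors $(\boldsymbol u_r)_{r\in(0,\infty)}$ in $\mathbb R^d$ with $|\boldsymbol u_r|=r$ such that $c:=\inf_{r>1}r^{-\delta}|\psi_{\boldsymbol S}(\boldsymbol u_r)|>0$. Then for all $q\ge1$ and any $C_*\in(0,ce^{-\lambda/2})$ we have $\mathcal W_q(\boldsymbol X^t_1,\boldsymbol\Sigma\boldsymbol B_1)\ge(C_*/\sqrt2)\,t^{1-\delta/2}$ for all sufficiently small $t>0$.
   Context: $|\cdot|$ is the Euclidean norm. A pure-jump Lévy process is one without Gaussian component (generating triplet $(\boldsymbol\gamma_{\boldsymbol S},\boldsymbol 0,\nu_{\boldsymbol S})$). Its Lévy–Khintchine exponent is defined by $\mathbb E[e^{i\langle\boldsymbol u,\boldsymbol S_t\rangle}]=e^{t\psi_{\boldsymbol S}(\boldsymbol u)}$. Its Blumenthal–Getoor index is $\beta=\inf\{p>0:\int_{0<|\boldsymbol w|<1}|\boldsymbol w|^p\nu_{\boldsymbol S}(\mathrm d\boldsymbol w)<\infty\}\in[0,2]$. $\boldsymbol S$ has finite variation iff $\int_{0<|\boldsymbol w|<1}|\boldsymbol w|\nu_{\boldsymbol S}(\mathrm d\boldsymbol w)<\infty$. Wasserstein distance: for $q>0$ and random vectors, $\mathcal W_q(\boldsymbol\xi,\boldsymbol\zeta)=\inf \mathbb E[|\boldsymbol\xi'-\boldsymbol\zeta'|^q]^{1/(q\vee1)}$ over all couplings with the given marginal laws; for processes on $[0,1]$, $\mathcal W_q(\boldsymbol{\mathcal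 X},\boldsymbol{\mathcal Y})=\inf\mathbb E[\sup_{t\in[0,1]}|\boldsymbol{\mathcal X}'_t-\boldsymbol{\mathcal Y}'_t|^q]^{1/(q\vee 1)}$ over all couplings of the process laws. *)

theory Defs
  imports "HOL-Probability.Probability"
begin

text \<open>All processes are indexed by the time interval \<open>[0,1]\<close>; values at other times are irrelevant.\<close>

definition cadlag :: "(real \<Rightarrow> 'b::topological_space) \<Rightarrow> bool" where
  "cadlag f \<longleftrightarrow>
     (\<forall>t\<in>{0..<1}. (f \<longlongrightarrow> f t) (at_right t)) \<and>
     (\<forall>t\<in>{0<..1}. \<exists>l. (f \<longlongrightarrow> l) (at_left t))"

definition independent_increments ::
    "'a measure \<Rightarrow> (real \<Rightarrow> 'a \<Rightarrow> real ^ 'd) \<Rightarrow> bool" where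
  "independent_increments M X \<longleftrightarrow>
     (\<forall>n (t :: nat \<Rightarrow> real). (\<forall>i\<le>n. t i \<in> {0..1}) \<longrightarrow> (\<forall>i<n. t i < t (Suc i)) \<longrightarrow>
        prob_space.indep_vars M (\<lambda>_. borel) (\<lambda>i \<omega>. X (t (Suc i)) \<omega> - X (t i) \<omega>) {..<n})"

definition brownian_motion :: "'a measure \<Rightarrow> (real \<Rightarrow> 'a \<Rightarrow> real ^ 'd) \<Rightarrow> bool" where
  "brownian_motion M B \<longleftrightarrow>
     (\<forall>t\<in>{0..1}. B t \<in> borel_measurable M) \<and>
     (AE \<omega> in M. B 0 \<omega> = 0) \<and>
     independent_increments M B \<and>
     (\<forall>s t. 0 \<le> s \<longrightarrow> s < t \<longrightarrow> t \<le> 1 \<longrightarrow>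
        distributed M lborel (\<lambda>\<omega>. B t \<omega> - B s \<omega>)
          (\<lambda>x. ennreal (\<Prod>i\<in>UNIV. normal_density 0 (sqrt (t - s)) (x $ i)))) \<and>
     (AE \<omega> in M. continuous_on {0..1} (\<lambda>t. B t \<omega>))"

definition levy_process :: "'a measure \<Rightarrow> (real \<Rightarrow> 'a \<Rightarrow> real ^ 'd) \<Rightarrow> bool" where
  "levy_process M S \<longleftrightarrow>
     (\<forall>t\<in>{0..1}. S t \<in> borel_measurable M) \<and>
     (AE \<omega> in M. S 0 \<omega> = 0) \<and>
     independent_increments M S \<and>
     (\<forall>s h. 0 \<le> s \<longrightarrow> 0 \<le> h \<longrightarrow> s + h \<le> 1 \<longrightarrow>
        distr M borel (\<lambda>\<omega>. S (s + h) \<omega> - S s \<omega>) = distr M borel (\<lambda>\<omega>. S h \<omega> - S 0 \<omega>)) \<and>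
     (\<forall>t\<in>{0..1}. \<forall>\<epsilon>>0.
        ((\<lambda>s. measure M {\<omega> \<in> space M. norm (S s \<omega> - S t \<omega>) > \<epsilon>}) \<longlongrightarrow> 0) (at t within {0..1})) \<and>
     (AE \<omega> in M. cadlag (\<lambda>t. S t \<omega>))"

definition path_space :: "(real \<Rightarrow> real ^ 'd) measure" where
  "path_space = (\<Pi>\<^sub>M t\<in>{0..1}. borel)"

definition path :: "(real \<Rightarrow> 'a \<Rightarrow> real ^ 'd) \<Rightarrow> 'a \<Rightarrow> real \<Rightarrow> real ^ 'd" where
  "path X \<omega> = (\<lambda>t\<in>{0..1}. X t \<omega>)"

definition independent_processes ::
    "'a measure \<Rightarrow> (real \<Rightarrow> 'a \<Rightarrow> real ^ 'd) \<Rightarrow> (real \<Rightarrow> 'a \<Rightarrow> real ^ 'd) \<Rightarrow> bool" where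
  "independent_processes M X Y \<longleftrightarrow>
     prob_space.indep_var M path_space (path X) path_space (path Y)"

text \<open>Since the defining equation is imposed for every \<open>t \<in> [0,1]\<close> (and not only at \<open>t = 1\<close>),
  it determines \<open>\<psi>\<close> without a choice of branch of the logarithm.\<close>

definition levy_khintchine_exponent ::
    "'a measure \<Rightarrow> (real \<Rightarrow> 'a \<Rightarrow> real ^ 'd) \<Rightarrow> (real ^ 'd \<Rightarrow> complex) \<Rightarrow> bool" where
  "levy_khintchine_exponent M S \<psi> \<longleftrightarrow>
     (\<forall>t\<in>{0..1}. \<forall>u. (CLINT \<omega>|M. iexp (u \<bullet> S t \<omega>)) = exp (complex_of_real t * \<psi> u))"

definition levy_measure :: "(real ^ 'd) measure \<Rightarrow> bool" where
  "levy_measure \<nu> \<longleftrightarrow> sets \<nu> = sets borel \<and> emeasure \<nu> {0} = 0 \<and>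
     (\<integral>\<^sup>+ w. ennreal (min 1 ((norm w)\<^sup>2)) \<partial>\<nu>) < \<infinity>"

text \<open>The Levy-Khintchine formula with cutoff function \<open>1\<close> on the open unit ball; the drift
  \<open>\<gamma>\<close> (but neither \<open>A\<close> nor \<open>\<nu>\<close>) depends on this choice.\<close>

definition generating_triplet ::
    "'a measure \<Rightarrow> (real \<Rightarrow> 'a \<Rightarrow> real ^ 'd) \<Rightarrow> real ^ 'd \<Rightarrow> real ^ 'd ^ 'd \<Rightarrow> (real ^ 'd) measure \<Rightarrow> bool"
  where
  "generating_triplet M S \<gamma> A \<nu> \<longleftrightarrow> levy_measure \<nu> \<and>
     levy_khintchine_exponent M S
       (\<lambda>u. \<i> * complex_of_real (u \<bullet> \<gamma>) - complex_of_real (u \<bullet> (A *v u)) / 2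
          + (CLINT w|\<nu>. iexp (u \<bullet> w) - 1
               - \<i> * complex_of_real ((u \<bullet> w) * indicator {w. norm w < 1} w)))"

definition small_jump_moment :: "(real ^ 'd) measure \<Rightarrow> real \<Rightarrow> ennreal" where
  "small_jump_moment \<nu> p = (\<integral>\<^sup>+ w\<in>{w. 0 < norm w \<and> norm w < 1}. ennreal (norm w powr p) \<partial>\<nu>)"

definition blumenthal_getoor_index :: "(real ^ 'd) measure \<Rightarrow> real" where
  "blumenthal_getoor_index \<nu> = Inf {p. 0 < p \<and> small_jump_moment \<nu> p < \<infinity>}"

text \<open>Finite variation of a Levy process with triplet \<open>(\<gamma>, 0, \<nu>)\<close>, expressed through its
  Levy measure.\<close>

definition finite_variation :: "(real ^ 'd) measure \<Rightarrow> bool" where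
  "finite_variation \<nu> \<longleftrightarrow> small_jump_moment \<nu> 1 < \<infinity>"


text \<open>The distances may be infinite, so they take values in \<^typ>\<open>ennreal\<close>. The power below
  is only used with \<open>p > 0\<close>.\<close>

definition ennreal_powr :: "ennreal \<Rightarrow> real \<Rightarrow> ennreal" where
  "ennreal_powr x p = (if x = \<infinity> then \<infinity> else ennreal (enn2real x powr p))"

text \<open>A coupling is represented by the joint law of the pair, living on \<open>D \<Otimes>\<^sub>M D\<close>. The space
  \<open>D\<close> may be smaller than that of \<open>\<mu>\<close> and \<open>\<mu>'\<close>, provided that the inclusion is measurable: for
  processes \<open>D\<close> consists of the cadlag paths, a subset which is not measurable in the
  uncountable product \<^const>\<open>path_space\<close>.\<close>

definition couplings :: "'b measure \<Rightarrow> 'b measure \<Rightarrow> 'b measure \<Rightarrow> ('b \<times> 'b) measure set" where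
  "couplings D \<mu> \<mu>' = {\<pi>. prob_space \<pi> \<and> sets \<pi> = sets (D \<Otimes>\<^sub>M D) \<and>
     distr \<pi> \<mu> fst = \<mu> \<and> distr \<pi> \<mu>' snd = \<mu>'}"

definition wasserstein_vec :: "real \<Rightarrow> 'a measure \<Rightarrow> ('a \<Rightarrow> real ^ 'd) \<Rightarrow> ('a \<Rightarrow> real ^ 'd) \<Rightarrow> ennreal"
  where
  "wasserstein_vec q M \<xi> \<zeta> =
     (INF \<pi>\<in>couplings borel (distr M borel \<xi>) (distr M borel \<zeta>).
        ennreal_powr (\<integral>\<^sup>+ (x, y). ennreal (norm (x - y) powr q) \<partial>\<pi>) (1 / max q 1))"

definition cadlag_space :: "(real \<Rightarrow> real ^ 'd) measure" where
  "cadlag_space = restrict_space path_space {f. cadlag f}"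

text \<open>The supremum is finite and measurable on pairs of cadlag paths.\<close>

definition wasserstein_proc ::
    "real \<Rightarrow> 'a measure \<Rightarrow> (real \<Rightarrow> 'a \<Rightarrow> real ^ 'd) \<Rightarrow> (real \<Rightarrow> 'a \<Rightarrow> real ^ 'd) \<Rightarrow> ennreal" where
  "wasserstein_proc q M X Y =
     (INF \<pi>\<in>couplings cadlag_space (distr M path_space (path X)) (distr M path_space (path Y)).
        ennreal_powr (\<integral>\<^sup>+ (x, y). ennreal ((SUP t\<in>{0..1}. norm (x t - y t)) powr q) \<partial>\<pi>)
          (1 / max q 1))"

definition eigenvalue :: "real ^ 'd ^ 'd \<Rightarrow> real \<Rightarrow> bool" where
  "eigenvalue A l \<longleftrightarrow> (\<exists>v. v \<noteq> 0 \<and> A *v v = l *\<^sub>R v)"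

end

theory Submission
  imports Defs
begin

text \<open>
  For (a), Brownian scaling makes \<open>(\<Sigma> B\<^bsub>st\<^esub> / \<surd>t)\<^sub>s\<close> a copy of \<open>\<Sigma> B\<close>, so coupling it with \<open>X\<^sup>t\<close> bounds the
  distance by the \<open>q\<close>-th moment of \<open>sup\<^bsub>s \<le> t\<^esub> |S\<^sub>s| / \<surd>t\<close>. No Levy-Ito decomposition is needed for that
  moment: Ottaviani's inequality on dyadic grids reduces the supremum to tail bounds for a single \<open>S\<^sub>s\<close>,
  the tails at bounded \<open>x\<close> follow from the growth of the exponent through the truncation inequality
  \<open>P(|S\<^sub>s| > x) \<le> 2 d sup\<^bsub>|u| \<le> 2d/x\<^esub> (1 - Re \<phi>\<^sub>s(u))\<close>, and the tails at large \<open>x\<close> are \<open>O(t)\<close> times those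
  of \<open>|S\<^sub>1|\<close>, because \<open>1/t\<close> independent increments of length \<open>t\<close> are controlled by the running maximum of
  \<open>S\<close> up to time 1. For (b) and (c), \<open>|E exp(i u \<bullet> \<xi>) - E exp(i u \<bullet> \<zeta>)| \<le> |u| E|\<xi> - \<zeta>|\<close> turns a difference of
  characteristic functions at one frequency into a lower bound for every coupling; in (b) the remainder
  can be taken to be 0 thanks to the factor \<open>1/\<surd>2\<close>.
\<close>

section \<open>Elementary inequalities and integrals\<close>

text \<open>Integrating a tail bound t x^(-p) against x^(q-1) shows which end dominates: if q < p,
  capping the tail at 1 near x = t^(1/p) gives t^(q/p); if q > p, the singularity at 0 is harmless
  and the order is t. The obstacle is q = p, where a logarithm appears. With infinite variation it
  is avoided because \<beta>_* lies strictly above the index, so that p can be taken between the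
  two. With finite variation \<beta>_* = 1, and the drift makes the exponent grow linearly, so no p
  < 1 is available: the case q = 1 needs its own argument, in which drift and compensator enter only
  to second order in t because they are purely imaginary. The growth of the exponent controls only
  bounded x; beyond that the moment hypothesis takes over. It is stated for X_1 and passes to S_1
  because all Gaussian moments are finite.\<close>

lemma cmod_exp_minus_one_le:
  assumes "Re z \<le> 0"
  shows "cmod (exp z - 1) \<le> cmod z"
proof -
  \<comment> \<open>Mean value inequality on the closed left half-plane, which is convex and on
    which the derivative \<open>exp\<close> has modulus at most 1.\<close>
  have "cmod (exp z - exp 0) \<le> 1 * cmod (z - 0)"
    by (rule field_differentiable_bound[where S="{z. Re z \<le> 0}" and f'=exp])
       (use assms in \<open>auto intro: convex_halfspace_Re_le DERIV_subset[OF DERIV_exp]\<close>)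
  then show ?thesis by simp
qed

lemma one_minus_cos_le: "1 - cos y \<le> y\<^sup>2 / 2" for y :: real
proof -
  have "(sin (y / 2))\<^sup>2 \<le> (y / 2)\<^sup>2"
    using abs_sin_x_le_abs_x[of "y / 2"] by (simp only: abs_le_square_iff)
  then show ?thesis
    using cos_double_sin[of "y / 2"] by (simp add: power_divide)
qed

text \<open>Sharper than a bound by the modulus of \<open>z\<close>: the imaginary part, which
  carries drift and compensator of a Levy exponent, enters only through its square.\<close>

lemma one_minus_Re_exp_le:
  assumes "Re z \<le> 0"
  shows "1 - Re (exp z) \<le> - Re z + (Im z)\<^sup>2 / 2"
proof -
  have exp: "1 - exp (Re z) \<le> - Re z"
    using exp_ge_add_one_self[of "Re z"] by linarith
  have "1 - Re (exp z) = (1 - exp (Re z)) + exp (Re z) * (1 - cos (Im z))"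
    by (simp add: Re_exp algebra_simps)
  also have "\<dots> \<le> - Re z + 1 * ((Im z)\<^sup>2 / 2)"
    using assms exp one_minus_cos_le[of "Im z"] by (intro add_mono mult_mono) auto
  finally show ?thesis by simp
qed

text \<open>The difference quotient of \<open>exp\<close> at 0 tends to 1, so every factor \<kappa>
  below 1 is admissible near 0. The lower bounds pay for it with their factor 1/sqrt 2.\<close>

lemma eventually_cmod_exp_minus_one_ge:
  assumes "\<kappa> < 1"
  shows "\<forall>\<^sub>F z in nhds 0. \<kappa> * cmod z \<le> cmod (exp z - 1)"
proof -
  have "((\<lambda>z::complex. (exp z - exp 0) / (z - 0)) \<longlongrightarrow> exp 0) (at 0)"
    using DERIV_exp[of "0::complex"] by (simp add: has_field_derivative_iff)
  then have "((\<lambda>z::complex. cmod ((exp z - exp 0) / (z - 0))) \<longlongrightarrow> cmod (exp 0)) (at 0)"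
    by (rule tendsto_norm)
  then have "\<forall>\<^sub>F z in at 0. \<kappa> < cmod ((exp z - 1) / z)"
    using assms by (auto dest!: order_tendstoD(1))
  then have "\<forall>\<^sub>F z in nhds 0. z \<noteq> 0 \<longrightarrow> \<kappa> < cmod ((exp z - 1) / z)"
    by (simp add: eventually_at_filter)
  then show ?thesis
    by eventually_elim (auto simp: norm_divide field_simps)
qed

lemma cmod_iexp_minus_one_le: "cmod (iexp y - 1) \<le> min 2 \<bar>y\<bar>"
proof -
  have "cmod (iexp y - 1) \<le> 1 + 1"
    using norm_triangle_ineq4[of "iexp y" 1] by simp
  then show ?thesis
  using iexp_approx1[of y 0] by simp
qed

lemma cmod_iexp_minus_linear_le:
  "cmod (iexp y - 1 - \<i> * y) \<le> 2 * \<bar>y\<bar>" "cmod (iexp y - 1 - \<i> * y) \<le> y\<^sup>2 / 2"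
proof -
  show "cmod (iexp y - 1 - \<i> * y) \<le> y\<^sup>2 / 2"
    using iexp_approx1[of y 1] by (simp add: power2_eq_square fact_numeral algebra_simps)
  have "cmod (iexp y - 1 - \<i> * y) \<le> cmod (iexp y - 1) + cmod (\<i> * y)"
    by (rule norm_triangle_ineq4)
  then show "cmod (iexp y - 1 - \<i> * y) \<le> 2 * \<bar>y\<bar>"
    using cmod_iexp_minus_one_le[of y] by (simp add: norm_mult)
qed

section \<open>Integrals of powers and the layer-cake formula\<close>

lemma nn_integral_powr_interval:
  assumes "0 < q" "0 \<le> y"
  shows "(\<integral>\<^sup>+x. ennreal (q * x powr (q - 1)) * indicator {0<..<y} x \<partial>lborel) = ennreal (y powr q)"
proof -
  have "((\<lambda>x. q * x powr (q - 1)) has_integral (q * (y powr (q - 1 + 1) / (q - 1 + 1)))) {0..y}"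
    using assms by (intro has_integral_mult_right has_integral_powr_from_0) auto
  from nn_integral_has_integral_lebesgue[OF _ this]
  have "(\<integral>\<^sup>+x. ennreal (indicator {0..y} x * (q * x powr (q - 1))) \<partial>lborel) = ennreal (y powr q)"
    using assms by simp
  moreover have "AE x in lborel. ennreal (q * x powr (q - 1)) * indicator {0<..<y} x
      = ennreal (indicator {0..y} x * (q * x powr (q - 1)))"
    using AE_lborel_singleton[of 0] AE_lborel_singleton[of y]
    by eventually_elim (auto simp: indicator_def)
  ultimately show ?thesis
    by (simp cong: nn_integral_cong_AE)
qed

text \<open>Tonelli applied to \<open>Y powr q\<close>, written as the integral of its derivative
  over the open interval from 0 to \<open>Y\<close>; the openness produces the strict tail event
  \<open>x < Y\<close>.\<close>

lemma (in sigma_finite_measure) nn_integral_powr_layer_cake: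
  fixes Y :: "'a \<Rightarrow> real"
  assumes [measurable]: "Y \<in> borel_measurable M" and "0 < q" "\<And>\<omega>. 0 \<le> Y \<omega>"
  shows "(\<integral>\<^sup>+\<omega>. ennreal (Y \<omega> powr q) \<partial>M) =
    (\<integral>\<^sup>+x\<in>{0<..}. ennreal (q * x powr (q - 1)) * emeasure M {\<omega>\<in>space M. x < Y \<omega>} \<partial>lborel)"
proof -
  interpret pair_sigma_finite M lborel ..
  have "(\<integral>\<^sup>+\<omega>. ennreal (Y \<omega> powr q) \<partial>M) =
     (\<integral>\<^sup>+\<omega>. \<integral>\<^sup>+x. ennreal (q * x powr (q - 1)) * indicator {0<..<Y \<omega>} x \<partial>lborel \<partial>M)"
    using assms by (simp add: nn_integral_powr_interval)
  also have "\<dots> = (\<integral>\<^sup>+\<omega>. \<integral>\<^sup>+x. ennreal (q * x powr (q - 1)) * indicator {0<..} x * indicator {\<omega>\<in>space M. x < Y \<omega>} \<omega> \<partial>lborel \<partial>M)"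
    by (intro nn_integral_cong) (auto simp: indicator_def)
  also have "\<dots> = (\<integral>\<^sup>+x. \<integral>\<^sup>+\<omega>. ennreal (q * x powr (q - 1)) * indicator {0<..} x * indicator {\<omega>\<in>space M. x < Y \<omega>} \<omega> \<partial>M \<partial>lborel)"
    by (intro Fubini'[symmetric]) (simp add: indicator_def)
  also have "\<dots> = (\<integral>\<^sup>+x\<in>{0<..}. ennreal (q * x powr (q - 1)) * emeasure M {\<omega>\<in>space M. x < Y \<omega>} \<partial>lborel)"
    by (intro nn_integral_cong) (subst nn_integral_cmult, auto simp: mult_ac)
  finally show ?thesis .
qed

lemma nn_integral_powr_min_tail:
  fixes A \<beta> q :: real
  assumes "0 < q" "q < \<beta>" "0 < A"
  shows "(\<integral>\<^sup>+x\<in>{0<..}. ennreal (q * x powr (q - 1) * min 1 (A * x powr - \<beta>)) \<partial>lborel)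
    \<le> ennreal ((1 + q / (\<beta> - q)) * A powr (q / \<beta>))"
proof -
  \<comment> \<open>The point where \<open>A * x powr - \<beta>\<close> equals 1: the minimum is
    bounded by 1 below it and by the power above it. With \<open>A\<close> proportional to t, this
    produces the rate t^(q/\<beta>).\<close>
  define a where "a = A powr (1 / \<beta>)"
  have a: "0 < a" using assms by (simp add: a_def)
  have "((\<lambda>x. (A * q) * x powr (q - 1 - \<beta>)) has_integral ((A * q) * (- (a powr (q - 1 - \<beta> + 1)) / (q - 1 - \<beta> + 1)))) {a..}"
    using assms a by (intro has_integral_mult_right has_integral_powr_to_inf) auto
  from nn_integral_has_integral_lebesgue[OF _ this]
  have tail: "(\<integral>\<^sup>+x. ennreal (indicator {a..} x * (A * q * x powr (q - 1 - \<beta>))) \<partial>lborel)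
     = ennreal (A * q * a powr (q - \<beta>) / (\<beta> - q))"
    using assms by (simp add: field_simps minus_divide_left[symmetric] divide_simps)
  have "A * a powr (q - \<beta>) = A powr (q / \<beta>)"
    using assms by (simp add: a_def powr_powr diff_divide_distrib powr_diff)
  then have tail_eq: "A * q * a powr (q - \<beta>) / (\<beta> - q) = q / (\<beta> - q) * A powr (q / \<beta>)"
    by (simp add: field_simps)
  have "(\<integral>\<^sup>+x\<in>{0<..}. ennreal (q * x powr (q - 1) * min 1 (A * x powr - \<beta>)) \<partial>lborel)
    \<le> (\<integral>\<^sup>+x. ennreal (q * x powr (q - 1)) * indicator {0<..<a} x + ennreal (indicator {a..} x * (A * q * x powr (q - 1 - \<beta>))) \<partial>lborel)"
  proof (intro nn_integral_mono)
    fix x :: real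
    have "q * x powr (q - 1) * min 1 (A * x powr - \<beta>) \<le> q * x powr (q - 1) * 1"
      using assms by (intro mult_left_mono) auto
    moreover have "q * x powr (q - 1) * min 1 (A * x powr - \<beta>) \<le> q * x powr (q - 1) * (A * x powr - \<beta>)"
      using assms by (intro mult_left_mono) auto
    moreover have "q * x powr (q - 1) * (A * x powr - \<beta>) = A * q * x powr (q - 1 - \<beta>)"
      using powr_add[of x "q - 1" "- \<beta>"] by simp
    ultimately show "ennreal (q * x powr (q - 1) * min 1 (A * x powr - \<beta>)) * indicator {0<..} x
      \<le> ennreal (q * x powr (q - 1)) * indicator {0<..<a} x + ennreal (indicator {a..} x * (A * q * x powr (q - 1 - \<beta>)))"
      using a by (auto simp: indicator_def intro!: ennreal_leI)
  qed
  also have "\<dots> = ennreal (a powr q) + ennreal (A * q * a powr (q - \<beta>) / (\<beta> - q))"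
    using assms a by (subst nn_integral_add) (auto simp: nn_integral_powr_interval tail)
  also have "\<dots> = ennreal ((1 + q / (\<beta> - q)) * A powr (q / \<beta>))"
    using assms by (subst ennreal_plus[symmetric]) (auto simp: tail_eq, simp add: a_def powr_powr algebra_simps)
  finally show ?thesis .
qed

text \<open>For \<beta> < q the integrand is integrable at 0 without a cap, so the value stays
  linear in \<open>A\<close>; with \<open>A\<close> proportional to t this gives the order
  t.\<close>

lemma nn_integral_powr_head:
  fixes A \<beta> q L :: real
  assumes "0 < \<beta>" "\<beta> < q" "0 \<le> A" "0 < L"
  shows "(\<integral>\<^sup>+x\<in>{0<..<L}. ennreal (q * x powr (q - 1) * (A * x powr - \<beta>)) \<partial>lborel)
    = ennreal (A * (q / (q - \<beta>) * L powr (q - \<beta>)))"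
proof -
  have "(\<integral>\<^sup>+x\<in>{0<..<L}. ennreal (q * x powr (q - 1) * (A * x powr - \<beta>)) \<partial>lborel) =
     (\<integral>\<^sup>+x. ennreal (A * (q / (q - \<beta>))) * (ennreal ((q - \<beta>) * x powr (q - \<beta> - 1)) * indicator {0<..<L} x) \<partial>lborel)"
  proof (intro nn_integral_cong)
    fix x :: real
    have "q * x powr (q - 1) * (A * x powr - \<beta>) = A * (q / (q - \<beta>)) * ((q - \<beta>) * x powr (q - \<beta> - 1))"
      using assms powr_add[of x "q - 1" "- \<beta>"] by (simp add: diff_diff_eq add.commute)
    then show "ennreal (q * x powr (q - 1) * (A * x powr - \<beta>)) * indicator {0<..<L} x
      = ennreal (A * (q / (q - \<beta>))) * (ennreal ((q - \<beta>) * x powr (q - \<beta> - 1)) * indicator {0<..<L} x)"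
      using assms by (auto simp: indicator_def simp flip: ennreal_mult'')
  qed
  also have "\<dots> = ennreal (A * (q / (q - \<beta>))) * ennreal (L powr (q - \<beta>))"
    using assms by (subst nn_integral_cmult) (auto simp: nn_integral_powr_interval)
  finally show ?thesis
    using assms by (simp add: mult.assoc flip: ennreal_mult'')
qed

section \<open>Maximal and truncation inequalities\<close>

lemma borel_measurable_vec_nth [measurable (raw)]:
  fixes f :: "'a \<Rightarrow> real ^ 'd"
  assumes "f \<in> borel_measurable M"
  shows "(\<lambda>x. f x $ i) \<in> borel_measurable M"
  using borel_measurable_inner[OF assms borel_measurable_const[of "axis i 1"]]
  by (simp add: inner_axis)

text \<open>The integral equals a - sin(a y)/y, and |sin(a y)/y| is at most 1/|y|, hence at most a/2
  once |y| is at least 2/a. This is the pointwise form of the truncation inequality.\<close>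

lemma nn_integral_one_minus_cos:
  assumes "0 < a"
  shows "ennreal (a / 2) * indicator {y. 2 / a \<le> \<bar>y\<bar>} y
    \<le> (\<integral>\<^sup>+u\<in>{0..a}. ennreal (1 - cos (u * y)) \<partial>lborel)"
proof (cases "2 / a \<le> \<bar>y\<bar>")
  case True
  then have y: "y \<noteq> 0"
    using assms by auto
  have y_inv: "1 / \<bar>y\<bar> \<le> a / 2"
    using True assms y by (simp add: field_simps)
  define F where "F u = u - sin (u * y) / y" for u
  have "(\<integral>\<^sup>+u\<in>{0..a}. ennreal (1 - cos (u * y)) \<partial>lborel) = F a - F 0"
    using assms y by (intro nn_integral_FTC_Icc)
      (auto simp: F_def intro!: derivative_eq_intros)
  moreover have "\<bar>sin (a * y) / y\<bar> \<le> a / 2"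
    by (intro order_trans[OF _ y_inv]) (simp add: divide_right_mono)
  then have "sin (a * y) / y \<le> a / 2"
    by linarith
  ultimately show ?thesis
    using True by (auto simp: F_def intro!: ennreal_leI)
qed (simp add: indicator_def)

text \<open>Taking expectations in the pointwise bound and exchanging the integrals bounds a/2 times
  the probability by the integral of 1 - Re \<phi>(u) over [0, a], which is at most a G.\<close>

lemma (in prob_space) prob_abs_ge_le_char:
  fixes Y :: "'a \<Rightarrow> real"
  assumes [measurable]: "random_variable borel Y" and "0 < a"
    and G: "\<And>u. 0 \<le> u \<Longrightarrow> u \<le> a \<Longrightarrow> 1 - Re (CLINT \<omega>|M. iexp (u * Y \<omega>)) \<le> G"
  shows "prob {\<omega>\<in>space M. 2 / a \<le> \<bar>Y \<omega>\<bar>} \<le> 2 * G"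
proof -
  interpret pair_sigma_finite M lborel ..
  have int: "integrable M (\<lambda>\<omega>. iexp (u * Y \<omega>))" for u
    by (intro integrable_const_bound[where B=1]) auto
  have inner: "(\<integral>\<^sup>+\<omega>. ennreal (1 - cos (u * Y \<omega>)) \<partial>M) = ennreal (1 - Re (CLINT \<omega>|M. iexp (u * Y \<omega>)))" for u
  proof -
    have "integrable M (\<lambda>\<omega>. cos (u * Y \<omega>))"
      by (intro integrable_const_bound[where B=1]) auto
    moreover have "Re (CLINT \<omega>|M. iexp (u * Y \<omega>)) = (\<integral>\<omega>. cos (u * Y \<omega>) \<partial>M)"
      using int by (simp add: Re_exp flip: integral_Re)
    ultimately show ?thesis
      by (subst nn_integral_eq_integral) (auto simp: prob_space)
  qed
  have G0: "0 \<le> G"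
    using G[of 0] assms by (simp add: prob_space)
  have "ennreal (a / 2) * emeasure M {\<omega>\<in>space M. 2 / a \<le> \<bar>Y \<omega>\<bar>}
    = (\<integral>\<^sup>+\<omega>. ennreal (a / 2) * indicator {y. 2 / a \<le> \<bar>y\<bar>} (Y \<omega>) \<partial>M)"
    by (subst nn_integral_cmult_indicator[symmetric]) (auto intro!: nn_integral_cong simp: indicator_def)
  also have "\<dots> \<le> (\<integral>\<^sup>+\<omega>. \<integral>\<^sup>+u. ennreal (1 - cos (u * Y \<omega>)) * indicator {0..a} u \<partial>lborel \<partial>M)"
    using assms by (intro nn_integral_mono nn_integral_one_minus_cos)
  also have "\<dots> = (\<integral>\<^sup>+u. \<integral>\<^sup>+\<omega>. ennreal (1 - cos (u * Y \<omega>)) * indicator {0..a} u \<partial>M \<partial>lborel)"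
    by (intro Fubini'[symmetric]) measurable
  also have "\<dots> = (\<integral>\<^sup>+u. ennreal (1 - Re (CLINT \<omega>|M. iexp (u * Y \<omega>))) * indicator {0..a} u \<partial>lborel)"
    by (simp add: nn_integral_multc inner)
  also have "\<dots> \<le> (\<integral>\<^sup>+u. ennreal G * indicator {0..a} u \<partial>lborel)"
    using G by (intro nn_integral_mono) (auto simp: indicator_def intro!: ennreal_leI)
  also have "\<dots> = ennreal (G * a)"
    using assms G0 by (simp add: nn_integral_cmult ennreal_mult)
  finally have "ennreal (a / 2 * prob {\<omega>\<in>space M. 2 / a \<le> \<bar>Y \<omega>\<bar>}) \<le> ennreal (G * a)"
    using assms by (simp add: emeasure_eq_measure ennreal_mult del: ennreal_mult'' flip: ennreal_mult)
  then show ?thesis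
    using assms G0 by (simp add: field_simps)
qed

text \<open>The l1 norm dominates the Euclidean one, so norm above x forces some coordinate to reach
  x/d in modulus, with d the dimension. Solving x/d = 2/a gives the frequency range a = 2d/x, and
  the union bound over coordinates the factor d.\<close>

lemma (in prob_space) prob_norm_gt_le_char:
  fixes Y :: "'a \<Rightarrow> real ^ 'd"
  assumes [measurable]: "random_variable borel Y" and "0 < x"
    and G: "\<And>u. norm u \<le> 2 * real CARD('d) / x \<Longrightarrow> 1 - Re (CLINT \<omega>|M. iexp (u \<bullet> Y \<omega>)) \<le> G"
  shows "prob {\<omega>\<in>space M. x < norm (Y \<omega>)} \<le> 2 * real CARD('d) * G"
proof -
  define a where "a = 2 * real CARD('d) / x"
  have a: "0 < a" "x = real CARD('d) * (2 / a)"
    using assms by (auto simp: a_def)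
  have "prob {\<omega>\<in>space M. x < norm (Y \<omega>)} \<le> prob (\<Union>i\<in>UNIV. {\<omega>\<in>space M. 2 / a \<le> \<bar>Y \<omega> $ i\<bar>})"
  proof (intro finite_measure_mono subsetI)
    fix \<omega> assume \<omega>: "\<omega> \<in> {\<omega>\<in>space M. x < norm (Y \<omega>)}"
    show "\<omega> \<in> (\<Union>i\<in>UNIV. {\<omega>\<in>space M. 2 / a \<le> \<bar>Y \<omega> $ i\<bar>})"
    proof (rule ccontr)
      assume "\<not> ?thesis"
      then have "(\<Sum>i\<in>UNIV. \<bar>Y \<omega> $ i\<bar>) \<le> (\<Sum>i\<in>(UNIV::'d set). 2 / a)"
        using \<omega> by (intro sum_mono) (auto simp: not_le less_imp_le)
      then show False
        using \<omega> norm_le_l1_cart[of "Y \<omega>"] a(2) by simp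
    qed
  qed measurable
  also have "\<dots> \<le> (\<Sum>i\<in>UNIV. prob {\<omega>\<in>space M. 2 / a \<le> \<bar>Y \<omega> $ i\<bar>})"
    by (intro measure_subadditive_finite) auto
  also have "\<dots> \<le> (\<Sum>i\<in>(UNIV::'d set). 2 * (G::real))"
  proof (intro sum_mono prob_abs_ge_le_char a)
    fix i u assume u: "0 \<le> u" "u \<le> a"
    then show "1 - Re (CLINT \<omega>|M. iexp (u * Y \<omega> $ i)) \<le> G"
      using G[of "u *\<^sub>R axis i 1"] by (simp add: a_def inner_axis')
  qed measurable
  finally show ?thesis by simp
qed

text \<open>The event is split according to the first index at which the partial sum is large.\<close>

lemma (in prob_space) ottaviani:
  fixes X :: "nat \<Rightarrow> 'a \<Rightarrow> real ^ 'd"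
  assumes ind: "indep_vars (\<lambda>_. borel) X {..<N}"
    and half: "\<And>k. k \<le> N \<Longrightarrow> prob {\<omega>\<in>space M. y < norm (\<Sum>i\<in>{k..<N}. X i \<omega>)} \<le> 1 / 2"
  shows "prob {\<omega>\<in>space M. \<exists>k\<le>N. x + y < norm (\<Sum>i<k. X i \<omega>)}
    \<le> 2 * prob {\<omega>\<in>space M. x < norm (\<Sum>i<N. X i \<omega>)}"
proof -
  have X[measurable]: "random_variable borel (X i)" if "i < N" for i
    using ind that by (auto simp: indep_vars_def)
  have S: "random_variable borel (\<lambda>\<omega>. \<Sum>i<k. X i \<omega>)" if "k \<le> N" for k
    using that by (intro borel_measurable_sum) (auto intro!: X)
  have T: "random_variable borel (\<lambda>\<omega>. \<Sum>i\<in>{k..<N}. X i \<omega>)" for k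
    by (intro borel_measurable_sum) (auto intro!: X)
  define A where "A k = {\<omega>\<in>space M. x + y < norm (\<Sum>i<k. X i \<omega>) \<and> (\<forall>j<k. \<not> x + y < norm (\<Sum>i<j. X i \<omega>))}" for k
  define E where "E k = {\<omega>\<in>space M. norm (\<Sum>i\<in>{k..<N}. X i \<omega>) \<le> y}" for k
  have big: "{\<omega>\<in>space M. x + y < norm (\<Sum>i<k. X i \<omega>)} \<in> events" if "k \<le> N" for k
    using S[OF that] by measurable
  have A_sets: "A k \<in> events" if "k \<le> N" for k
  proof -
    have "A k = {\<omega>\<in>space M. x + y < norm (\<Sum>i<k. X i \<omega>)} - (\<Union>j<k. {\<omega>\<in>space M. x + y < norm (\<Sum>i<j. X i \<omega>)})"
      by (auto simp: A_def)
    also have "\<dots> \<in> events"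
      using big that by (intro sets.Diff sets.finite_UN) auto
    finally show ?thesis .
  qed
  have E_sets: "E k \<in> events" for k
    unfolding E_def using T[of k] by measurable
  have E_prob: "1 / 2 \<le> prob (E k)" if "k \<le> N" for k
  proof -
    have "space M - E k = {\<omega>\<in>space M. y < norm (\<Sum>i\<in>{k..<N}. X i \<omega>)}"
      by (auto simp: E_def)
    then show ?thesis
      using half[OF that] prob_compl[OF E_sets[of k]] by simp
  qed
  \<comment> \<open>\<open>A k\<close> depends only on the summands before \<open>k\<close>,
    \<open>E k\<close> only on those from \<open>k\<close> on. Both are rewritten as preimages of
    sets \<open>U\<close> and \<open>V\<close> in two product spaces, so that independence of the
    two blocks applies.\<close>
  have indep: "prob (A k \<inter> E k) = prob (A k) * prob (E k)" if k: "k \<le> N" for k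
  proof -
    define P where "P = PiM {..<k} (\<lambda>_. borel :: (real ^ 'd) measure)"
    define Q where "Q = PiM {k..<N} (\<lambda>_. borel :: (real ^ 'd) measure)"
    have indPQ: "indep_var P (\<lambda>\<omega>. restrict (\<lambda>i. X i \<omega>) {..<k}) Q (\<lambda>\<omega>. restrict (\<lambda>i. X i \<omega>) {k..<N})"
      unfolding P_def Q_def using k by (intro indep_var_restrict[OF ind]) auto
    define U where "U = {f\<in>space P. x + y < norm (\<Sum>i<k. f i) \<and> (\<forall>j<k. \<not> x + y < norm (\<Sum>i<j. f i))}"
    have big': "{f\<in>space P. x + y < norm (\<Sum>i<j. f i)} \<in> sets P" if "j \<le> k" for j
    proof -
      have "(\<lambda>f. \<Sum>i<j. f i) \<in> borel_measurable P"
        unfolding P_def using that by (intro borel_measurable_sum measurable_component_singleton) auto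
      then show ?thesis by measurable
    qed
    have "U = {f\<in>space P. x + y < norm (\<Sum>i<k. f i)} - (\<Union>j<k. {f\<in>space P. x + y < norm (\<Sum>i<j. f i)})"
      by (auto simp: U_def)
    also have "\<dots> \<in> sets P"
      using big' by (intro sets.Diff sets.finite_UN) auto
    finally have U: "U \<in> sets P" .
    define V where "V = {f\<in>space Q. norm (\<Sum>i\<in>{k..<N}. f i) \<le> y}"
    have V: "V \<in> sets Q"
      unfolding V_def Q_def by measurable
    have "prob ((\<lambda>\<omega>. (restrict (\<lambda>i. X i \<omega>) {..<k}, restrict (\<lambda>i. X i \<omega>) {k..<N})) -` (U \<times> V) \<inter> space M)
      = prob ((\<lambda>\<omega>. restrict (\<lambda>i. X i \<omega>) {..<k}) -` U \<inter> space M) * prob ((\<lambda>\<omega>. restrict (\<lambda>i. X i \<omega>) {k..<N}) -` V \<inter> space M)"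
      using indPQ U V by (rule indep_varD)
    moreover have "(\<lambda>\<omega>. (restrict (\<lambda>i. X i \<omega>) {..<k}, restrict (\<lambda>i. X i \<omega>) {k..<N})) -` (U \<times> V) \<inter> space M = A k \<inter> E k"
      by (auto simp: A_def E_def U_def V_def P_def Q_def space_PiM)
    moreover have "(\<lambda>\<omega>. restrict (\<lambda>i. X i \<omega>) {..<k}) -` U \<inter> space M = A k"
      by (auto simp: A_def U_def P_def space_PiM)
    moreover have "(\<lambda>\<omega>. restrict (\<lambda>i. X i \<omega>) {k..<N}) -` V \<inter> space M = E k"
      by (auto simp: E_def V_def Q_def space_PiM)
    ultimately show ?thesis
      by simp
  qed
  have disj: "disjoint_family_on A {..N}"
    unfolding disjoint_family_on_def A_def by (auto, metis linorder_neqE_nat)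
  then have disj': "disjoint_family_on (\<lambda>k. A k \<inter> E k) {..N}"
    unfolding disjoint_family_on_def by blast
  have "{\<omega>\<in>space M. \<exists>k\<le>N. x + y < norm (\<Sum>i<k. X i \<omega>)} = (\<Union>k\<le>N. A k)"
  proof (intro set_eqI iffI)
    fix \<omega> assume *: "\<omega> \<in> {\<omega>\<in>space M. \<exists>k\<le>N. x + y < norm (\<Sum>i<k. X i \<omega>)}"
    then obtain k where k: "k \<le> N" "x + y < norm (\<Sum>i<k. X i \<omega>)" by auto
    define m where "m = (LEAST k. x + y < norm (\<Sum>i<k. X i \<omega>))"
    have "m \<le> N" unfolding m_def using k by (meson Least_le order_trans)
    moreover have "\<omega> \<in> A m"
      unfolding A_def m_def using * k LeastI[of "\<lambda>k. x + y < norm (\<Sum>i<k. X i \<omega>)" k]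
      by (auto dest: not_less_Least)
    ultimately show "\<omega> \<in> (\<Union>k\<le>N. A k)" by blast
  qed (auto simp: A_def)
  then have "prob {\<omega>\<in>space M. \<exists>k\<le>N. x + y < norm (\<Sum>i<k. X i \<omega>)} = (\<Sum>k\<le>N. prob (A k))"
    using A_sets disj by (simp add: finite_measure_finite_Union image_subset_iff)
  also have "\<dots> \<le> (\<Sum>k\<le>N. 2 * prob (A k \<inter> E k))"
  proof (rule sum_mono)
    fix k assume "k \<in> {..N}"
    then have "prob (A k) * (1 / 2) \<le> prob (A k) * prob (E k)"
      by (intro mult_left_mono E_prob) auto
    then show "prob (A k) \<le> 2 * prob (A k \<inter> E k)"
      using indep[of k] \<open>k \<in> {..N}\<close> by simp
  qed
  also have "\<dots> = 2 * prob (\<Union>k\<le>N. A k \<inter> E k)"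
    unfolding sum_distrib_left[symmetric] using A_sets E_sets disj'
    by (subst finite_measure_finite_Union) (auto simp: image_subset_iff)
  also have "\<dots> \<le> 2 * prob {\<omega>\<in>space M. x < norm (\<Sum>i<N. X i \<omega>)}"
  proof (intro mult_left_mono finite_measure_mono subsetI)
    fix \<omega> assume "\<omega> \<in> (\<Union>k\<le>N. A k \<inter> E k)"
    then obtain k where k: "k \<le> N" "\<omega> \<in> space M" "x + y < norm (\<Sum>i<k. X i \<omega>)" "norm (\<Sum>i\<in>{k..<N}. X i \<omega>) \<le> y"
      by (auto simp: A_def E_def)
    moreover have "(\<Sum>i<N. X i \<omega>) = (\<Sum>i<k. X i \<omega>) + (\<Sum>i\<in>{k..<N}. X i \<omega>)"
      using k(1) by (metis sum.atLeastLessThan_concat atLeast0LessThan zero_le)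
    ultimately show "\<omega> \<in> {\<omega>\<in>space M. x < norm (\<Sum>i<N. X i \<omega>)}"
      using norm_diff_ineq[of "\<Sum>i<k. X i \<omega>" "\<Sum>i\<in>{k..<N}. X i \<omega>"] by auto
  qed (use big[of N] S[of N] in \<open>auto intro: measurable_sets\<close>)
  finally show ?thesis .
qed

section \<open>Exponents of pure-jump Levy processes\<close>

definition jump_integrand :: "real ^ 'd \<Rightarrow> real ^ 'd \<Rightarrow> complex" where
  "jump_integrand u w = iexp (u \<bullet> w) - 1 - \<i> * complex_of_real ((u \<bullet> w) * indicator {w. norm w < 1} w)"

definition pure_jump_exponent :: "real ^ 'd \<Rightarrow> (real ^ 'd) measure \<Rightarrow> real ^ 'd \<Rightarrow> complex" where
  "pure_jump_exponent \<gamma> \<nu> u = \<i> * complex_of_real (u \<bullet> \<gamma>) + (CLINT w|\<nu>. jump_integrand u w)"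

text \<open>A majorant of \<open>jump_integrand\<close> that depends on the frequency only through
  its norm \<open>r\<close> and is monotone in \<open>r\<close>, hence uniform over balls. For small
  jumps both the linear and the quadratic bound are kept, since powers between 1 and 2 interpolate
  between them.\<close>

definition jump_bound :: "real \<Rightarrow> real ^ 'd \<Rightarrow> real" where
  "jump_bound r w = (if norm w < 1 then min (2 * r * norm w) (r\<^sup>2 * (norm w)\<^sup>2) else min 2 (r * norm w))"

lemma jump_bound_nonneg: "0 \<le> r \<Longrightarrow> 0 \<le> jump_bound r w"
  by (simp add: jump_bound_def)

lemma abs_jump_bound [simp]: "0 \<le> r \<Longrightarrow> \<bar>jump_bound r w\<bar> = jump_bound r w"
  by (simp add: jump_bound_nonneg)

lemma jump_bound_mono:
  assumes "0 \<le> r" "r \<le> r'"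
  shows "jump_bound r w \<le> jump_bound r' w"
proof (cases "norm w < 1")
  case True
  have "min (2 * r * norm w) (r\<^sup>2 * (norm w)\<^sup>2) \<le> min (2 * r' * norm w) (r'\<^sup>2 * (norm w)\<^sup>2)"
    using assms by (intro min.mono mult_mono power_mono) auto
  then show ?thesis using True by (simp add: jump_bound_def)
next
  case False
  have "min 2 (r * norm w) \<le> min 2 (r' * norm w)"
    using assms by (intro min.mono mult_mono) auto
  then show ?thesis using False by (simp add: jump_bound_def)
qed

lemma cmod_jump_integrand_le:
  "cmod (jump_integrand u w) \<le> jump_bound (norm u) w"
proof -
  have uw: "\<bar>u \<bullet> w\<bar> \<le> norm u * norm w"
    by (rule Cauchy_Schwarz_ineq2)
  show ?thesis
  proof (cases "norm w < 1")
    case True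
    have "(u \<bullet> w)\<^sup>2 \<le> (norm u * norm w)\<^sup>2"
      using uw by (metis abs_ge_zero power2_abs power_mono)
    then have "cmod (iexp (u \<bullet> w) - 1 - \<i> * complex_of_real (u \<bullet> w)) \<le> (norm u)\<^sup>2 * (norm w)\<^sup>2"
      using cmod_iexp_minus_linear_le(2)[of "u \<bullet> w"] zero_le_power2[of "u \<bullet> w"]
      unfolding power_mult_distrib by linarith
    moreover have "cmod (iexp (u \<bullet> w) - 1 - \<i> * complex_of_real (u \<bullet> w)) \<le> 2 * norm u * norm w"
      using uw cmod_iexp_minus_linear_le(1)[of "u \<bullet> w"] by linarith
    ultimately show ?thesis
      using True by (simp add: jump_bound_def jump_integrand_def)
  next
    case False
    then show ?thesis
      using uw cmod_iexp_minus_one_le[of "u \<bullet> w"] by (auto simp: jump_bound_def jump_integrand_def)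
  qed
qed

text \<open>Serves only for pointwise limits in \<open>r\<close>, because \<open>norm w\<close> may
  fail to be \<nu>-integrable; the dominating function comes from
  \<open>jump_bound_le_min\<close>.\<close>

lemma jump_bound_le_linear:
  assumes "0 \<le> r"
  shows "jump_bound r w \<le> 2 * r * norm w"
  using mult_nonneg_nonneg[OF assms norm_ge_zero[of w]] by (auto simp: jump_bound_def min_def)

lemma jump_bound_le_min:
  assumes "0 \<le> r"
  shows "jump_bound r w \<le> 2 * max 1 (r\<^sup>2) * min 1 ((norm w)\<^sup>2)"
proof (cases "norm w < 1")
  case True
  then have "(norm w)\<^sup>2 \<le> 1"
    by (simp add: power_le_one)
  moreover have "r\<^sup>2 * (norm w)\<^sup>2 \<le> (2 * max 1 (r\<^sup>2)) * (norm w)\<^sup>2"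
    by (intro mult_right_mono) auto
  ultimately show ?thesis
    using True by (auto simp: jump_bound_def min_def)
next
  case False
  then have "1 \<le> (norm w)\<^sup>2"
    by simp
  then show ?thesis
    using False by (auto simp: jump_bound_def)
qed

text \<open>With y = r |w| the small-jump part is min(2y, y^2), which is at most 2 y^p for p in
  [1,2]: y^2 is at most y^p if y is at most 1, and y is at most y^p otherwise. Jumps of norm at
  least 1 cost at most 2 each.\<close>

lemma jump_bound_le_powr:
  assumes "0 \<le> r" "1 \<le> p" "p \<le> 2"
  shows "jump_bound r w \<le> 2 * r powr p * (norm w powr p * indicator {w. 0 < norm w \<and> norm w < 1} w)
    + 2 * indicator {w. 1 \<le> norm w} w"
proof (cases "0 < norm w \<and> norm w < 1")
  case True
  define y where "y = r * norm w"
  have y: "0 \<le> y" using assms by (simp add: y_def)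
  have "min (2 * y) (y\<^sup>2) \<le> 2 * y powr p"
  proof (cases "y \<le> 1")
    case True
    have "y\<^sup>2 = y powr 2" using y by simp
    also have "\<dots> \<le> y powr p" using y True assms by (intro powr_mono') auto
    finally show ?thesis using powr_ge_zero[of y p] by linarith
  next
    case False
    then have "y powr 1 \<le> y powr p" using assms by (intro powr_mono) auto
    then show ?thesis using False by auto
  qed
  then show ?thesis
    using True assms by (simp add: jump_bound_def y_def powr_mult power_mult_distrib mult.assoc)
next
  case False
  then show ?thesis
    using assms by (cases "w = 0") (auto simp: jump_bound_def)
qed

locale levy_jumps =
  fixes \<nu> :: "(real ^ 'd) measure"
  assumes levy_measure: "levy_measure \<nu>"
begin

lemma sets_nu [measurable_cong, simp]: "sets \<nu> = sets borel"
  using levy_measure by (simp add: levy_measure_def)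

lemma space_nu [simp]: "space \<nu> = UNIV"
  using sets_eq_imp_space_eq[OF sets_nu] by simp

lemma integrable_min: "integrable \<nu> (\<lambda>w. min 1 ((norm w)\<^sup>2))"
  using levy_measure by (intro integrableI_nonneg) (auto simp: levy_measure_def)

lemma emeasure_norm_ge_finite:
  assumes "0 < e"
  shows "emeasure \<nu> {w. e \<le> norm w} < \<infinity>"
proof -
  define c where "c = min 1 (e\<^sup>2)"
  have c: "0 < c" using assms by (simp add: c_def)
  have "emeasure \<nu> {w. e \<le> norm w} = (\<integral>\<^sup>+w. indicator {w. e \<le> norm w} w \<partial>\<nu>)"
    by simp
  also have "\<dots> \<le> (\<integral>\<^sup>+w. ennreal (1 / c) * ennreal (min 1 ((norm w)\<^sup>2)) \<partial>\<nu>)"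
  proof (intro nn_integral_mono)
    fix w :: "real ^ 'd"
    have "c \<le> min 1 ((norm w)\<^sup>2)" if "e \<le> norm w"
      unfolding c_def using that assms by (intro min.mono power_mono) auto
    then show "indicator {w. e \<le> norm w} w \<le> ennreal (1 / c) * ennreal (min 1 ((norm w)\<^sup>2))"
      using c by (auto simp: indicator_def field_simps simp flip: ennreal_mult'' ennreal_1 intro!: ennreal_leI)
  qed
  also have "\<dots> < \<infinity>"
    using levy_measure by (subst nn_integral_cmult) (auto simp: levy_measure_def ennreal_mult_less_top)
  finally show ?thesis .
qed

text \<open>A Levy measure can have infinite mass only near the origin: \<open>{0}\<close> is null
  and each set {|w| >= 1/(n+1)} has finite mass. This allows exchanging integration over jumps and
  over the tail level.\<close>

sublocale jumps: sigma_finite_measure \<nu>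
proof
  define \<A> where "\<A> = insert {0} (range (\<lambda>n. {w :: real ^ 'd. inverse (real (Suc n)) \<le> norm w}))"
  have "w \<in> \<Union>\<A>" for w
  proof (cases "w = 0")
    case False
    then obtain n where "inverse (real (Suc n)) < norm w"
      using reals_Archimedean[of "norm w"] by auto
    then show ?thesis by (auto simp: \<A>_def intro!: less_imp_le)
  qed (simp add: \<A>_def)
  moreover have "emeasure \<nu> a \<noteq> \<infinity>" if "a \<in> \<A>" for a
    using that levy_measure emeasure_norm_ge_finite
    by (auto simp: \<A>_def levy_measure_def less_top)
  ultimately show "\<exists>A. countable A \<and> A \<subseteq> sets \<nu> \<and> \<Union> A = space \<nu> \<and> (\<forall>a\<in>A. emeasure \<nu> a \<noteq> \<infinity>)"
    by (intro exI[of _ \<A>]) (auto simp: \<A>_def)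
qed

lemma borel_measurable_jump_bound [measurable]: "jump_bound r \<in> borel_measurable borel"
  unfolding jump_bound_def[abs_def] by measurable

lemma borel_measurable_jump_integrand [measurable]: "jump_integrand u \<in> borel_measurable borel"
  unfolding jump_integrand_def[abs_def] by measurable

lemma integrable_jump_bound:
  assumes "0 \<le> r"
  shows "integrable \<nu> (jump_bound r)"
proof (rule Bochner_Integration.integrable_bound)
  show "integrable \<nu> (\<lambda>w. 2 * max 1 (r\<^sup>2) * min 1 ((norm w)\<^sup>2))"
    by (intro integrable_mult_right integrable_min)
  show "AE w in \<nu>. norm (jump_bound r w) \<le> norm (2 * max 1 (r\<^sup>2) * min 1 ((norm w)\<^sup>2))"
    using assms by (intro AE_I2) (simp add: abs_mult jump_bound_le_min)
qed measurable

lemma integrable_jump_integrand: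
  "integrable \<nu> (jump_integrand u)"
proof (rule Bochner_Integration.integrable_bound)
  show "AE w in \<nu>. norm (jump_integrand u w) \<le> norm (jump_bound (norm u) w)"
    using cmod_jump_integrand_le by (intro AE_I2) simp
qed (auto intro: integrable_jump_bound)

lemma cmod_pure_jump_exponent_le:
  "cmod (pure_jump_exponent \<gamma> \<nu> u) \<le> norm u * norm \<gamma> + (\<integral>w. jump_bound (norm u) w \<partial>\<nu>)"
proof -
  have "cmod (pure_jump_exponent \<gamma> \<nu> u) \<le> \<bar>u \<bullet> \<gamma>\<bar> + (\<integral>w. jump_bound (norm u) w \<partial>\<nu>)"
    unfolding pure_jump_exponent_def
  proof (intro order_trans[OF norm_triangle_ineq] add_mono)
    show "cmod (CLINT w|\<nu>. jump_integrand u w) \<le> (\<integral>w. jump_bound (norm u) w \<partial>\<nu>)"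
      by (intro order_trans[OF integral_norm_bound] integral_mono integrable_norm
          integrable_jump_integrand integrable_jump_bound cmod_jump_integrand_le norm_ge_zero)
  qed (simp add: norm_mult)
  then show ?thesis
    using Cauchy_Schwarz_ineq2[of u \<gamma>] by linarith
qed

text \<open>Drift and compensator are purely imaginary and drop out; what remains is quadratic in
  \<open>u \<bullet> w\<close> near 0.\<close>

lemma Re_pure_jump_exponent:
  "Re (pure_jump_exponent \<gamma> \<nu> u) = - (\<integral>w. 1 - cos (u \<bullet> w) \<partial>\<nu>)"
proof -
  have "Re (pure_jump_exponent \<gamma> \<nu> u) = (\<integral>w. Re (jump_integrand u w) \<partial>\<nu>)"
    using integral_Re[OF integrable_jump_integrand[of u]] by (simp add: pure_jump_exponent_def)
  also have "\<dots> = (\<integral>w. - (1 - cos (u \<bullet> w)) \<partial>\<nu>)"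
    by (simp add: jump_integrand_def Re_exp)
  finally show ?thesis
    by (simp only: integral_minus)
qed

lemma small_jump_moment_mono:
  assumes "p \<le> p'"
  shows "small_jump_moment \<nu> p' \<le> small_jump_moment \<nu> p"
  unfolding small_jump_moment_def using assms
  by (intro nn_integral_mono) (auto simp: indicator_def intro!: ennreal_leI powr_mono')

lemma small_jump_moment_2_finite: "small_jump_moment \<nu> 2 < \<infinity>"
proof -
  have "small_jump_moment \<nu> 2 \<le> (\<integral>\<^sup>+w. ennreal (min 1 ((norm w)\<^sup>2)) \<partial>\<nu>)"
    unfolding small_jump_moment_def
    by (intro nn_integral_mono) (auto simp: indicator_def power_le_one intro!: ennreal_leI)
  then show ?thesis
    using levy_measure by (auto simp: levy_measure_def)
qed

text \<open>The set defining the index contains 2, so its infimum is a genuine one and is approached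
  from within; finiteness passes to larger exponents because only jumps with |w| < 1 are
  counted.\<close>

lemma small_jump_moment_finite_above_index:
  assumes "blumenthal_getoor_index \<nu> < p"
  shows "small_jump_moment \<nu> p < \<infinity>"
proof -
  have "\<exists>p'\<in>{p. 0 < p \<and> small_jump_moment \<nu> p < \<infinity>}. p' < p"
    using assms small_jump_moment_2_finite unfolding blumenthal_getoor_index_def
    by (intro cInf_lessD) (auto intro!: exI[of _ 2])
  then show ?thesis
    using small_jump_moment_mono[of _ p] by (metis (mono_tags, lifting) le_less_trans less_imp_le mem_Collect_eq)
qed

text \<open>Guarantees that in the infinite-variation case every exponent above the index exceeds 1,
  as the power bound on the exponent requires.\<close>

lemma one_le_blumenthal_getoor_index:
  assumes "\<not> finite_variation \<nu>"
  shows "1 \<le> blumenthal_getoor_index \<nu>"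
  using assms small_jump_moment_finite_above_index[of 1] by (force simp: finite_variation_def)

text \<open>The small-jump moment of order p supplies the power, jumps of norm at least 1 the
  constant, and the linear drift term is absorbed through |u| <= 1 + |u|^p, valid for p >=
  1.\<close>

lemma cmod_pure_jump_exponent_le_powr:
  assumes p: "1 \<le> p" "p \<le> 2" and fin: "small_jump_moment \<nu> p < \<infinity>"
  obtains C where "0 < C" "\<And>u. cmod (pure_jump_exponent \<gamma> \<nu> u) \<le> C * (1 + norm u powr p)"
proof -
  define m where "m w = norm w powr p * indicator {w. 0 < norm w \<and> norm w < 1} w" for w :: "real ^ 'd"
  define n where "n = measure \<nu> {w. 1 \<le> norm w}"
  have [simp]: "integrable \<nu> m"
    using fin unfolding m_def small_jump_moment_def
    by (intro integrableI_nonneg) (auto simp: ennreal_mult ennreal_indicator)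
  have [simp]: "integrable \<nu> (indicator {w. 1 \<le> norm w} :: _ \<Rightarrow> real)"
    using emeasure_norm_ge_finite[of 1] by (intro integrable_real_indicator) auto
  define I where "I = (\<integral>w. m w \<partial>\<nu>)"
  have I: "0 \<le> I" "0 \<le> n" by (auto simp: I_def m_def n_def)
  show thesis
  proof (rule that[of "1 + norm \<gamma> + 2 * I + 2 * n"])
    fix u :: "real ^ 'd"
    have "(\<integral>w. jump_bound (norm u) w \<partial>\<nu>) \<le> (\<integral>w. 2 * norm u powr p * m w + 2 * indicator {w. 1 \<le> norm w} w \<partial>\<nu>)"
    proof (intro integral_mono integrable_jump_bound)
      show "integrable \<nu> (\<lambda>w. 2 * norm u powr p * m w + 2 * indicator {w. 1 \<le> norm w} w)"
        by simp
    qed (use jump_bound_le_powr[OF norm_ge_zero p] in \<open>simp_all add: m_def\<close>)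
    also have "\<dots> = 2 * norm u powr p * I + 2 * n"
      by (simp add: I_def n_def)
    finally have "cmod (pure_jump_exponent \<gamma> \<nu> u) \<le> norm u * norm \<gamma> + (2 * norm u powr p * I + 2 * n)"
      using cmod_pure_jump_exponent_le[of \<gamma> u] by linarith
    moreover have "norm u \<le> 1 + norm u powr p"
    proof (cases "norm u \<le> 1")
      case False
      then have "norm u powr 1 \<le> norm u powr p" using p by (intro powr_mono) auto
      then show ?thesis using False by simp
    qed (simp add: add_increasing2)
    then have "norm u * norm \<gamma> \<le> (1 + norm u powr p) * norm \<gamma>"
      by (rule mult_right_mono) simp
    moreover have "0 \<le> I" "0 \<le> n * norm u powr p" "0 \<le> norm u powr p"
      using I by auto
    ultimately show "cmod (pure_jump_exponent \<gamma> \<nu> u) \<le> (1 + norm \<gamma> + 2 * I + 2 * n) * (1 + norm u powr p)"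
      by (simp only: algebra_simps)
  qed (use I norm_ge_zero[of \<gamma>] in linarith)
qed

text \<open>Continuity at the origin, uniform in the direction of \<open>u\<close>, which yields
  tightness of S over [0,1]. The radius is written as 1/s so that dominated convergence runs along
  \<open>at_top\<close>.\<close>

lemma pure_jump_exponent_at_0:
  assumes "0 < e"
  obtains r where "0 < r" "\<And>u. norm u \<le> r \<Longrightarrow> cmod (pure_jump_exponent \<gamma> \<nu> u) \<le> e"
proof -
  have inverse_0: "((\<lambda>s :: real. 1 / s) \<longlongrightarrow> 0) at_top"
    by (rule tendsto_divide_0[OF tendsto_const filterlim_at_top_imp_at_infinity[OF filterlim_ident]])
  have "((\<lambda>s. \<integral>w. jump_bound (1 / s) w \<partial>\<nu>) \<longlongrightarrow> (\<integral>w. 0 \<partial>\<nu>)) at_top"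
  proof (rule integral_dominated_convergence_at_top)
    show "integrable \<nu> (\<lambda>w. 2 * min 1 ((norm w)\<^sup>2))"
      by (intro integrable_mult_right integrable_min)
    show "\<forall>\<^sub>F s in at_top. AE w in \<nu>. norm (jump_bound (1 / s) w) \<le> 2 * min 1 ((norm w)\<^sup>2)"
      using eventually_ge_at_top[of 1]
    proof eventually_elim
      case (elim s)
      then have "(1 / s)\<^sup>2 \<le> 1"
        by (intro power_le_one) auto
      then have "max 1 ((1 / s)\<^sup>2) = 1"
        by simp
      then show ?case
        using jump_bound_le_min[of "1 / s"] elim by (intro AE_I2) simp
    qed
    show "AE w in \<nu>. ((\<lambda>s. jump_bound (1 / s) w) \<longlongrightarrow> 0) at_top"
    proof (intro AE_I2, rule tendsto_sandwich[where f="\<lambda>_. 0"])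
      fix w :: "real ^ 'd"
      show "\<forall>\<^sub>F s in at_top. jump_bound (1 / s) w \<le> 2 * (1 / s) * norm w"
        using eventually_gt_at_top[of 0] by eventually_elim (rule jump_bound_le_linear, simp)
      show "((\<lambda>s. 2 * (1 / s) * norm w) \<longlongrightarrow> 0) at_top"
        using tendsto_mult_right[OF inverse_0, of "2 * norm w"] by (simp add: mult_ac)
      show "\<forall>\<^sub>F s in at_top. 0 \<le> jump_bound (1 / s) w"
        using eventually_gt_at_top[of 0] by eventually_elim (rule jump_bound_nonneg, simp)
    qed auto
  qed measurable
  moreover have "((\<lambda>s. (1 / s) * norm \<gamma>) \<longlongrightarrow> 0 * norm \<gamma>) at_top"
    by (rule tendsto_mult_right[OF inverse_0])
  ultimately have "((\<lambda>s. (1 / s) * norm \<gamma> + (\<integral>w. jump_bound (1 / s) w \<partial>\<nu>)) \<longlongrightarrow> 0) at_top"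
    using tendsto_add by force
  then have "\<forall>\<^sub>F s in at_top. (1 / s) * norm \<gamma> + (\<integral>w. jump_bound (1 / s) w \<partial>\<nu>) < e"
    using assms by (rule order_tendstoD(2))
  with eventually_gt_at_top[of 0]
  have "\<forall>\<^sub>F s in at_top. 0 < s \<and> (1 / s) * norm \<gamma> + (\<integral>w. jump_bound (1 / s) w \<partial>\<nu>) < e"
    by eventually_elim auto
  then obtain s where s: "0 < s" "(1 / s) * norm \<gamma> + (\<integral>w. jump_bound (1 / s) w \<partial>\<nu>) < e"
    using eventually_happens trivial_limit_at_top_linorder by blast
  show thesis
  proof (rule that[of "1 / s"])
    fix u :: "real ^ 'd" assume u: "norm u \<le> 1 / s"
    have "(\<integral>w. jump_bound (norm u) w \<partial>\<nu>) \<le> (\<integral>w. jump_bound (1 / s) w \<partial>\<nu>)"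
      using s u by (intro integral_mono integrable_jump_bound jump_bound_mono) auto
    moreover have "norm u * norm \<gamma> \<le> (1 / s) * norm \<gamma>"
      using u by (rule mult_right_mono) simp
    ultimately show "cmod (pure_jump_exponent \<gamma> \<nu> u) \<le> e"
      using cmod_pure_jump_exponent_le[of \<gamma> u] s by linarith
  qed (use s in simp)
qed

text \<open>The absence of a Gaussian part enters here. Divided by r^2, the majorant is dominated by
  2 min(1, |w|^2) for r >= 1 and is O(1/r) for each fixed w.\<close>

lemma pure_jump_exponent_at_infinity:
  assumes "0 < e"
  shows "\<forall>\<^sub>F r in at_top. \<forall>u. norm u = r \<longrightarrow> cmod (pure_jump_exponent \<gamma> \<nu> u) \<le> e * r\<^sup>2"
proof -
  have "((\<lambda>r. \<integral>w. jump_bound r w / r\<^sup>2 \<partial>\<nu>) \<longlongrightarrow> (\<integral>w. 0 \<partial>\<nu>)) at_top"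
  proof (rule integral_dominated_convergence_at_top)
    show "integrable \<nu> (\<lambda>w. 2 * min 1 ((norm w)\<^sup>2))"
      by (intro integrable_mult_right integrable_min)
    show "\<forall>\<^sub>F r in at_top. AE w in \<nu>. norm (jump_bound r w / r\<^sup>2) \<le> 2 * min 1 ((norm w)\<^sup>2)"
      using eventually_ge_at_top[of 1]
    proof eventually_elim
      case (elim r)
      then have "max 1 (r\<^sup>2) = r\<^sup>2"
        by simp
      then have "jump_bound r w \<le> (2 * min 1 ((norm w)\<^sup>2)) * r\<^sup>2" for w :: "real ^ 'd"
        using jump_bound_le_min[of r w] elim by (simp add: ac_simps)
      then show ?case
        using elim by (intro AE_I2) (simp add: pos_divide_le_eq)
    qed
    show "AE w in \<nu>. ((\<lambda>r. jump_bound r w / r\<^sup>2) \<longlongrightarrow> 0) at_top"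
    proof (intro AE_I2, rule tendsto_sandwich[where f="\<lambda>_. 0"])
      fix w :: "real ^ 'd"
      show "\<forall>\<^sub>F r in at_top. jump_bound r w / r\<^sup>2 \<le> 2 * norm w / r"
        using eventually_gt_at_top[of 0]
      proof eventually_elim
        case (elim r)
        then show ?case
          using divide_right_mono[OF jump_bound_le_linear[of r w], of "r\<^sup>2"]
          by (simp add: power2_eq_square)
      qed
      show "((\<lambda>r. 2 * norm w / r) \<longlongrightarrow> 0) at_top"
        by (rule tendsto_divide_0[OF tendsto_const filterlim_at_top_imp_at_infinity[OF filterlim_ident]])
      show "\<forall>\<^sub>F r in at_top. 0 \<le> jump_bound r w / r\<^sup>2"
        using eventually_gt_at_top[of 0] by eventually_elim (simp add: jump_bound_nonneg)
    qed auto
  qed measurable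
  moreover have "((\<lambda>r. norm \<gamma> / r) \<longlongrightarrow> 0) at_top"
    by (rule tendsto_divide_0[OF tendsto_const filterlim_at_top_imp_at_infinity[OF filterlim_ident]])
  ultimately have "((\<lambda>r. norm \<gamma> / r + (\<integral>w. jump_bound r w / r\<^sup>2 \<partial>\<nu>)) \<longlongrightarrow> 0) at_top"
    using tendsto_add by force
  then have "\<forall>\<^sub>F r in at_top. norm \<gamma> / r + (\<integral>w. jump_bound r w / r\<^sup>2 \<partial>\<nu>) < e"
    using assms by (rule order_tendstoD(2))
  with eventually_gt_at_top[of 0] show ?thesis
  proof eventually_elim
    case (elim r)
    have "norm \<gamma> / r + (\<integral>w. jump_bound r w / r\<^sup>2 \<partial>\<nu>) = (r * norm \<gamma> + (\<integral>w. jump_bound r w \<partial>\<nu>)) / r\<^sup>2"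
      using elim by (simp add: field_simps power2_eq_square)
    then have "r * norm \<gamma> + (\<integral>w. jump_bound r w \<partial>\<nu>) \<le> e * r\<^sup>2"
      using elim by (simp add: pos_divide_less_eq less_imp_le)
    then show ?case
      using cmod_pure_jump_exponent_le[of \<gamma>] by (auto intro: order_trans)
  qed
qed

end

section \<open>Tails of pure-jump Levy processes\<close>

text \<open>Turns a bound \<open>z\<close> on the probability that at least one of n independent
  events occurs into one on their expected number n p: (1 - p)^n is at most 1/(1 + n p), whence n p
  (1 - z) <= z, and z <= 1/2 gives the factor 2.\<close>

lemma one_minus_power_bernoulli:
  fixes p z :: real
  assumes "0 \<le> p" "p \<le> 1" and z: "1 - (1 - p) ^ n \<le> z" "z \<le> 1 / 2"
  shows "n * p \<le> 2 * z"
proof -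
  have "(1 - p) ^ n \<le> exp (- p) ^ n"
    using assms exp_ge_add_one_self[of "- p"] by (intro power_mono) auto
  also have "\<dots> = inverse (exp (n * p))"
    by (simp add: exp_of_nat_mult exp_minus power_inverse)
  also have "\<dots> \<le> inverse (1 + n * p)"
    using assms exp_ge_add_one_self[of "n * p"] by (intro le_imp_inverse_le) (auto intro: add_pos_nonneg)
  finally have "1 - z \<le> inverse (1 + n * p)"
    using z by linarith
  moreover have np: "0 \<le> n * p" using assms by simp
  ultimately have "(1 - z) * (1 + n * p) \<le> 1"
    by (simp add: field_simps)
  moreover have "n * p * (1 / 2) \<le> n * p * (1 - z)"
    using np z by (intro mult_left_mono) auto
  ultimately show ?thesis
    by (simp add: algebra_simps)
qed

locale pure_jump_levy_process = prob_space M + levy_jumps \<nu>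
  for M :: "'a measure" and \<nu> :: "(real ^ 'd) measure" +
  fixes S :: "real \<Rightarrow> 'a \<Rightarrow> real ^ 'd" and \<gamma> :: "real ^ 'd"
  assumes levy_process: "levy_process M S"
    and exponent: "levy_khintchine_exponent M S (pure_jump_exponent \<gamma> \<nu>)"
begin

abbreviation "\<psi> \<equiv> pure_jump_exponent \<gamma> \<nu>"

abbreviation tail :: "real \<Rightarrow> real \<Rightarrow> real" where
  "tail s x \<equiv> prob {\<omega>\<in>space M. x < norm (S s \<omega>)}"

lemma random_variable_S [measurable]: "0 \<le> t \<Longrightarrow> t \<le> 1 \<Longrightarrow> random_variable borel (S t)"
  using levy_process by (auto simp: levy_process_def)

lemma S_0: "AE \<omega> in M. S 0 \<omega> = 0"
  using levy_process by (auto simp: levy_process_def)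

lemma char_S: "0 \<le> t \<Longrightarrow> t \<le> 1 \<Longrightarrow> (CLINT \<omega>|M. iexp (u \<bullet> S t \<omega>)) = exp (complex_of_real t * \<psi> u)"
  using exponent by (auto simp: levy_khintchine_exponent_def)

lemma Re_exponent_nonpos: "Re (\<psi> u) \<le> 0"
proof -
  have "cmod (CLINT \<omega>|M. iexp (u \<bullet> S 1 \<omega>)) \<le> (\<integral>\<omega>. 1 \<partial>M)"
    by (rule order_trans[OF integral_norm_bound]) (simp add: prob_space)
  then show ?thesis
    by (simp add: char_S prob_space)
qed

text \<open>The first bound is enough whenever the growth of |\<psi>| decides. The second keeps Re
  \<psi> as the only term of first order in s and is reserved for the borderline case.\<close>

lemma one_minus_Re_char_le:
  assumes "0 \<le> s" "s \<le> 1"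
  shows "1 - Re (CLINT \<omega>|M. iexp (u \<bullet> S s \<omega>)) \<le> s * cmod (\<psi> u)"
    and "1 - Re (CLINT \<omega>|M. iexp (u \<bullet> S s \<omega>)) \<le> s * - Re (\<psi> u) + s\<^sup>2 * (cmod (\<psi> u))\<^sup>2"
proof -
  have Re: "Re (complex_of_real s * \<psi> u) \<le> 0"
    using assms Re_exponent_nonpos[of u] by (simp add: mult_nonneg_nonpos)
  have "1 - Re (exp (complex_of_real s * \<psi> u)) \<le> cmod (exp (complex_of_real s * \<psi> u) - 1)"
    using abs_Re_le_cmod[of "exp (complex_of_real s * \<psi> u) - 1"] by simp
  also have "\<dots> \<le> s * cmod (\<psi> u)"
    using cmod_exp_minus_one_le[OF Re] assms by (simp add: norm_mult)
  finally show "1 - Re (CLINT \<omega>|M. iexp (u \<bullet> S s \<omega>)) \<le> s * cmod (\<psi> u)"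
    by (simp add: char_S assms)
  have "(Im (\<psi> u))\<^sup>2 \<le> (cmod (\<psi> u))\<^sup>2"
    using abs_Im_le_cmod[of "\<psi> u"] by (metis abs_ge_zero power2_abs power_mono)
  then have "s\<^sup>2 * (Im (\<psi> u))\<^sup>2 \<le> s\<^sup>2 * (cmod (\<psi> u))\<^sup>2"
    by (rule mult_left_mono) simp
  then have "(s * Im (\<psi> u))\<^sup>2 / 2 \<le> s\<^sup>2 * (cmod (\<psi> u))\<^sup>2"
    using zero_le_power2[of "s * Im (\<psi> u)"] unfolding power_mult_distrib by linarith
  then show "1 - Re (CLINT \<omega>|M. iexp (u \<bullet> S s \<omega>)) \<le> s * - Re (\<psi> u) + s\<^sup>2 * (cmod (\<psi> u))\<^sup>2"
    using one_minus_Re_exp_le[OF Re] by (simp add: char_S assms)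
qed

lemma prob_increment:
  assumes "0 \<le> s" "s \<le> t" "t \<le> 1"
  shows "prob {\<omega>\<in>space M. x < norm (S t \<omega> - S s \<omega>)} = tail (t - s) x"
proof -
  have [measurable]: "random_variable borel (S s)" "random_variable borel (S t)"
     "random_variable borel (S 0)" "random_variable borel (S (t - s))"
    using assms by (auto intro!: random_variable_S)
  have "distr M borel (\<lambda>\<omega>. S t \<omega> - S s \<omega>) = distr M borel (\<lambda>\<omega>. S (t - s) \<omega> - S 0 \<omega>)"
  proof -
    have "\<forall>s h. 0 \<le> s \<longrightarrow> 0 \<le> h \<longrightarrow> s + h \<le> 1 \<longrightarrow>
        distr M borel (\<lambda>\<omega>. S (s + h) \<omega> - S s \<omega>) = distr M borel (\<lambda>\<omega>. S h \<omega> - S 0 \<omega>)"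
      using levy_process unfolding levy_process_def by blast
    from this[rule_format, of s "t - s"] show ?thesis
      using assms by simp
  qed
  also have "\<dots> = distr M borel (S (t - s))"
    using S_0 by (intro distr_cong_AE) auto
  finally have "measure (distr M borel (\<lambda>\<omega>. S t \<omega> - S s \<omega>)) {z. x < norm z}
    = measure (distr M borel (S (t - s))) {z. x < norm z}"
    by simp
  then show ?thesis
    by (simp add: measure_distr vimage_def Int_def conj_commute)
qed

lemma prob_norm_S_gt_le:
  fixes s x G :: real
  assumes "0 \<le> s" "s \<le> 1" "0 < x"
    and "\<And>u. norm u \<le> 2 * real CARD('d) / x \<Longrightarrow> cmod (\<psi> u) \<le> G"
  shows "tail s x \<le> 2 * real CARD('d) * (s * G)"
  using assms
  by (intro prob_norm_gt_le_char random_variable_S order_trans[OF one_minus_Re_char_le(1)] mult_left_mono) auto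

lemma S_tight:
  assumes "0 < e"
  obtains K where "0 < K" "\<And>s. 0 \<le> s \<Longrightarrow> s \<le> 1 \<Longrightarrow> tail s K \<le> e"
proof -
  define c where "c = 2 * real CARD('d)"
  have c: "0 < c" by (simp add: c_def)
  obtain r where r: "0 < r" "\<And>u. norm u \<le> r \<Longrightarrow> cmod (\<psi> u) \<le> e / c"
    using pure_jump_exponent_at_0[of "e / c" \<gamma>] assms c by auto
  show thesis
  \<comment> \<open>For the level x = c/r the frequency range |u| <= c/x is exactly the ball of
    radius \<open>r\<close>; uniformity in s holds because s <= 1 multiplies the exponent.\<close>
  proof (rule that[of "c / r"])
    fix s :: real assume s: "0 \<le> s" "s \<le> 1"
    have "tail s (c / r) \<le> c * (s * (e / c))"
      using s r c prob_norm_S_gt_le[of s "c / r" "e / c"] by (simp add: c_def)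
    also have "\<dots> \<le> e"
      using s c assms by (simp add: mult_left_le_one_le)
    finally show "tail s (c / r) \<le> e" .
  qed (use r c in simp)
qed

text \<open>Restricted to x <= L because the constant 1 in the growth bound C (1 + |u|^p) does not
  decay for the small frequencies that belong to large x; on (0, L] it is at most L^p
  x^(-p).\<close>

lemma prob_norm_S_gt_le_powr:
  assumes p: "1 \<le> p" "p \<le> 2" "small_jump_moment \<nu> p < \<infinity>" and "0 < L"
  obtains C where "0 < C" "\<And>s x. 0 \<le> s \<Longrightarrow> s \<le> 1 \<Longrightarrow> 0 < x \<Longrightarrow> x \<le> L \<Longrightarrow>
    tail s x \<le> C * s * x powr - p"
proof -
  define c where "c = 2 * real CARD('d)"
  have c: "0 < c" by (simp add: c_def)
  obtain C where C: "0 < C" "\<And>u. cmod (\<psi> u) \<le> C * (1 + norm u powr p)"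
    using cmod_pure_jump_exponent_le_powr[OF p, of \<gamma>] by blast
  show thesis
  proof (rule that[of "c * (C * (L powr p + c powr p))"])
    fix s x :: real assume *: "0 \<le> s" "s \<le> 1" "0 < x" "x \<le> L"
    have "tail s x \<le> c * (s * (C * (L powr p + c powr p) * x powr - p))"
      unfolding c_def
    proof (rule prob_norm_S_gt_le)
      fix u :: "real ^ 'd" assume u: "norm u \<le> 2 * real CARD('d) / x"
      have "norm u powr p \<le> (c / x) powr p"
        using u p by (intro powr_mono2) (auto simp: c_def)
      also have "\<dots> = c powr p * x powr - p"
        using * c by (simp add: powr_divide powr_minus field_simps)
      finally have "norm u powr p \<le> c powr p * x powr - p" .
      moreover have "1 \<le> L powr p * x powr - p"
        using * p powr_mono2[of p x L] by (simp add: powr_minus field_simps)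
      ultimately have "1 + norm u powr p \<le> (L powr p + c powr p) * x powr - p"
        by (simp add: algebra_simps)
      then have "C * (1 + norm u powr p) \<le> C * ((L powr p + c powr p) * x powr - p)"
        using C by (intro mult_left_mono) auto
      then show "cmod (\<psi> u) \<le> C * (L powr p + (2 * real CARD('d)) powr p) * x powr - p"
        using C(2)[of u] by (simp add: c_def mult.assoc)
    qed (use * in auto)
    then show "tail s x \<le> c * (C * (L powr p + c powr p)) * s * x powr - p"
      by (simp add: ac_simps)
  qed (use C c assms in \<open>auto intro!: mult_pos_pos add_pos_pos\<close>)
qed

lemma indep_increments:
  assumes \<tau>: "\<And>k. k \<le> N \<Longrightarrow> 0 \<le> \<tau> k \<and> \<tau> k \<le> 1" "\<And>k. k < N \<Longrightarrow> \<tau> k < \<tau> (Suc k)"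
  shows "indep_vars (\<lambda>_. borel) (\<lambda>i \<omega>. S (\<tau> (Suc i)) \<omega> - S (\<tau> i) \<omega>) {..<N}"
  using levy_process \<tau> unfolding levy_process_def independent_increments_def by auto

lemma ottaviani_grid:
  assumes \<tau>: "\<And>k. k \<le> N \<Longrightarrow> 0 \<le> \<tau> k \<and> \<tau> k \<le> 1" "\<And>k. k < N \<Longrightarrow> \<tau> k < \<tau> (Suc k)" "\<tau> 0 = 0"
    and half: "\<And>k. k \<le> N \<Longrightarrow> tail (\<tau> N - \<tau> k) y \<le> 1 / 2"
  shows "prob {\<omega>\<in>space M. \<exists>k\<le>N. x + y < norm (S (\<tau> k) \<omega>)}
    \<le> 2 * tail (\<tau> N) x"
proof -
  have mono: "\<tau> k \<le> \<tau> N" if "k \<le> N" for k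
    using that by (induction rule: inc_induct) (auto intro: order_trans less_imp_le \<tau>)
  have [measurable]: "random_variable borel (S (\<tau> k))" if "k \<le> N" for k
    using \<tau>(1)[OF that] by (intro random_variable_S) auto
  have [measurable]: "random_variable borel (S (\<tau> N))" "random_variable borel (S 0)"
    using \<tau>(1)[of N] by (auto intro!: random_variable_S)
  have tele: "(\<Sum>i\<in>{k..<N}. S (\<tau> (Suc i)) \<omega> - S (\<tau> i) \<omega>) = S (\<tau> N) \<omega> - S (\<tau> k) \<omega>" if "k \<le> N" for k \<omega>
    using that by (rule sum_Suc_diff')
  have tele0: "(\<Sum>i<k. S (\<tau> (Suc i)) \<omega> - S (\<tau> i) \<omega>) = S (\<tau> k) \<omega> - S 0 \<omega>" for k \<omega>
    using sum_Suc_diff'[of 0 k "\<lambda>i. S (\<tau> i) \<omega>"] by (simp add: \<tau>(3) atLeast0LessThan)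
  \<comment> \<open>The increments telescope to S(\<tau> k) - S(0), and S(0) vanishes only almost
    surely; hence the inequality is proved with S(0) subtracted and transferred afterwards.\<close>
  have *: "prob {\<omega>\<in>space M. \<exists>k\<le>N. x + y < norm (S (\<tau> k) \<omega> - S 0 \<omega>)}
    \<le> 2 * prob {\<omega>\<in>space M. x < norm (S (\<tau> N) \<omega> - S 0 \<omega>)}"
    unfolding tele0[symmetric]
  proof (rule ottaviani)
    fix k assume "k \<le> N"
    then show "prob {\<omega>\<in>space M. y < norm (\<Sum>i\<in>{k..<N}. S (\<tau> (Suc i)) \<omega> - S (\<tau> i) \<omega>)} \<le> 1 / 2"
      using prob_increment[of "\<tau> k" "\<tau> N" y] \<tau>(1)[of k] \<tau>(1)[of N] mono[of k] half[of k] by (simp add: tele)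
  qed (use \<tau> in \<open>intro indep_increments; simp\<close>)
  have "prob {\<omega>\<in>space M. \<exists>k\<le>N. x + y < norm (S (\<tau> k) \<omega>)} = prob {\<omega>\<in>space M. \<exists>k\<le>N. x + y < norm (S (\<tau> k) \<omega> - S 0 \<omega>)}"
    using S_0 by (intro finite_measure_eq_AE) auto
  moreover have "tail (\<tau> N) x = prob {\<omega>\<in>space M. x < norm (S (\<tau> N) \<omega> - S 0 \<omega>)}"
    using S_0 by (intro finite_measure_eq_AE) auto
  ultimately show ?thesis
    using * by simp
qed

text \<open>The dyadic grid of [0,1] scaled to [0,t]: after the time change in \<open>X t\<close>
  these points become the dyadic times of [0,1].\<close>

definition grid_max :: "real \<Rightarrow> nat \<Rightarrow> 'a \<Rightarrow> real" where
  "grid_max t n \<omega> = (MAX k\<in>{..2 ^ n}. norm (S (t * (real k / 2 ^ n)) \<omega>))"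

abbreviation grid_moment :: "real \<Rightarrow> real \<Rightarrow> nat \<Rightarrow> ennreal" where
  "grid_moment q t n \<equiv> \<integral>\<^sup>+\<omega>. ennreal (grid_max t n \<omega> powr q) \<partial>M"

lemma grid_mem: "0 \<le> t \<Longrightarrow> k \<le> 2 ^ n \<Longrightarrow> 0 \<le> t * (real k / 2 ^ n) \<and> t * (real k / 2 ^ n) \<le> t"
proof -
  assume "0 \<le> t" "k \<le> 2 ^ n"
  then have "t * (real k / 2 ^ n) \<le> t * 1"
    by (intro mult_left_mono) (auto simp: divide_le_eq_1)
  then show ?thesis using \<open>0 \<le> t\<close> by simp
qed

lemma grid_max_gt_iff: "x < grid_max t n \<omega> \<longleftrightarrow> (\<exists>k\<le>2 ^ n. x < norm (S (t * (real k / 2 ^ n)) \<omega>))"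
  unfolding grid_max_def by (subst Max_gr_iff) auto

lemma grid_max_ge: "k \<le> 2 ^ n \<Longrightarrow> norm (S (t * (real k / 2 ^ n)) \<omega>) \<le> grid_max t n \<omega>"
  unfolding grid_max_def by (intro Max_ge) auto

lemma grid_max_nonneg: "0 \<le> grid_max t n \<omega>"
  using grid_max_ge[of 0 n] by (rule order_trans[OF norm_ge_zero]) simp

lemma random_variable_grid_max [measurable]:
  assumes "0 \<le> t" "t \<le> 1"
  shows "random_variable borel (grid_max t n)"
  unfolding grid_max_def[abs_def]
proof (intro borel_measurable_Max)
  fix k :: nat assume "k \<in> {..2 ^ n}"
  then have "0 \<le> t * (real k / 2 ^ n)" "t * (real k / 2 ^ n) \<le> 1"
    using grid_mem[of t k n] assms by (auto simp del: times_divide_eq_right)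
  then have "random_variable borel (S (t * (real k / 2 ^ n)))"
    by (rule random_variable_S)
  then show "random_variable borel (\<lambda>\<omega>. norm (S (t * (real k / 2 ^ n)) \<omega>))" by measurable
qed auto

text \<open>Ottaviani's inequality with both thresholds equal to \<open>x\<close>. Its condition on
  the remaining increments is the hypothesis when p <= 1/2; otherwise 2 p exceeds 1 and the claim is
  trivial. The bound does not depend on the mesh.\<close>

lemma prob_grid_max_gt_le:
  assumes t: "0 < t" "t \<le> 1"
    and p: "\<And>s. 0 \<le> s \<Longrightarrow> s \<le> t \<Longrightarrow> tail s x \<le> p"
  shows "prob {\<omega>\<in>space M. 2 * x < grid_max t n \<omega>} \<le> 2 * p"
proof (cases "p \<le> 1 / 2")
  case True
  have "prob {\<omega>\<in>space M. \<exists>k\<le>2 ^ n. x + x < norm (S (t * (real k / 2 ^ n)) \<omega>)}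
    \<le> 2 * prob {\<omega>\<in>space M. x < norm (S (t * (real (2 ^ n) / 2 ^ n)) \<omega>)}"
  proof (rule ottaviani_grid)
    fix k :: nat assume k: "k \<le> 2 ^ n"
    then show "0 \<le> t * (real k / 2 ^ n) \<and> t * (real k / 2 ^ n) \<le> 1"
      using grid_mem[of t k n] t by linarith
    show "prob {\<omega>\<in>space M. x < norm (S (t * (real (2 ^ n) / 2 ^ n) - t * (real k / 2 ^ n)) \<omega>)} \<le> 1 / 2"
      using grid_mem[OF less_imp_le[OF t(1)] k] True by (intro order_trans[OF p]) auto
  qed (use t in \<open>auto simp: divide_strict_right_mono\<close>)
  also have "\<dots> \<le> 2 * p"
    using p[of t] t by simp
  finally show ?thesis
    by (simp add: grid_max_gt_iff)
next
  case False
  then show ?thesis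
    using prob_le_1[of "{\<omega>\<in>space M. 2 * x < grid_max t n \<omega>}"] by linarith
qed

text \<open>The largest of \<open>n\<close> increments over disjoint intervals of length \<open>t \<approx> 1 / n\<close> is at most twice
  the running maximum up to time 1, and exceeds \<open>x\<close> with probability about \<open>n\<close> times that of a
  single increment.\<close>

lemma prob_S_large_le:
  obtains K L where "0 < K" "0 < L"
    "\<And>t x. 0 \<le> t \<Longrightarrow> t \<le> 1 / 2 \<Longrightarrow> L \<le> x \<Longrightarrow>
      tail t x \<le> 8 * t * prob {\<omega>\<in>space M. x < 2 * norm (S 1 \<omega>) + K}"
proof -
  obtain K where K: "0 < K" "\<And>s. 0 \<le> s \<Longrightarrow> s \<le> 1 \<Longrightarrow> tail s K \<le> 1 / 2"
    using S_tight[of "1 / 2"] by auto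
  \<comment> \<open>Level 1/4, because Ottaviani's inequality doubles it and
    \<open>one_minus_power_bernoulli\<close> accepts at most 1/2.\<close>
  obtain K' where K': "0 < K'" "\<And>s. 0 \<le> s \<Longrightarrow> s \<le> 1 \<Longrightarrow> tail s K' \<le> 1 / 4"
    using S_tight[of "1 / 4"] by auto
  have "tail t x \<le> 8 * t * prob {\<omega>\<in>space M. x < 2 * norm (S 1 \<omega>) + 2 * K}"
    if t: "0 < t" "t \<le> 1 / 2" and x: "2 * K' + 2 * K \<le> x" for t x
  proof -
    define p where "p = tail t x"
    define z where "z = prob {\<omega>\<in>space M. x < 2 * norm (S 1 \<omega>) + 2 * K}"
    \<comment> \<open>The largest integer strictly below 1/t. Strictness leaves a nonempty interval
      after time n t, and t <= 1/2 ensures that n is at least 1/(2t).\<close>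
    define n where "n = nat (\<lceil>1 / t\<rceil> - 1)"
    have "2 \<le> 1 / t" using t by (simp add: field_simps)
    then have n: "real n < 1 / t" "1 / t - 1 \<le> real n" "1 \<le> n"
      unfolding n_def by linarith+
    then have nt: "real n * t < 1" "1 / (2 * t) \<le> real n"
      using t \<open>2 \<le> 1 / t\<close> by (auto simp: field_simps)
    have z: "z \<le> 1 / 4"
      unfolding z_def using x by (intro order_trans[OF finite_measure_mono K'(2)[of 1]]) auto
    \<comment> \<open>n steps of length t and one more step that ends at time 1, since Ottaviani's
      inequality compares the maximum with the last grid point and the moment is assumed
      there.\<close>
    define \<tau> where "\<tau> k = (if k \<le> n then real k * t else 1)" for k
    have \<tau>: "0 \<le> \<tau> k" "\<tau> k \<le> 1" for k
    proof -
      have "real k * t \<le> 1" if "k \<le> n"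
      proof -
        have "real k * t \<le> real n * t" using that t by (intro mult_right_mono) auto
        then show ?thesis using nt by linarith
      qed
      then show "0 \<le> \<tau> k" "\<tau> k \<le> 1"
        using t by (auto simp: \<tau>_def)
    qed
    have \<tau>_less: "\<tau> k < \<tau> (Suc k)" if "k < Suc n" for k
      using that nt t by (cases "k = n") (auto simp: \<tau>_def algebra_simps)
    have S_meas[measurable]: "random_variable borel (S (\<tau> k))" "random_variable borel (S t)" "random_variable borel (S 1)" for k
      using \<tau>[of k] t by (auto intro!: random_variable_S)
    have indep: "indep_vars (\<lambda>_. borel) (\<lambda>i \<omega>. S (\<tau> (Suc i)) \<omega> - S (\<tau> i) \<omega>) {..<n}"
      using \<tau> \<tau>_less by (intro indep_increments) auto
    define D where "D i = (\<lambda>\<omega>. S (\<tau> (Suc i)) \<omega> - S (\<tau> i) \<omega>) -` {w. norm w \<le> x} \<inter> space M" for i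
    have D_events: "D i \<in> events" for i
      unfolding D_def by measurable
    have D: "prob (D i) = 1 - p" if "i < n" for i
    proof -
      have "space M - D i = {\<omega>\<in>space M. x < norm (S (\<tau> (Suc i)) \<omega> - S (\<tau> i) \<omega>)}"
        by (auto simp: D_def)
      then have "1 - prob (D i) = prob {\<omega>\<in>space M. x < norm (S (\<tau> (Suc i)) \<omega> - S (\<tau> i) \<omega>)}"
        using prob_compl[OF D_events[of i]] by simp
      also have "\<dots> = p"
        using prob_increment[of "\<tau> i" "\<tau> (Suc i)" x] \<tau>[of i] \<tau>[of "Suc i"] \<tau>_less[of i] that
        by (simp add: p_def \<tau>_def algebra_simps)
      finally show ?thesis by simp
    qed
    have "prob (\<Inter>i\<in>{..<n}. D i) = (\<Prod>i\<in>{..<n}. prob (D i))"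
      unfolding D_def using n(3) by (intro indep_varsD[OF indep]) (auto simp: lessThan_empty_iff)
    also have "\<dots> = (1 - p) ^ n"
      by (simp add: D)
    finally have "1 - (1 - p) ^ n = prob (space M - (\<Inter>i\<in>{..<n}. D i))"
      using n(3) D_events by (subst prob_compl) (auto simp: lessThan_empty_iff)
    also have "\<dots> \<le> prob {\<omega>\<in>space M. \<exists>k\<le>Suc n. (x / 2 - K) + K < norm (S (\<tau> k) \<omega>)}"
    proof (rule finite_measure_mono)
      show "space M - (\<Inter>i\<in>{..<n}. D i) \<subseteq> {\<omega>\<in>space M. \<exists>k\<le>Suc n. (x / 2 - K) + K < norm (S (\<tau> k) \<omega>)}"
      proof
        fix \<omega> assume "\<omega> \<in> space M - (\<Inter>i\<in>{..<n}. D i)"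
        then obtain i where "\<omega> \<in> space M" "i < n" "\<omega> \<notin> D i"
          by blast
        then have i: "\<omega> \<in> space M" "i < n" "x < norm (S (\<tau> (Suc i)) \<omega> - S (\<tau> i) \<omega>)"
          by (auto simp: D_def)
        then have "x / 2 < norm (S (\<tau> (Suc i)) \<omega>) \<or> x / 2 < norm (S (\<tau> i) \<omega>)"
          using norm_triangle_ineq4[of "S (\<tau> (Suc i)) \<omega>" "S (\<tau> i) \<omega>"] by linarith
        then show "\<omega> \<in> {\<omega>\<in>space M. \<exists>k\<le>Suc n. (x / 2 - K) + K < norm (S (\<tau> k) \<omega>)}"
          using i by (auto intro: exI[of _ i] exI[of _ "Suc i"])
      qed
    qed measurable
    also have "\<dots> \<le> 2 * tail (\<tau> (Suc n)) (x / 2 - K)"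
      using \<tau> \<tau>_less K(2) by (intro ottaviani_grid) (auto simp: \<tau>_def[of 0], simp add: \<tau>_def)
    also have "\<dots> = 2 * z"
      unfolding z_def \<tau>_def by (auto intro!: arg_cong[where f=prob])
    finally have "n * p \<le> 2 * (2 * z)"
      using z by (intro one_minus_power_bernoulli) (auto simp: p_def)
    moreover have "1 / (2 * t) * p \<le> real n * p"
      using nt by (intro mult_right_mono) (auto simp: p_def)
    ultimately have "1 / (2 * t) * p \<le> 4 * z"
      by linarith
    then show ?thesis
      using t by (simp add: p_def z_def field_simps)
  qed
  moreover have "tail 0 x = 0" if "0 < x" for x
    using S_0 that by (subst prob_eq_0) auto
  ultimately show thesis
    using K K' by (intro that[of "2 * K" "2 * K' + 2 * K"]) (auto simp: order_le_less)
qed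

end

section \<open>Moments of the running maximum\<close>

lemma powr_add_le:
  fixes a b q :: real
  assumes "0 \<le> a" "0 \<le> b" "0 \<le> q"
  shows "(a + b) powr q \<le> 2 powr q * (a powr q + b powr q)"
proof -
  have "(a + b) powr q \<le> (2 * max a b) powr q"
    using assms by (intro powr_mono2) auto
  also have "\<dots> = 2 powr q * max a b powr q"
    using assms by (simp add: powr_mult)
  also have "\<dots> \<le> 2 powr q * (a powr q + b powr q)"
    by (intro mult_left_mono) (auto simp: max_def)
  finally show ?thesis .
qed

lemma (in finite_measure) nn_integral_powr_add_finite:
  fixes Y Z :: "'a \<Rightarrow> real"
  assumes [measurable]: "Y \<in> borel_measurable M" "Z \<in> borel_measurable M"
    and nn: "\<And>\<omega>. 0 \<le> Y \<omega>" "\<And>\<omega>. 0 \<le> Z \<omega>" "0 \<le> q"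
    and fin: "(\<integral>\<^sup>+\<omega>. ennreal (Y \<omega> powr q) \<partial>M) < \<infinity>" "(\<integral>\<^sup>+\<omega>. ennreal (Z \<omega> powr q) \<partial>M) < \<infinity>"
  shows "(\<integral>\<^sup>+\<omega>. ennreal ((Y \<omega> + Z \<omega>) powr q) \<partial>M) < \<infinity>"
proof -
  have "(\<integral>\<^sup>+\<omega>. ennreal ((Y \<omega> + Z \<omega>) powr q) \<partial>M)
    \<le> (\<integral>\<^sup>+\<omega>. ennreal (2 powr q) * (ennreal (Y \<omega> powr q) + ennreal (Z \<omega> powr q)) \<partial>M)"
    using nn by (intro nn_integral_mono)
      (auto intro!: ennreal_leI powr_add_le simp flip: ennreal_plus ennreal_mult'')
  also have "\<dots> = ennreal (2 powr q) * ((\<integral>\<^sup>+\<omega>. ennreal (Y \<omega> powr q) \<partial>M) + (\<integral>\<^sup>+\<omega>. ennreal (Z \<omega> powr q) \<partial>M))"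
    by (simp add: nn_integral_cmult nn_integral_add)
  also have "\<dots> < \<infinity>"
    using fin by (simp add: ennreal_mult_less_top)
  finally show ?thesis .
qed

context pure_jump_levy_process
begin

text \<open>The layer-cake integral is split at \<open>L\<close>. Below, an arbitrary majorant
  \<open>H\<close> is left open; above, the mesh-free maximal inequality combined with the
  large-value bound gives 16 t times the tail of 4 |S_1| + K, and the layer-cake formula read
  backwards turns this into a moment.\<close>

lemma nn_integral_grid_max_le:
  obtains K L where "0 < K" "0 < L"
    "\<And>t n q H. 0 < t \<Longrightarrow> t \<le> 1 / 2 \<Longrightarrow> 0 < q \<Longrightarrow> H \<in> borel_measurable borel \<Longrightarrow>
      (\<And>x. 0 < x \<Longrightarrow> x < L \<Longrightarrow> emeasure M {\<omega>\<in>space M. x < grid_max t n \<omega>} \<le> H x) \<Longrightarrow>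
      grid_moment q t n \<le>
        (\<integral>\<^sup>+x\<in>{0<..<L}. ennreal (q * x powr (q - 1)) * H x \<partial>lborel) +
        ennreal (16 * t) * (\<integral>\<^sup>+\<omega>. ennreal ((4 * norm (S 1 \<omega>) + K) powr q) \<partial>M)"
proof -
  obtain K L where K: "0 < K" and L: "0 < L" and large:
    "\<And>t x. 0 \<le> t \<Longrightarrow> t \<le> 1 / 2 \<Longrightarrow> L \<le> x \<Longrightarrow>
      tail t x \<le> 8 * t * prob {\<omega>\<in>space M. x < 2 * norm (S 1 \<omega>) + K}"
    using prob_S_large_le by blast
  let ?R = "\<lambda>x. {\<omega>\<in>space M. x < 4 * norm (S 1 \<omega>) + 2 * K}"
  show thesis
  proof (rule that[of "2 * K" "2 * L"])
    fix t q :: real and n :: nat and H :: "real \<Rightarrow> ennreal"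
    assume t: "0 < t" "t \<le> 1 / 2" and q: "0 < q" and [measurable]: "H \<in> borel_measurable borel"
      and H: "\<And>x. 0 < x \<Longrightarrow> x < 2 * L \<Longrightarrow> emeasure M {\<omega>\<in>space M. x < grid_max t n \<omega>} \<le> H x"
    have [measurable]: "random_variable borel (grid_max t n)"
      using t by simp
    have big: "emeasure M {\<omega>\<in>space M. x < grid_max t n \<omega>} \<le> ennreal (16 * t) * emeasure M (?R x)"
      if x: "2 * L \<le> x" for x
    proof -
      have "prob {\<omega>\<in>space M. 2 * (x / 2) < grid_max t n \<omega>} \<le> 2 * (8 * t * prob {\<omega>\<in>space M. x / 2 < 2 * norm (S 1 \<omega>) + K})"
      proof (rule prob_grid_max_gt_le)
        fix s assume s: "0 \<le> s" "s \<le> t"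
        have "tail s (x / 2) \<le> 8 * s * prob {\<omega>\<in>space M. x / 2 < 2 * norm (S 1 \<omega>) + K}"
          using s t x by (intro large) auto
        also have "\<dots> \<le> 8 * t * prob {\<omega>\<in>space M. x / 2 < 2 * norm (S 1 \<omega>) + K}"
          using s by (intro mult_right_mono) auto
        finally show "tail s (x / 2) \<le> 8 * t * prob {\<omega>\<in>space M. x / 2 < 2 * norm (S 1 \<omega>) + K}" .
      qed (use t in auto)
      moreover have "{\<omega>\<in>space M. x / 2 < 2 * norm (S 1 \<omega>) + K} = (?R x)"
        by auto
      ultimately show ?thesis
        using t by (simp add: emeasure_eq_measure flip: ennreal_mult)
    qed
    have "grid_moment q t n =
      (\<integral>\<^sup>+x\<in>{0<..}. ennreal (q * x powr (q - 1)) * emeasure M {\<omega>\<in>space M. x < grid_max t n \<omega>} \<partial>lborel)"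
      using q by (intro nn_integral_powr_layer_cake) (auto simp: grid_max_nonneg)
    also have "\<dots> \<le> (\<integral>\<^sup>+x. ennreal (q * x powr (q - 1)) * H x * indicator {0<..<2 * L} x +
      ennreal (16 * t) * (ennreal (q * x powr (q - 1)) * emeasure M (?R x) * indicator {0<..} x) \<partial>lborel)"
    proof (intro nn_integral_mono)
      fix x :: real
      show "ennreal (q * x powr (q - 1)) * emeasure M {\<omega>\<in>space M. x < grid_max t n \<omega>} * indicator {0<..} x
        \<le> ennreal (q * x powr (q - 1)) * H x * indicator {0<..<2 * L} x +
          ennreal (16 * t) * (ennreal (q * x powr (q - 1)) * emeasure M (?R x) * indicator {0<..} x)"
      proof (cases "x < 2 * L")
        case True
        then show ?thesis
          using mult_left_mono[OF H[of x]] by (auto simp: indicator_def intro!: add_increasing2)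
      next
        case False
        then have "ennreal (q * x powr (q - 1)) * emeasure M {\<omega>\<in>space M. x < grid_max t n \<omega>}
          \<le> ennreal (q * x powr (q - 1)) * (ennreal (16 * t) * emeasure M (?R x))"
          by (intro mult_left_mono big) auto
        then show ?thesis
          using False L by (auto simp: indicator_def ac_simps)
      qed
    qed
    also have "\<dots> = (\<integral>\<^sup>+x\<in>{0<..<2 * L}. ennreal (q * x powr (q - 1)) * H x \<partial>lborel) +
        ennreal (16 * t) * (\<integral>\<^sup>+x\<in>{0<..}. ennreal (q * x powr (q - 1)) * emeasure M (?R x) \<partial>lborel)"
      by (subst nn_integral_add, measurable, subst nn_integral_cmult, measurable)
    also have "(\<integral>\<^sup>+x\<in>{0<..}. ennreal (q * x powr (q - 1)) * emeasure M (?R x) \<partial>lborel)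
      = (\<integral>\<^sup>+\<omega>. ennreal ((4 * norm (S 1 \<omega>) + 2 * K) powr q) \<partial>M)"
      using q K by (intro nn_integral_powr_layer_cake[symmetric]) auto
    finally show "grid_moment q t n \<le>
        (\<integral>\<^sup>+x\<in>{0<..<2 * L}. ennreal (q * x powr (q - 1)) * H x \<partial>lborel) +
        ennreal (16 * t) * (\<integral>\<^sup>+\<omega>. ennreal ((4 * norm (S 1 \<omega>) + 2 * K) powr q) \<partial>M)" .
  qed (use K L in auto)
qed

text \<open>What remains to be supplied for levels below \<open>L\<close>. The left-hand side is
  capped at 1 so that the trivial bound may be used near 0; \<open>h\<close> is
  \<open>ennreal\<close>-valued because in the borderline case it is an integral over \<nu> whose
  finiteness is only established after integration over x.\<close>

abbreviation tail_majorant :: "real \<Rightarrow> real \<Rightarrow> real \<Rightarrow> real \<Rightarrow> real \<Rightarrow> (real \<Rightarrow> ennreal) \<Rightarrow> bool" where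
  "tail_majorant q \<kappa> L C t h \<equiv> h \<in> borel_measurable borel \<and> 0 \<le> C \<and>
    (\<forall>s x. 0 \<le> s \<longrightarrow> s \<le> t \<longrightarrow> 0 < x \<longrightarrow> x < L \<longrightarrow> ennreal (min 1 (2 * tail s (x / 2))) \<le> h x) \<and>
    (\<integral>\<^sup>+x\<in>{0<..<L}. ennreal (q * x powr (q - 1)) * h x \<partial>lborel) \<le> ennreal (C * t powr \<kappa>)"

text \<open>Values above \<open>L\<close> contribute \<open>O(t)\<close>, so only the integral over \<open>x < L\<close> needs to be estimated. The
  factors 2 in the condition on \<open>H\<close> come from Ottaviani's inequality.\<close>

lemma grid_max_moment_bound:
  assumes q: "0 < q" and fin: "(\<integral>\<^sup>+\<omega>. ennreal (norm (S 1 \<omega>) powr q) \<partial>M) < \<infinity>"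
    and \<kappa>: "\<kappa> \<le> 1"
    and H: "\<And>L. 0 < L \<Longrightarrow> \<exists>H C. \<forall>t. 0 < t \<longrightarrow> t \<le> 1 / 2 \<longrightarrow>
      tail_majorant q \<kappa> L C t (H t)"
  obtains C where "0 \<le> C" "\<And>t n. 0 < t \<Longrightarrow> t \<le> 1 / 2 \<Longrightarrow>
    grid_moment q t n \<le> ennreal (C * t powr \<kappa>)"
proof (rule nn_integral_grid_max_le)
  fix K L :: real
  assume KL: "0 < K" "0 < L" and main:
    "\<And>t n q H. 0 < t \<Longrightarrow> t \<le> 1 / 2 \<Longrightarrow> 0 < q \<Longrightarrow> H \<in> borel_measurable borel \<Longrightarrow>
      (\<And>x. 0 < x \<Longrightarrow> x < L \<Longrightarrow> emeasure M {\<omega>\<in>space M. x < grid_max t n \<omega>} \<le> H x) \<Longrightarrow>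
      grid_moment q t n \<le>
        (\<integral>\<^sup>+x\<in>{0<..<L}. ennreal (q * x powr (q - 1)) * H x \<partial>lborel) +
        ennreal (16 * t) * (\<integral>\<^sup>+\<omega>. ennreal ((4 * norm (S 1 \<omega>) + K) powr q) \<partial>M)"
  obtain H C where "\<forall>t. 0 < t \<longrightarrow> t \<le> 1 / 2 \<longrightarrow>
      tail_majorant q \<kappa> L C t (H t)"
    using H[OF KL(2)] by (elim exE) (rule that)
  note * = this[THEN spec, THEN mp, THEN mp]
  note H_meas = *[THEN conjunct1] and C0 = *[THEN conjunct2, THEN conjunct1, of "1 / 2", simplified]
    and H_tail = *[THEN conjunct2, THEN conjunct2, THEN conjunct1, rule_format]
    and H_int = *[THEN conjunct2, THEN conjunct2, THEN conjunct2]
  define I where "I = enn2real (\<integral>\<^sup>+\<omega>. ennreal ((4 * norm (S 1 \<omega>) + K) powr q) \<partial>M)"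
  have "(\<integral>\<^sup>+\<omega>. ennreal ((4 * norm (S 1 \<omega>) + K) powr q) \<partial>M) < \<infinity>"
  proof (rule nn_integral_powr_add_finite)
    have "(\<integral>\<^sup>+\<omega>. ennreal ((4 * norm (S 1 \<omega>)) powr q) \<partial>M) = ennreal (4 powr q) * (\<integral>\<^sup>+\<omega>. ennreal (norm (S 1 \<omega>) powr q) \<partial>M)"
      by (subst nn_integral_cmult[symmetric]) (auto simp: powr_mult ennreal_mult)
    then show "(\<integral>\<^sup>+\<omega>. ennreal ((4 * norm (S 1 \<omega>)) powr q) \<partial>M) < \<infinity>"
      using fin by (simp add: ennreal_mult_less_top)
  qed (use KL q in \<open>auto simp: emeasure_space_1\<close>)
  then have I: "(\<integral>\<^sup>+\<omega>. ennreal ((4 * norm (S 1 \<omega>) + K) powr q) \<partial>M) = ennreal I"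
    by (simp add: I_def)
  have I0: "0 \<le> I" by (simp add: I_def)
  show thesis
  proof (rule that[of "C + 16 * I"])
    fix t n assume t: "0 < t" "t \<le> (1 / 2 :: real)"
    have "grid_moment q t n \<le>
        (\<integral>\<^sup>+x\<in>{0<..<L}. ennreal (q * x powr (q - 1)) * H t x \<partial>lborel) + ennreal (16 * t) * ennreal I"
      unfolding I[symmetric]
    proof (rule main)
      fix x assume x: "0 < x" "x < L"
      show "emeasure M {\<omega>\<in>space M. x < grid_max t n \<omega>} \<le> H t x"
      proof (cases "H t x")
        case (real r)
        have r: "min 1 (2 * tail s (x / 2)) \<le> r" if "0 \<le> s" "s \<le> t" for s
          using H_tail[OF t that x] real by simp
        have "prob {\<omega>\<in>space M. 2 * (x / 2) < grid_max t n \<omega>} \<le> r"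
        \<comment> \<open>If r < 1 the cap in the hypothesis is inactive and the one-time tails are
          at most r/2; if r >= 1 there is nothing to prove.\<close>
        proof (cases "r < 1")
          case True
          have "tail s (x / 2) \<le> r / 2" if "0 \<le> s" "s \<le> t" for s
            using r[OF that] True by (auto simp: min_def split: if_splits)
          then show ?thesis
            using prob_grid_max_gt_le[of t "x / 2" "r / 2" n] t by simp
        next
          case False
          then show ?thesis
            using prob_le_1[of "{\<omega>\<in>space M. 2 * (x / 2) < grid_max t n \<omega>}"] by linarith
        qed
        then show ?thesis
          using real by (simp add: emeasure_eq_measure)
      qed simp
    qed (use t q H_meas[OF t] in auto)
    also have "\<dots> \<le> ennreal (C * t powr \<kappa>) + ennreal (16 * t) * ennreal I"
      by (intro add_mono H_int t) simp
    also have "\<dots> = ennreal (C * t powr \<kappa> + 16 * t * I)"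
      using C0 t I0 by (simp flip: ennreal_mult ennreal_plus)
    also have "\<dots> \<le> ennreal ((C + 16 * I) * t powr \<kappa>)"
    proof (rule ennreal_leI)
      have "t \<le> t powr \<kappa>"
        using t \<kappa> powr_mono'[of \<kappa> 1 t] by simp
      then have "16 * I * t \<le> 16 * I * t powr \<kappa>"
        using I0 by (intro mult_left_mono) auto
      then show "C * t powr \<kappa> + 16 * t * I \<le> (C + 16 * I) * t powr \<kappa>"
        by (simp add: algebra_simps)
    qed
    finally show "grid_moment q t n \<le> ennreal ((C + 16 * I) * t powr \<kappa>)" .
  qed (use C0 I0 in simp)
qed

section \<open>Moment bounds according to the position of \<open>q\<close> relative to
  \<open>p\<close>\<close>

lemma two_prob_norm_S_gt_le_powr:
  assumes p: "1 \<le> p" "p \<le> 2" "small_jump_moment \<nu> p < \<infinity>" and "0 < L"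
  obtains C where "0 < C" "\<And>s t x. 0 \<le> s \<Longrightarrow> s \<le> t \<Longrightarrow> t \<le> 1 / 2 \<Longrightarrow> 0 < x \<Longrightarrow> x < L \<Longrightarrow>
    2 * tail s (x / 2) \<le> C * t * x powr - p"
proof -
  obtain C where C: "0 < C" "\<And>s x. 0 \<le> s \<Longrightarrow> s \<le> 1 \<Longrightarrow> 0 < x \<Longrightarrow> x \<le> L \<Longrightarrow>
    tail s x \<le> C * s * x powr - p"
    using prob_norm_S_gt_le_powr[OF p \<open>0 < L\<close>] by blast
  show thesis
  proof (rule that[of "2 * C * 2 powr p"])
    fix s t x :: real assume *: "0 \<le> s" "s \<le> t" "t \<le> 1 / 2" "0 < x" "x < L"
    have "tail s (x / 2) \<le> C * s * (x / 2) powr - p"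
      using * by (intro C) auto
    also have "\<dots> \<le> C * t * (x / 2) powr - p"
      using * C by (intro mult_right_mono mult_left_mono) auto
    also have "(x / 2) powr - p = 2 powr p * x powr - p"
      using * by (simp add: powr_divide powr_minus field_simps)
    finally show "2 * tail s (x / 2) \<le> 2 * C * 2 powr p * t * x powr - p"
      by (simp add: algebra_simps)
  qed (use C in simp)
qed

text \<open>For q < p the capped tail min(1, C t x^(-p)) is integrable against x^(q-1) over the
  whole half-line, and scaling in C t gives the power q/p.\<close>

lemma grid_max_moment_below:
  assumes p: "1 \<le> p" "p \<le> 2" "small_jump_moment \<nu> p < \<infinity>"
    and q: "0 < q" "q < p" and fin: "(\<integral>\<^sup>+\<omega>. ennreal (norm (S 1 \<omega>) powr q) \<partial>M) < \<infinity>"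
  obtains C where "0 \<le> C" "\<And>t n. 0 < t \<Longrightarrow> t \<le> 1 / 2 \<Longrightarrow>
    grid_moment q t n \<le> ennreal (C * t powr (q / p))"
proof (rule grid_max_moment_bound[OF q(1) fin])
  fix L :: real assume "0 < L"
  then obtain C where C: "0 < C" "\<And>s t x. 0 \<le> s \<Longrightarrow> s \<le> t \<Longrightarrow> t \<le> 1 / 2 \<Longrightarrow> 0 < x \<Longrightarrow> x < L \<Longrightarrow>
    2 * tail s (x / 2) \<le> C * t * x powr - p"
    using two_prob_norm_S_gt_le_powr[OF p] by blast
  show "\<exists>H C. \<forall>t. 0 < t \<longrightarrow> t \<le> 1 / 2 \<longrightarrow>
      tail_majorant q (q / p) L C t (H t)"
  proof (intro exI allI impI conjI)
    fix t :: real assume t: "0 < t" "t \<le> 1 / 2"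
    show "(\<lambda>x. ennreal (min 1 (C * t * x powr - p))) \<in> borel_measurable borel"
      by measurable
    show "0 \<le> (1 + q / (p - q)) * C powr (q / p)"
      using q by simp
    show "ennreal (min 1 (2 * tail s (x / 2))) \<le> ennreal (min 1 (C * t * x powr - p))"
      if "0 \<le> s" "s \<le> t" "0 < x" "x < L" for s x
      using that t by (intro ennreal_leI min.mono C) auto
    have "(\<integral>\<^sup>+x\<in>{0<..<L}. ennreal (q * x powr (q - 1)) * ennreal (min 1 (C * t * x powr - p)) \<partial>lborel)
      \<le> (\<integral>\<^sup>+x\<in>{0<..}. ennreal (q * x powr (q - 1) * min 1 (C * t * x powr - p)) \<partial>lborel)"
      using q C t by (intro nn_integral_mono) (auto simp: indicator_def ennreal_mult)
    also have "\<dots> \<le> ennreal ((1 + q / (p - q)) * (C * t) powr (q / p))"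
      using q C t by (intro nn_integral_powr_min_tail) auto
    finally show "(\<integral>\<^sup>+x\<in>{0<..<L}. ennreal (q * x powr (q - 1)) * ennreal (min 1 (C * t * x powr - p)) \<partial>lborel)
      \<le> ennreal ((1 + q / (p - q)) * C powr (q / p) * t powr (q / p))"
      using C t by (simp add: powr_mult mult.assoc)
  qed
qed (use p q that in auto)

text \<open>For p < q the uncapped tail is already integrable at 0, so everything up to
  \<open>L\<close> is linear in t; the order matches that of the values above
  \<open>L\<close>.\<close>

lemma grid_max_moment_above:
  assumes p: "1 \<le> p" "p \<le> 2" "small_jump_moment \<nu> p < \<infinity>"
    and q: "p < q" and fin: "(\<integral>\<^sup>+\<omega>. ennreal (norm (S 1 \<omega>) powr q) \<partial>M) < \<infinity>"
  obtains C where "0 \<le> C" "\<And>t n. 0 < t \<Longrightarrow> t \<le> 1 / 2 \<Longrightarrow>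
    grid_moment q t n \<le> ennreal (C * t powr 1)"
proof (rule grid_max_moment_bound[OF _ fin order_refl])
  fix L :: real assume L: "0 < L"
  then obtain C where C: "0 < C" "\<And>s t x. 0 \<le> s \<Longrightarrow> s \<le> t \<Longrightarrow> t \<le> 1 / 2 \<Longrightarrow> 0 < x \<Longrightarrow> x < L \<Longrightarrow>
    2 * tail s (x / 2) \<le> C * t * x powr - p"
    using two_prob_norm_S_gt_le_powr[OF p] by blast
  show "\<exists>H C. \<forall>t. 0 < t \<longrightarrow> t \<le> 1 / 2 \<longrightarrow>
      tail_majorant q 1 L C t (H t)"
  proof (intro exI allI impI conjI)
    fix t :: real assume t: "0 < t" "t \<le> 1 / 2"
    show "(\<lambda>x. ennreal (C * t * x powr - p)) \<in> borel_measurable borel"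
      by measurable
    show "0 \<le> C * (q / (q - p) * L powr (q - p))"
      using q p C by simp
    show "ennreal (min 1 (2 * tail s (x / 2))) \<le> ennreal (C * t * x powr - p)"
      if "0 \<le> s" "s \<le> t" "0 < x" "x < L" for s x
      using that t by (intro ennreal_leI min.coboundedI2 C) auto
    have "(\<integral>\<^sup>+x\<in>{0<..<L}. ennreal (q * x powr (q - 1)) * ennreal (C * t * x powr - p) \<partial>lborel)
      = (\<integral>\<^sup>+x\<in>{0<..<L}. ennreal (q * x powr (q - 1) * (C * t * x powr - p)) \<partial>lborel)"
      using q p C t by (simp add: ennreal_mult)
    also have "\<dots> = ennreal (C * t * (q / (q - p) * L powr (q - p)))"
      using q p C t L by (intro nn_integral_powr_head) auto
    finally show "(\<integral>\<^sup>+x\<in>{0<..<L}. ennreal (q * x powr (q - 1)) * ennreal (C * t * x powr - p) \<partial>lborel)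
      \<le> ennreal (C * (q / (q - p) * L powr (q - p)) * t powr 1)"
      using t by (simp add: ac_simps)
  qed
qed (use p q that in auto)

end

section \<open>The borderline case: finite variation and \<open>q = 1\<close>\<close>

context levy_jumps
begin

text \<open>The bound is uniform over the ball of radius \<open>r\<close> and is stated as a
  nonnegative integral, ready for an exchange of integrals once \<open>r\<close> becomes a multiple
  of 1/x.\<close>

lemma minus_Re_pure_jump_exponent_le:
  assumes "norm u \<le> r"
  shows "ennreal (- Re (pure_jump_exponent \<gamma> \<nu> u)) \<le> (\<integral>\<^sup>+w. ennreal (min 2 (r\<^sup>2 * (norm w)\<^sup>2)) \<partial>\<nu>)"
proof -
  have "ennreal (- Re (pure_jump_exponent \<gamma> \<nu> u)) = ennreal (\<integral>w. 1 - cos (u \<bullet> w) \<partial>\<nu>)"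
    by (simp add: Re_pure_jump_exponent)
  also have "\<dots> \<le> (\<integral>\<^sup>+w. ennreal (1 - cos (u \<bullet> w)) \<partial>\<nu>)"
  \<comment> \<open>In the non-integrable case the Bochner integral takes its default value 0, and
    the inequality is trivial.\<close>
  proof (cases "integrable \<nu> (\<lambda>w. 1 - cos (u \<bullet> w))")
    case True
    then show ?thesis
      by (subst nn_integral_eq_integral) auto
  qed (simp add: not_integrable_integral_eq)
  also have "\<dots> \<le> (\<integral>\<^sup>+w. ennreal (min 2 (r\<^sup>2 * (norm w)\<^sup>2)) \<partial>\<nu>)"
  proof (intro nn_integral_mono ennreal_leI min.boundedI)
    fix w :: "real ^ 'd"
    show "1 - cos (u \<bullet> w) \<le> 2"
      using cos_ge_minus_one[of "u \<bullet> w"] by linarith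
    have "\<bar>u \<bullet> w\<bar> \<le> r * norm w"
      using Cauchy_Schwarz_ineq2[of u w] mult_right_mono[OF assms, of "norm w"] by auto
    then have "(u \<bullet> w)\<^sup>2 \<le> (r * norm w)\<^sup>2"
      by (metis abs_ge_zero power2_abs power_mono)
    then show "1 - cos (u \<bullet> w) \<le> r\<^sup>2 * (norm w)\<^sup>2"
      using one_minus_cos_le[of "u \<bullet> w"] zero_le_power2[of "u \<bullet> w"] unfolding power_mult_distrib by linarith
  qed
  finally show ?thesis .
qed

text \<open>Integrating over x first is the point: for fixed w the inner integral is at most 4 c |w|
  and at most 2 L, which is \<nu>-integrable by finite variation. Estimating the \<nu>-integral
  first would leave a multiple of 1/x, which diverges at 0.\<close>

lemma nn_integral_truncated_second_moment_finite:
  assumes fv: "finite_variation \<nu>" and "0 < c" "0 < L"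
  shows "(\<integral>\<^sup>+x\<in>{0<..<L}. (\<integral>\<^sup>+w. ennreal (min 2 ((c / x)\<^sup>2 * (norm w)\<^sup>2)) \<partial>\<nu>) \<partial>lborel) < \<infinity>"
proof -
  let ?f = "\<lambda>x w :: real ^ 'd. ennreal (min 2 ((c / x)\<^sup>2 * (norm w)\<^sup>2))"
  interpret pair_sigma_finite \<nu> lborel ..
  have inner: "(\<integral>\<^sup>+x. ?f x w * indicator {0<..<L} x \<partial>lborel)
    \<le> ennreal (2 * L) * indicator {w. 1 \<le> norm w} w +
      ennreal (4 * c) * (ennreal (norm w powr 1) * indicator {w. 0 < norm w \<and> norm w < 1} w)" for w :: "real ^ 'd"
  proof -
    consider "w = 0" | "1 \<le> norm w" | "0 < norm w" "norm w < 1"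
      by fastforce
    then show ?thesis
    proof cases
      case 2
      have "(\<integral>\<^sup>+x. ?f x w * indicator {0<..<L} x \<partial>lborel)
        \<le> (\<integral>\<^sup>+x. ennreal 2 * indicator {0<..<L} x \<partial>lborel)"
        by (intro nn_integral_mono mult_right_mono ennreal_leI) auto
      also have "\<dots> = ennreal (2 * L)"
        using assms by (simp add: nn_integral_cmult ennreal_mult del: ennreal_numeral)
      finally show ?thesis
        using 2 by simp
    next
      case 3
      \<comment> \<open>With this value the estimate is \<open>nn_integral_powr_min_tail\<close> for
        q = 1 and \<beta> = 2, which yields 2 c |w|; pulling the factor 2 out of the minimum makes
        it 4 c |w|.\<close>
      define A where "A = (c * norm w)\<^sup>2"
      have "(\<integral>\<^sup>+x. ?f x w * indicator {0<..<L} x \<partial>lborel)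
        \<le> (\<integral>\<^sup>+x. ennreal 2 * (ennreal (1 * x powr (1 - 1) * min 1 (A * x powr - 2)) * indicator {0<..} x) \<partial>lborel)"
      proof (intro nn_integral_mono)
        fix x :: real
        have min_le: "min 2 ((c / x)\<^sup>2 * (norm w)\<^sup>2) \<le> 2 * min 1 (A * x powr - 2)" if "0 < x"
        proof -
          have "(c / x)\<^sup>2 * (norm w)\<^sup>2 = A * x powr - 2"
            using that by (simp add: A_def power_mult_distrib power_inverse powr_minus divide_inverse)
          moreover have "0 \<le> A * x powr - 2"
            by (simp add: A_def)
          ultimately show ?thesis
            by (simp add: min_def)
        qed
        have le: "?f x w \<le> ennreal 2 * ennreal (min 1 (A * x powr - 2))" if "0 < x"
        proof -
          have "ennreal (2 * min 1 (A * x powr - 2)) = ennreal 2 * ennreal (min 1 (A * x powr - 2))"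
            by (rule ennreal_mult) (simp_all add: A_def)
          with ennreal_leI[OF min_le[OF that]] show ?thesis
            by (rule ord_le_eq_trans)
        qed
        show "?f x w * indicator {0<..<L} x
          \<le> ennreal 2 * (ennreal (1 * x powr (1 - 1) * min 1 (A * x powr - 2)) * indicator {0<..} x)"
          using le by (auto simp: indicator_def simp del: ennreal_numeral)
      qed
      also have "\<dots> = ennreal 2 * (\<integral>\<^sup>+x\<in>{0<..}. ennreal (1 * x powr (1 - 1) * min 1 (A * x powr - 2)) \<partial>lborel)"
        by (rule nn_integral_cmult) measurable
      also have "\<dots> \<le> ennreal 2 * ennreal ((1 + 1 / (2 - 1)) * A powr (1 / 2))"
        using 3 assms by (intro mult_left_mono nn_integral_powr_min_tail) (auto simp: A_def)
      also have "\<dots> = ennreal (4 * c * norm w)"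
        using assms by (simp add: A_def powr_half_sqrt real_sqrt_mult flip: ennreal_mult'' del: ennreal_numeral)
      finally show ?thesis
        using 3 assms by (simp flip: ennreal_mult'')
    qed (simp add: power2_eq_square)
  qed
  have "(\<integral>\<^sup>+x\<in>{0<..<L}. (\<integral>\<^sup>+w. ?f x w \<partial>\<nu>) \<partial>lborel) =
    (\<integral>\<^sup>+x. (\<integral>\<^sup>+w. ?f x w * indicator {0<..<L} x \<partial>\<nu>) \<partial>lborel)"
    by (intro nn_integral_cong nn_integral_multc[symmetric]) measurable
  also have "\<dots> = (\<integral>\<^sup>+w. (\<integral>\<^sup>+x. ?f x w * indicator {0<..<L} x \<partial>lborel) \<partial>\<nu>)"
    by (intro Fubini') measurable
  also have "\<dots> \<le> (\<integral>\<^sup>+w. ennreal (2 * L) * indicator {w. 1 \<le> norm w} w +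
      ennreal (4 * c) * (ennreal (norm w powr 1) * indicator {w. 0 < norm w \<and> norm w < 1} w) \<partial>\<nu>)"
    by (intro nn_integral_mono inner)
  also have "\<dots> = ennreal (2 * L) * emeasure \<nu> {w. 1 \<le> norm w} + ennreal (4 * c) * small_jump_moment \<nu> 1"
    unfolding small_jump_moment_def
    by (simp add: nn_integral_add nn_integral_cmult del: powr_one)
  also have "\<dots> < \<infinity>"
    using fv emeasure_norm_ge_finite[of 1] by (simp add: ennreal_mult_less_top finite_variation_def)
  finally show ?thesis .
qed

end

context pure_jump_levy_process
begin

text \<open>The borderline case: bounding \<open>1 - Re \<phi>\<close> by \<open>|\<psi>|\<close> would lose a logarithm here, so the real
  part of the exponent is kept and integrated over \<open>x\<close> before it is estimated.\<close>

lemma grid_max_moment_finite_variation: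
  assumes fv: "finite_variation \<nu>" and fin: "(\<integral>\<^sup>+\<omega>. ennreal (norm (S 1 \<omega>) powr 1) \<partial>M) < \<infinity>"
  obtains C where "0 \<le> C" "\<And>t n. 0 < t \<Longrightarrow> t \<le> 1 / 2 \<Longrightarrow>
    grid_moment 1 t n \<le> ennreal (C * t powr 1)"
proof (rule grid_max_moment_bound[OF zero_less_one fin order_refl])
  fix L :: real assume L: "0 < L"
  define d where "d = real CARD('d)"
  have d: "0 < d" by (simp add: d_def)
  obtain C where C: "0 < C" "\<And>u. cmod (\<psi> u) \<le> C * (1 + norm u powr 1)"
    using cmod_pure_jump_exponent_le_powr[of 1 \<gamma>] fv unfolding finite_variation_def by auto
  \<comment> \<open>4 d/x is the frequency range of the truncation inequality at the level x/2;
    \<open>h x\<close> bounds - Re \<psi> on it.\<close>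
  define h where "h x = (\<integral>\<^sup>+w. ennreal (min 2 ((4 * d / x)\<^sup>2 * (norm w)\<^sup>2)) \<partial>\<nu>)" for x :: real
  have h_meas [measurable]: "h \<in> borel_measurable borel"
    unfolding h_def by (intro jumps.borel_measurable_nn_integral) measurable
  \<comment> \<open>Chosen such that |\<psi>| <= E/x on the same frequency range for all x < L,
    using 1 <= L/x.\<close>
  define E where "E = C * (L + 4 * d)"
  have E: "0 < E" using C L d by (simp add: E_def)
  define J where "J = enn2real (\<integral>\<^sup>+x\<in>{0<..<L}. h x \<partial>lborel)"
  have J: "(\<integral>\<^sup>+x\<in>{0<..<L}. h x \<partial>lborel) = ennreal J" "0 \<le> J"
    using nn_integral_truncated_second_moment_finite[OF fv, of "4 * d" L] d L by (simp_all add: J_def h_def)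
  show "\<exists>H C. \<forall>t. 0 < t \<longrightarrow> t \<le> 1 / 2 \<longrightarrow>
      tail_majorant 1 1 L C t (H t)"
  proof (intro exI allI impI conjI)
    fix t :: real assume t: "0 < t" "t \<le> 1 / 2"
    \<comment> \<open>The second-order term A/x^2 has exponent 2 > q = 1, so once capped at 1 it
      integrates to a multiple of the square root of \<open>A\<close>, that is, of t: no logarithm
      arises.\<close>
    define A where "A = 4 * d * E\<^sup>2 * t\<^sup>2"
    have A: "0 < A" using t E d by (simp add: A_def)
    show "(\<lambda>x. ennreal (4 * d * t) * h x + ennreal (min 1 (4 * d * E\<^sup>2 * t\<^sup>2 * x powr - 2))) \<in> borel_measurable borel"
      by measurable
    show "0 \<le> 4 * d * J + 4 * sqrt d * E"
      using d J E by simp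
    show "ennreal (min 1 (2 * tail s (x / 2)))
        \<le> ennreal (4 * d * t) * h x + ennreal (min 1 (4 * d * E\<^sup>2 * t\<^sup>2 * x powr - 2))"
      if s: "0 \<le> s" "s \<le> t" and x: "0 < x" "x < L" for s x
    proof (cases "h x")
      case (real r)
      have "tail s (x / 2) \<le> 2 * real CARD('d) * (t * r + t\<^sup>2 * (E\<^sup>2 * x powr - 2))"
      proof (rule prob_norm_gt_le_char)
        fix u :: "real ^ 'd" assume "norm u \<le> 2 * real CARD('d) / (x / 2)"
        then have u: "norm u \<le> 4 * d / x" by (simp add: d_def)
        have "ennreal (- Re (\<psi> u)) \<le> ennreal r"
          using minus_Re_pure_jump_exponent_le[OF u] real by (simp add: h_def)
        then have Re: "- Re (\<psi> u) \<le> r"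
          using real by simp
        have "cmod (\<psi> u) \<le> C * (1 + 4 * d / x)"
          using u C(1) by (intro order_trans[OF C(2)] mult_left_mono add_left_mono) auto
        also have "\<dots> \<le> C * ((L + 4 * d) / x)"
          using C x by (intro mult_left_mono) (auto simp: add_divide_distrib)
        finally have "cmod (\<psi> u) \<le> E / x"
          by (simp add: E_def)
        then have "(cmod (\<psi> u))\<^sup>2 \<le> (E / x)\<^sup>2"
          by (intro power_mono) auto
        then have Psi: "(cmod (\<psi> u))\<^sup>2 \<le> E\<^sup>2 * x powr - 2"
          using x by (simp add: power_mult_distrib power_inverse powr_minus divide_inverse)
        have "1 - Re (CLINT \<omega>|M. iexp (u \<bullet> S s \<omega>)) \<le> s * - Re (\<psi> u) + s\<^sup>2 * (cmod (\<psi> u))\<^sup>2"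
          using s t by (intro one_minus_Re_char_le) auto
        also have "\<dots> \<le> t * r + t\<^sup>2 * (E\<^sup>2 * x powr - 2)"
          using s Re Psi Re_exponent_nonpos[of u] by (intro add_mono mult_mono power_mono) auto
        finally show "1 - Re (CLINT \<omega>|M. iexp (u \<bullet> S s \<omega>)) \<le> t * r + t\<^sup>2 * (E\<^sup>2 * x powr - 2)" .
      qed (use s t x in auto)
      then have "2 * tail s (x / 2) \<le> 4 * d * t * r + 4 * d * E\<^sup>2 * t\<^sup>2 * x powr - 2"
        by (simp add: d_def algebra_simps)
      moreover have "0 \<le> 4 * d * t * r"
        using d t real by simp
      ultimately have "min 1 (2 * tail s (x / 2))
          \<le> 4 * d * t * r + min 1 (4 * d * E\<^sup>2 * t\<^sup>2 * x powr - 2)"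
        by linarith
      then have "ennreal (min 1 (2 * tail s (x / 2)))
          \<le> ennreal (4 * d * t * r + min 1 (4 * d * E\<^sup>2 * t\<^sup>2 * x powr - 2))"
        by (rule ennreal_leI)
      also have "\<dots> = ennreal (4 * d * t) * h x + ennreal (min 1 (4 * d * E\<^sup>2 * t\<^sup>2 * x powr - 2))"
        using d t real E by (simp add: ennreal_mult)
      finally show ?thesis .
    qed (use d t in \<open>simp add: ennreal_mult_top\<close>)
    have "(\<integral>\<^sup>+x\<in>{0<..<L}. ennreal (1 * x powr (1 - 1)) *
        (ennreal (4 * d * t) * h x + ennreal (min 1 (4 * d * E\<^sup>2 * t\<^sup>2 * x powr - 2))) \<partial>lborel)
      \<le> (\<integral>\<^sup>+x. ennreal (4 * d * t) * (h x * indicator {0<..<L} x) +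
         ennreal (1 * x powr (1 - 1) * min 1 (A * x powr - 2)) * indicator {0<..} x \<partial>lborel)"
      by (intro nn_integral_mono) (auto simp: indicator_def A_def)
    also have "\<dots> = ennreal (4 * d * t) * ennreal J +
        (\<integral>\<^sup>+x\<in>{0<..}. ennreal (1 * x powr (1 - 1) * min 1 (A * x powr - 2)) \<partial>lborel)"
      unfolding J(1)[symmetric]
      by (subst nn_integral_add, measurable, subst nn_integral_cmult, measurable)
    also have "\<dots> \<le> ennreal (4 * d * t) * ennreal J + ennreal ((1 + 1 / (2 - 1)) * A powr (1 / 2))"
      using A by (intro add_left_mono nn_integral_powr_min_tail) auto
    also have "A powr (1 / 2) = 2 * sqrt d * E * t"
      using d E t by (simp add: A_def powr_half_sqrt real_sqrt_mult)
    also have "ennreal (4 * d * t) * ennreal J + ennreal ((1 + 1 / (2 - 1)) * (2 * sqrt d * E * t))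
      = ennreal ((4 * d * J + 4 * sqrt d * E) * t powr 1)"
      using d t J E by (simp add: algebra_simps flip: ennreal_mult'' ennreal_plus)
    finally show "(\<integral>\<^sup>+x\<in>{0<..<L}. ennreal (1 * x powr (1 - 1)) *
        (ennreal (4 * d * t) * h x + ennreal (min 1 (4 * d * E\<^sup>2 * t\<^sup>2 * x powr - 2))) \<partial>lborel)
      \<le> ennreal ((4 * d * J + 4 * sqrt d * E) * t powr 1)" .
  qed
qed (use that in auto)

lemma grid_max_moment:
  assumes index: "blumenthal_getoor_index \<nu> < 2"
    and bs: "if finite_variation \<nu> then bs = 1 else blumenthal_getoor_index \<nu> < bs \<and> bs \<le> 2"
    and q: "0 < q" and fin: "(\<integral>\<^sup>+\<omega>. ennreal (norm (S 1 \<omega>) powr q) \<partial>M) < \<infinity>"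
  obtains C where "0 \<le> C" "\<And>t n. 0 < t \<Longrightarrow> t \<le> 1 / 2 \<Longrightarrow>
    grid_moment q t n \<le> ennreal (C * t powr (min 1 (q / bs)))"
proof -
  have bs1: "1 \<le> bs" "bs \<le> 2" "small_jump_moment \<nu> bs < \<infinity>"
    using bs one_le_blumenthal_getoor_index small_jump_moment_finite_above_index[of bs]
    by (auto simp: finite_variation_def split: if_splits)
  consider "q < bs" | "finite_variation \<nu>" "q = 1" "bs = 1" | "finite_variation \<nu>" "1 < q" "bs = 1"
    | "\<not> finite_variation \<nu>" "bs \<le> q"
    using bs by (cases "finite_variation \<nu>"; cases "q < bs"; cases "q = 1") auto
  then show thesis
  proof cases
    case 1
    then have "min 1 (q / bs) = q / bs"
      using bs1 by (simp add: min_def field_simps)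
    then show thesis
      using grid_max_moment_below[OF bs1 q 1 fin] that by metis
  next
    case 2
    then show thesis
      using grid_max_moment_finite_variation fin that by (metis div_by_1 min.idem)
  next
    case 3
    then have "min 1 (q / bs) = 1" by simp
    then show thesis
      using grid_max_moment_above[OF bs1 _ fin] 3 that by metis
  next
    case 4
    \<comment> \<open>The midpoint: finiteness of the moment needs p above the index, and p < bs <=
      q excludes the logarithmic case q = p.\<close>
    define p where "p = (blumenthal_getoor_index \<nu> + bs) / 2"
    have p: "blumenthal_getoor_index \<nu> < p" "p < bs"
      using 4 bs by (auto simp: p_def)
    have "1 \<le> p" "p \<le> 2"
      using p bs1 one_le_blumenthal_getoor_index[OF 4(1)] by linarith+
    moreover have "p < q" using p 4 by linarith
    moreover have "min 1 (q / bs) = 1"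
      using 4 bs1 by (simp add: min_def field_simps)
    ultimately show thesis
      using grid_max_moment_above[of p q] small_jump_moment_finite_above_index[OF p(1)] fin that by metis
  qed
qed

end

section \<open>Brownian motion\<close>

text \<open>Finite-dimensional probabilities depend only on the laws of the increments: by
  independence the increments have a product law, and X(\<tau> k) is almost surely their k-th
  partial sum, as X(0) = 0 almost surely.\<close>

lemma (in prob_space) prob_partial_sums:
  fixes X :: "real \<Rightarrow> 'a \<Rightarrow> real ^ 'd"
  assumes X: "\<And>t. 0 \<le> t \<Longrightarrow> t \<le> 1 \<Longrightarrow> random_variable borel (X t)"
    and X0: "AE \<omega> in M. X 0 \<omega> = 0" and ind: "independent_increments M X"
    and \<tau>: "\<And>k. k \<le> N \<Longrightarrow> 0 \<le> \<tau> k \<and> \<tau> k \<le> 1" "\<And>k. k < N \<Longrightarrow> \<tau> k < \<tau> (Suc k)" "\<tau> 0 = 0"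
    and N: "0 < N" and A: "\<And>k. k \<le> N \<Longrightarrow> A k \<in> sets borel"
  shows "emeasure M {\<omega>\<in>space M. \<forall>k\<le>N. X (\<tau> k) \<omega> \<in> A k} =
    emeasure (PiM {..<N} (\<lambda>i. distr M borel (\<lambda>\<omega>. X (\<tau> (Suc i)) \<omega> - X (\<tau> i) \<omega>)))
      {f\<in>space (PiM {..<N} (\<lambda>_. borel)). \<forall>k\<le>N. (\<Sum>i<k. f i) \<in> A k}"
proof -
  define D where "D i \<omega> = X (\<tau> (Suc i)) \<omega> - X (\<tau> i) \<omega>" for i \<omega>
  define V where "V = {f\<in>space (PiM {..<N} (\<lambda>_. borel :: (real ^ 'd) measure)). \<forall>k\<le>N. (\<Sum>i<k. f i) \<in> A k}"
  have X\<tau>: "random_variable borel (X (\<tau> k))" if "k \<le> N" for k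
    using \<tau>(1)[OF that] by (intro X) auto
  have D: "random_variable borel (D i)" if "i \<in> {..<N}" for i
    using X\<tau>[of i] X\<tau>[of "Suc i"] that unfolding D_def[abs_def] by (intro borel_measurable_diff) auto
  have sum_meas: "(\<lambda>f. \<Sum>i<k. f i) \<in> borel_measurable (PiM {..<N} (\<lambda>_. borel :: (real ^ 'd) measure))" if "k \<le> N" for k
    using that by (intro borel_measurable_sum measurable_component_singleton) auto
  have "V = (\<Inter>k\<in>{..N}. (\<lambda>f. \<Sum>i<k. f i) -` A k \<inter> space (PiM {..<N} (\<lambda>_. borel)))"
    by (auto simp: V_def)
  also have "\<dots> \<in> sets (PiM {..<N} (\<lambda>_. borel))"
    using A sum_meas by (intro sets.finite_INT measurable_sets[OF sum_meas]) auto
  finally have V: "V \<in> sets (PiM {..<N} (\<lambda>_. borel))" .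
  have indD: "indep_vars (\<lambda>_. borel) D {..<N}"
    using ind \<tau> unfolding independent_increments_def D_def[abs_def] by auto
  have "AE \<omega> in M. (\<forall>k\<le>N. X (\<tau> k) \<omega> \<in> A k) \<longleftrightarrow> (\<lambda>i\<in>{..<N}. D i \<omega>) \<in> V"
    using X0
  proof eventually_elim
    case (elim \<omega>)
    have "(\<Sum>i<k. (\<lambda>i\<in>{..<N}. D i \<omega>) i) = X (\<tau> k) \<omega>" if "k \<le> N" for k
    proof -
      have "(\<Sum>i<k. (\<lambda>i\<in>{..<N}. D i \<omega>) i) = (\<Sum>i<k. D i \<omega>)"
        using that by (intro sum.cong) auto
      also have "\<dots> = X (\<tau> k) \<omega>"
        using sum_Suc_diff'[of 0 k "\<lambda>i. X (\<tau> i) \<omega>"] elim by (simp add: D_def \<tau>(3) atLeast0LessThan)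
      finally show ?thesis .
    qed
    then show ?case
      by (auto simp: V_def space_PiM)
  qed
  then have "emeasure M {\<omega>\<in>space M. \<forall>k\<le>N. X (\<tau> k) \<omega> \<in> A k} = emeasure M ((\<lambda>\<omega>. \<lambda>i\<in>{..<N}. D i \<omega>) -` V \<inter> space M)"
  proof (intro emeasure_eq_AE)
    show "{\<omega>\<in>space M. \<forall>k\<le>N. X (\<tau> k) \<omega> \<in> A k} \<in> events"
    proof -
      have "{\<omega>\<in>space M. \<forall>k\<le>N. X (\<tau> k) \<omega> \<in> A k} = (\<Inter>k\<in>{..N}. X (\<tau> k) -` A k \<inter> space M)"
        by auto
      also have "\<dots> \<in> events"
        using A by (intro sets.finite_INT measurable_sets[OF X\<tau>]) auto
      finally show ?thesis .
    qed
    show "(\<lambda>\<omega>. \<lambda>i\<in>{..<N}. D i \<omega>) -` V \<inter> space M \<in> events"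
      using D V by (intro measurable_sets[OF measurable_restrict]) auto
  qed auto
  also have "\<dots> = emeasure (distr M (PiM {..<N} (\<lambda>_. borel)) (\<lambda>\<omega>. \<lambda>i\<in>{..<N}. D i \<omega>)) V"
    using D V by (intro emeasure_distr[symmetric] measurable_restrict) auto
  also have "distr M (PiM {..<N} (\<lambda>_. borel)) (\<lambda>\<omega>. \<lambda>i\<in>{..<N}. D i \<omega>) = PiM {..<N} (\<lambda>i. distr M borel (D i))"
    using indD N D by (subst (asm) indep_vars_iff_distr_eq_PiM') auto
  finally show ?thesis
    by (simp add: V_def D_def[abs_def])
qed

text \<open>Cylinder sets over finitely many times determine a law on the path space, and their
  probabilities are functions of the increment laws.\<close>

lemma (in prob_space) distr_path_eq:
  fixes X Y :: "real \<Rightarrow> 'a \<Rightarrow> real ^ 'd"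
  assumes X: "\<And>t. 0 \<le> t \<Longrightarrow> t \<le> 1 \<Longrightarrow> random_variable borel (X t)" "AE \<omega> in M. X 0 \<omega> = 0" "independent_increments M X"
    and Y: "\<And>t. 0 \<le> t \<Longrightarrow> t \<le> 1 \<Longrightarrow> random_variable borel (Y t)" "AE \<omega> in M. Y 0 \<omega> = 0" "independent_increments M Y"
    and eq: "\<And>s t. 0 \<le> s \<Longrightarrow> s < t \<Longrightarrow> t \<le> 1 \<Longrightarrow>
      distr M borel (\<lambda>\<omega>. X t \<omega> - X s \<omega>) = distr M borel (\<lambda>\<omega>. Y t \<omega> - Y s \<omega>)"
  shows "distr M path_space (path X) = distr M path_space (path Y)"
proof (rule measure_eqI_PiM_infinite[where I="{0..1}" and M="\<lambda>_. borel"])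
  have path: "path Z \<in> measurable M path_space" if "\<And>t. 0 \<le> t \<Longrightarrow> t \<le> 1 \<Longrightarrow> random_variable borel (Z t)"
    for Z :: "real \<Rightarrow> 'a \<Rightarrow> real ^ 'd"
    using that unfolding path_def[abs_def] path_space_def by (intro measurable_restrict) auto
  show "finite_measure (distr M path_space (path X))"
    using path X by (intro finite_measure_distr) auto
  fix A :: "real \<Rightarrow> (real ^ 'd) set" and J :: "real set"
  assume J: "finite J" "J \<subseteq> {0..1}" and A: "\<And>i. i \<in> J \<Longrightarrow> A i \<in> sets borel"
  define E where "E = prod_emb {0..1} (\<lambda>_. borel :: (real ^ 'd) measure) J (Pi\<^sub>E J A)"
  have E: "E \<in> sets path_space"
    unfolding E_def path_space_def using J A by (intro sets_PiM_I) auto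
  \<comment> \<open>Adding 0 lets the partial sums start at the origin; adding 1 guarantees two grid
    points, hence at least one increment, even if \<open>J\<close> is empty. Times outside
    \<open>J\<close> get the trivial constraint \<open>UNIV\<close> in \<open>A'\<close>.\<close>
  define K where "K = insert 0 (insert 1 J)"
  define ts where "ts = sorted_list_of_set K"
  define N where "N = length ts - 1"
  have "finite K" using J by (simp add: K_def)
  then have set_ts: "set ts = insert 0 (insert 1 J)" and ts: "sorted_wrt (<) ts"
    unfolding ts_def by (simp_all add: K_def del: sorted_list_of_set_insert_remove)
  have "card (set ts) = length ts"
    using ts by (intro distinct_card) (simp add: strict_sorted_iff)
  moreover have "card {0, 1 :: real} \<le> card (set ts)"
    using J by (intro card_mono) (auto simp: set_ts)
  ultimately have len: "2 \<le> length ts" by simp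
  then have N: "0 < N" "length ts = Suc N" by (auto simp: N_def)
  have \<tau>: "0 \<le> ts ! k \<and> ts ! k \<le> 1" if "k \<le> N" for k
    using that nth_mem[of k ts] J by (auto simp: set_ts N(2))
  have \<tau>_less: "ts ! k < ts ! Suc k" if "k < N" for k
    using sorted_wrt_nth_less[OF ts, of k "Suc k"] that by (simp add: N(2))
  have \<tau>0: "ts ! 0 = 0"
  proof -
    obtain i where i: "i \<le> N" "ts ! i = 0"
      using set_ts by (metis in_set_conv_nth insertI1 N(2) less_Suc_eq_le)
    then have "i = 0 \<or> ts ! 0 < ts ! i"
      using sorted_wrt_nth_less[OF ts, of 0 i] by (auto simp: N(2))
    then show ?thesis using i \<tau>[of 0] by auto
  qed
  define A' where "A' k = (if ts ! k \<in> J then A (ts ! k) else UNIV)" for k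
  have A': "A' k \<in> sets borel" for k
    using A by (auto simp: A'_def)
  have prob: "emeasure (distr M path_space (path Z)) E = emeasure (PiM {..<N} (\<lambda>i. distr M borel (\<lambda>\<omega>. Z (ts ! Suc i) \<omega> - Z (ts ! i) \<omega>)))
      {f\<in>space (PiM {..<N} (\<lambda>_. borel)). \<forall>k\<le>N. (\<Sum>i<k. f i) \<in> A' k}"
    if Z: "\<And>t. 0 \<le> t \<Longrightarrow> t \<le> 1 \<Longrightarrow> random_variable borel (Z t)" "AE \<omega> in M. Z 0 \<omega> = 0" "independent_increments M Z"
    for Z :: "real \<Rightarrow> 'a \<Rightarrow> real ^ 'd"
  proof -
    have "path Z -` E \<inter> space M = {\<omega>\<in>space M. \<forall>k\<le>N. Z (ts ! k) \<omega> \<in> A' k}"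
    proof -
      have "path Z \<omega> \<in> E \<longleftrightarrow> (\<forall>j\<in>J. Z j \<omega> \<in> A j)" for \<omega>
        unfolding E_def path_def using J by (auto simp: prod_emb_def PiE_iff)
      moreover have "(\<forall>j\<in>J. Z j \<omega> \<in> A j) \<longleftrightarrow> (\<forall>k\<le>N. Z (ts ! k) \<omega> \<in> A' k)" for \<omega>
      proof
        assume *: "\<forall>k\<le>N. Z (ts ! k) \<omega> \<in> A' k"
        show "\<forall>j\<in>J. Z j \<omega> \<in> A j"
        proof
          fix j assume "j \<in> J"
          then obtain k where "k \<le> N" "ts ! k = j"
            using set_ts by (metis in_set_conv_nth insertI2 N(2) less_Suc_eq_le)
          then show "Z j \<omega> \<in> A j"
            using * \<open>j \<in> J\<close> by (auto simp: A'_def)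
        qed
      qed (auto simp: A'_def)
      ultimately show ?thesis by auto
    qed
    then have "emeasure (distr M path_space (path Z)) E = emeasure M {\<omega>\<in>space M. \<forall>k\<le>N. Z (ts ! k) \<omega> \<in> A' k}"
      using emeasure_distr[OF path[OF Z(1)] E] by simp
    also have "\<dots> = emeasure (PiM {..<N} (\<lambda>i. distr M borel (\<lambda>\<omega>. Z (ts ! Suc i) \<omega> - Z (ts ! i) \<omega>)))
      {f\<in>space (PiM {..<N} (\<lambda>_. borel)). \<forall>k\<le>N. (\<Sum>i<k. f i) \<in> A' k}"
      by (rule prob_partial_sums[OF Z]) (use \<tau> \<tau>_less \<tau>0 N A' in auto)
    finally show ?thesis .
  qed
  have "PiM {..<N} (\<lambda>i. distr M borel (\<lambda>\<omega>. X (ts ! Suc i) \<omega> - X (ts ! i) \<omega>)) =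
    PiM {..<N} (\<lambda>i. distr M borel (\<lambda>\<omega>. Y (ts ! Suc i) \<omega> - Y (ts ! i) \<omega>))"
    using \<tau> \<tau>_less by (intro PiM_cong refl eq) auto
  then show "emeasure (distr M path_space (path X)) (prod_emb {0..1} (\<lambda>_. borel) J (Pi\<^sub>E J A)) =
    emeasure (distr M path_space (path Y)) (prod_emb {0..1} (\<lambda>_. borel) J (Pi\<^sub>E J A))"
    using prob[OF X] prob[OF Y] unfolding E_def by simp
qed (simp_all add: path_space_def)

definition std_gaussian_density :: "real \<Rightarrow> real ^ 'd \<Rightarrow> real" where
  "std_gaussian_density \<sigma> x = (\<Prod>i\<in>UNIV. normal_density 0 \<sigma> (x $ i))"

lemma std_gaussian_density_nonneg: "0 \<le> std_gaussian_density \<sigma> x"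
  by (simp add: std_gaussian_density_def prod_nonneg)

lemma borel_measurable_std_gaussian_density [measurable]: "std_gaussian_density \<sigma> \<in> borel_measurable borel"
  unfolding std_gaussian_density_def[abs_def] by measurable

text \<open>Change of variables: the Jacobian c^d supplies one factor c for each of the d
  one-dimensional densities.\<close>

lemma distr_scaleR_gaussian:
  assumes "0 < c" "0 < \<sigma>"
  shows "distr (density lborel (std_gaussian_density \<sigma> :: real ^ 'd \<Rightarrow> real)) borel (\<lambda>x. c *\<^sub>R x)
    = density lborel (std_gaussian_density (c * \<sigma>) :: real ^ 'd \<Rightarrow> real)"
proof -
  let ?T = "\<lambda>x :: real ^ 'd. c *\<^sub>R x"
  have eq: "c ^ CARD('d) * std_gaussian_density (c * \<sigma>) (?T x) = std_gaussian_density \<sigma> x" for x :: "real ^ 'd"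
  proof -
    have "c * normal_density 0 (c * \<sigma>) (c * y) = normal_density 0 \<sigma> y" for y
      using assms by (simp add: normal_density_def power_mult_distrib real_sqrt_mult)
    then have "(\<Prod>i\<in>(UNIV :: 'd set). c * normal_density 0 (c * \<sigma>) (c * x $ i)) = std_gaussian_density \<sigma> x"
      by (simp add: std_gaussian_density_def)
    then show ?thesis
      by (simp add: prod.distrib std_gaussian_density_def)
  qed
  have "density lborel (std_gaussian_density (c * \<sigma>) :: real ^ 'd \<Rightarrow> real) =
    density (density (distr lborel borel ?T) (\<lambda>_. ennreal (c ^ CARD('d)))) (std_gaussian_density (c * \<sigma>))"
    using lborel_affine[of c "0 :: real ^ 'd"] assms by (simp add: ennreal_power)
  also have "\<dots> = density (distr lborel borel ?T) (\<lambda>x. ennreal (c ^ CARD('d) * std_gaussian_density (c * \<sigma>) x))"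
    using assms by (subst density_density_eq) (auto simp: ennreal_mult std_gaussian_density_nonneg)
  also have "\<dots> = distr (density lborel (\<lambda>x. ennreal (c ^ CARD('d) * std_gaussian_density (c * \<sigma>) (?T x)))) borel ?T"
    by (subst density_distr) auto
  finally show ?thesis
    by (simp add: eq)
qed

lemma measurable_matrix_vector_mult [measurable (raw)]:
  fixes A :: "real ^ 'd ^ 'd"
  assumes "f \<in> borel_measurable M"
  shows "(\<lambda>x. A *v f x) \<in> borel_measurable M"
  by (rule borel_measurable_continuous_on[OF _ assms])
     (intro linear_continuous_on matrix_vector_mul_bounded_linear)

locale brownian = prob_space M for M :: "'a measure" +
  fixes B :: "real \<Rightarrow> 'a \<Rightarrow> real ^ 'd"
  assumes brownian_motion: "brownian_motion M B"
begin

lemma random_variable_B [measurable]: "0 \<le> t \<Longrightarrow> t \<le> 1 \<Longrightarrow> random_variable borel (B t)"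
  using brownian_motion by (auto simp: brownian_motion_def)

lemma B_0: "AE \<omega> in M. B 0 \<omega> = 0"
  using brownian_motion by (auto simp: brownian_motion_def)

lemma distr_increment:
  assumes "0 \<le> s" "s < t" "t \<le> 1"
  shows "distr M borel (\<lambda>\<omega>. B t \<omega> - B s \<omega>) = density lborel (std_gaussian_density (sqrt (t - s)))"
proof -
  have "distributed M lborel (\<lambda>\<omega>. B t \<omega> - B s \<omega>) (\<lambda>x. ennreal (std_gaussian_density (sqrt (t - s)) x))"
    using brownian_motion assms unfolding brownian_motion_def std_gaussian_density_def by blast
  then have "distr M lborel (\<lambda>\<omega>. B t \<omega> - B s \<omega>) = density lborel (std_gaussian_density (sqrt (t - s)))"
    by (simp add: distributed_def)
  then show ?thesis
    by (simp add: distr_cong[OF refl sets_lborel refl])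
qed

text \<open>Brownian scaling for whole paths: multiplying by 1/sqrt t turns the increment variance t
  (r - s) into r - s. Equality on the path space is what allows the rescaled motion to stand in for
  the target in a coupling.\<close>

lemma distr_scaled_path:
  fixes A :: "real ^ 'd ^ 'd"
  assumes t: "0 < t" "t \<le> 1"
  shows "distr M path_space (path (\<lambda>s \<omega>. A *v ((1 / sqrt t) *\<^sub>R B (s * t) \<omega>))) = distr M path_space (path (\<lambda>s \<omega>. A *v B s \<omega>))"
proof (rule distr_path_eq)
  let ?c = "1 / sqrt t"
  have st: "0 \<le> s * t \<and> s * t \<le> 1" if "0 \<le> s" "s \<le> 1" for s
    using that t by (simp add: mult_le_one)
  have B [measurable]: "random_variable borel (B (s * t))" "random_variable borel (B s)" if "0 \<le> s" "s \<le> 1" for s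
    using st[OF that] that by (auto intro: random_variable_B)
  have diff: "A *v (?c *\<^sub>R x) - A *v (?c *\<^sub>R y) = A *v (?c *\<^sub>R (x - y))" for x y
    by (simp add: matrix_vector_mult_diff_distrib scaleR_diff_right)
  have indB: "indep_vars (\<lambda>_. borel) (\<lambda>i \<omega>. B (\<tau> (Suc i)) \<omega> - B (\<tau> i) \<omega>) {..<n}"
    if "\<And>i. i \<le> n \<Longrightarrow> \<tau> i \<in> {0..1}" "\<And>i. i < n \<Longrightarrow> \<tau> i < \<tau> (Suc i)" for \<tau> :: "nat \<Rightarrow> real" and n
    using brownian_motion that unfolding brownian_motion_def independent_increments_def by blast
  show "independent_increments M (\<lambda>s \<omega>. A *v (?c *\<^sub>R B (s * t) \<omega>))"
    unfolding independent_increments_def diff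
  proof (intro allI impI)
    fix n and \<tau> :: "nat \<Rightarrow> real" assume \<tau>: "\<forall>i\<le>n. \<tau> i \<in> {0..1}" "\<forall>i<n. \<tau> i < \<tau> (Suc i)"
    have "indep_vars (\<lambda>_. borel) (\<lambda>i \<omega>. B (\<tau> (Suc i) * t) \<omega> - B (\<tau> i * t) \<omega>) {..<n}"
      using \<tau> st t by (intro indB[of n "\<lambda>i. \<tau> i * t"]) auto
    then show "indep_vars (\<lambda>_. borel) (\<lambda>i \<omega>. A *v (?c *\<^sub>R (B (\<tau> (Suc i) * t) \<omega> - B (\<tau> i * t) \<omega>))) {..<n}"
      by (rule indep_vars_compose2[where Y="\<lambda>_ x. A *v (?c *\<^sub>R x)"]) measurable
  qed
  show "independent_increments M (\<lambda>s \<omega>. A *v B s \<omega>)"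
    unfolding independent_increments_def matrix_vector_mult_diff_distrib[symmetric]
  proof (intro allI impI)
    fix n and \<tau> :: "nat \<Rightarrow> real" assume \<tau>: "\<forall>i\<le>n. \<tau> i \<in> {0..1}" "\<forall>i<n. \<tau> i < \<tau> (Suc i)"
    have "indep_vars (\<lambda>_. borel) (\<lambda>i \<omega>. B (\<tau> (Suc i)) \<omega> - B (\<tau> i) \<omega>) {..<n}"
      using \<tau> by (intro indB) auto
    then show "indep_vars (\<lambda>_. borel) (\<lambda>i \<omega>. A *v (B (\<tau> (Suc i)) \<omega> - B (\<tau> i) \<omega>)) {..<n}"
      by (rule indep_vars_compose2[where Y="\<lambda>_ x. A *v x"]) measurable
  qed
  show "distr M borel (\<lambda>\<omega>. A *v (?c *\<^sub>R B (r * t) \<omega>) - A *v (?c *\<^sub>R B (s * t) \<omega>))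
    = distr M borel (\<lambda>\<omega>. A *v B r \<omega> - A *v B s \<omega>)" if sr: "0 \<le> s" "s < r" "r \<le> 1" for s r
  proof -
    have [measurable]: "random_variable borel (B (r * t))" "random_variable borel (B (s * t))"
      "random_variable borel (B r)" "random_variable borel (B s)"
      using sr by (auto intro!: B)
    have "distr M borel (\<lambda>\<omega>. A *v (?c *\<^sub>R (B (r * t) \<omega> - B (s * t) \<omega>)))
      = distr (distr (distr M borel (\<lambda>\<omega>. B (r * t) \<omega> - B (s * t) \<omega>)) borel (\<lambda>x. ?c *\<^sub>R x)) borel (\<lambda>x. A *v x)"
      by (simp add: distr_distr comp_def)
    also have "distr M borel (\<lambda>\<omega>. B (r * t) \<omega> - B (s * t) \<omega>) = density lborel (std_gaussian_density (sqrt (r * t - s * t)))"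
      using sr st[of s] st[of r] t by (intro distr_increment) auto
    also have "distr (density lborel (std_gaussian_density (sqrt (r * t - s * t)) :: real ^ 'd \<Rightarrow> real)) borel (\<lambda>x. ?c *\<^sub>R x)
      = density lborel (std_gaussian_density (?c * sqrt (r * t - s * t)))"
      using sr t by (intro distr_scaleR_gaussian) auto
    also have "?c * sqrt (r * t - s * t) = sqrt (r - s)"
      using t by (simp add: real_sqrt_mult flip: left_diff_distrib)
    also have "density lborel (std_gaussian_density (sqrt (r - s)) :: real ^ 'd \<Rightarrow> real) = distr M borel (\<lambda>\<omega>. B r \<omega> - B s \<omega>)"
      using sr by (intro distr_increment[symmetric]) auto
    also have "distr \<dots> borel (\<lambda>x. A *v x) = distr M borel (\<lambda>\<omega>. A *v (B r \<omega> - B s \<omega>))"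
      by (simp add: distr_distr comp_def)
    finally show ?thesis
      by (simp add: diff matrix_vector_mult_diff_distrib)
  qed
qed (use B_0 t in \<open>auto intro!: measurable_matrix_vector_mult borel_measurable_scaleR random_variable_B mult_le_one\<close>)

text \<open>A time step of 1/2 gives variance 1/2, which leaves room for a factor exp(|x|^2/2): the
  product is a multiple of the standard Gaussian density. That factor absorbs |x|^q, because y <= q
  exp(y/q) and y <= (1 + y^2)/2. Two such steps cover [0,1].\<close>

lemma nn_integral_increment_powr_finite:
  assumes "0 < q" "0 \<le> s" "t \<le> 1" "t - s = 1 / 2"
  shows "(\<integral>\<^sup>+\<omega>. ennreal (norm (B t \<omega> - B s \<omega>) powr q) \<partial>M) < \<infinity>"
proof -
  have [measurable]: "random_variable borel (B t)" "random_variable borel (B s)" "random_variable borel (B 0)" "random_variable borel (B 1)"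
    using assms by (auto intro!: random_variable_B)
  have powr_le: "y powr q \<le> q powr q * exp (1 / 2) * exp (y\<^sup>2 / 2)" if "0 \<le> y" for y :: real
  proof -
    have "y \<le> q * exp (y / q)"
      using exp_ge_add_one_self[of "y / q"] assms(1) by (simp add: field_simps)
    then have "y powr q \<le> (q * exp (y / q)) powr q"
      using that assms(1) by (intro powr_mono2) auto
    also have "\<dots> = q powr q * exp y"
      using assms(1) by (simp add: powr_mult exp_powr_real)
    also have "\<dots> \<le> q powr q * exp (1 / 2 + y\<^sup>2 / 2)"
      using zero_le_power2[of "y - 1"] by (intro mult_left_mono) (auto simp: power2_eq_square algebra_simps)
    finally show ?thesis by (simp add: exp_add mult.assoc)
  qed
  have dens: "std_gaussian_density (sqrt (1 / 2)) x * exp ((norm x)\<^sup>2 / 2) = sqrt 2 ^ CARD('d) * std_gaussian_density 1 x"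
    for x :: "real ^ 'd"
  proof -
    have n2: "(norm x)\<^sup>2 = (\<Sum>i\<in>UNIV. (x $ i)\<^sup>2)"
      by (simp add: norm_vec_def L2_set_def sum_nonneg)
    have "normal_density 0 (sqrt (1 / 2)) y * exp (y\<^sup>2 / 2) = sqrt 2 * normal_density 0 1 y" for y
      by (simp add: normal_density_def real_sqrt_mult field_simps flip: exp_add)
    then have "(\<Prod>i\<in>UNIV. normal_density 0 (sqrt (1 / 2)) (x $ i) * exp ((x $ i)\<^sup>2 / 2)) = (\<Prod>i\<in>UNIV. sqrt 2 * normal_density 0 1 (x $ i))"
      by simp
    then show ?thesis
      by (simp add: std_gaussian_density_def prod.distrib n2 exp_sum sum_divide_distrib)
  qed
  \<comment> \<open>The normalisation is read off from the Brownian motion itself: this is the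
    density of its increment over [0,1], a probability law.\<close>
  have total: "(\<integral>\<^sup>+x. ennreal (std_gaussian_density 1 (x :: real ^ 'd)) \<partial>lborel) = 1"
  proof -
    have "(\<integral>\<^sup>+x. ennreal (std_gaussian_density 1 (x :: real ^ 'd)) \<partial>lborel) = emeasure (density lborel (std_gaussian_density 1 :: real ^ 'd \<Rightarrow> real)) UNIV"
      by (subst emeasure_density) auto
    also have "\<dots> = emeasure (distr M borel (\<lambda>\<omega>. B 1 \<omega> - B 0 \<omega>)) UNIV"
      by (subst distr_increment) auto
    also have "\<dots> = 1"
      by (subst emeasure_distr) (auto simp: emeasure_space_1)
    finally show ?thesis .
  qed
  have "(\<integral>\<^sup>+\<omega>. ennreal (norm (B t \<omega> - B s \<omega>) powr q) \<partial>M) = (\<integral>\<^sup>+x. ennreal (norm x powr q) \<partial>distr M borel (\<lambda>\<omega>. B t \<omega> - B s \<omega>))"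
    by (subst nn_integral_distr) auto
  also have "\<dots> = (\<integral>\<^sup>+x. ennreal (std_gaussian_density (sqrt (1 / 2)) x) * ennreal (norm (x :: real ^ 'd) powr q) \<partial>lborel)"
  proof -
    have "distr M borel (\<lambda>\<omega>. B t \<omega> - B s \<omega>) = density lborel (std_gaussian_density (sqrt (1 / 2)))"
    proof -
      have "s < t" using assms(4) by linarith
      then show ?thesis
        using distr_increment[of s t] assms(2,3) unfolding assms(4) by blast
    qed
    then show ?thesis
      by (simp add: nn_integral_density)
  qed
  also have "\<dots> \<le> (\<integral>\<^sup>+x. ennreal (q powr q * exp (1 / 2) * sqrt 2 ^ CARD('d)) * ennreal (std_gaussian_density 1 (x :: real ^ 'd)) \<partial>lborel)"
  proof (intro nn_integral_mono)
    fix x :: "real ^ 'd"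
    have "std_gaussian_density (sqrt (1 / 2)) x * norm x powr q
      \<le> std_gaussian_density (sqrt (1 / 2)) x * (q powr q * exp (1 / 2) * exp ((norm x)\<^sup>2 / 2))"
      by (intro mult_left_mono powr_le) (auto simp: std_gaussian_density_nonneg)
    also have "\<dots> = q powr q * exp (1 / 2) * (std_gaussian_density (sqrt (1 / 2)) x * exp ((norm x)\<^sup>2 / 2))"
      by simp
    also have "\<dots> = (q powr q * exp (1 / 2) * sqrt 2 ^ CARD('d)) * std_gaussian_density 1 x"
      by (simp only: dens mult.assoc)
    finally show "ennreal (std_gaussian_density (sqrt (1 / 2)) x) * ennreal (norm x powr q)
      \<le> ennreal (q powr q * exp (1 / 2) * sqrt 2 ^ CARD('d)) * ennreal (std_gaussian_density 1 x)"
      by (subst (1 2) ennreal_mult[symmetric]) (auto simp: std_gaussian_density_nonneg intro!: ennreal_leI)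
  qed
  also have "\<dots> = ennreal (q powr q * exp (1 / 2) * sqrt 2 ^ CARD('d))"
    by (subst nn_integral_cmult) (auto simp: total)
  finally show ?thesis
    by (auto simp: top.not_eq_extremum intro: le_less_trans)
qed

lemma nn_integral_B_powr_finite:
  assumes "0 < q"
  shows "(\<integral>\<^sup>+\<omega>. ennreal (norm (B 1 \<omega>) powr q) \<partial>M) < \<infinity>"
proof -
  have [measurable]: "random_variable borel (B 1)" "random_variable borel (B 0)" "random_variable borel (B (1 / 2))"
    by (auto intro!: random_variable_B)
  have "(\<integral>\<^sup>+\<omega>. ennreal (norm (B 1 \<omega>) powr q) \<partial>M)
    \<le> (\<integral>\<^sup>+\<omega>. ennreal ((norm (B 1 \<omega> - B (1 / 2) \<omega>) + norm (B (1 / 2) \<omega> - B 0 \<omega>)) powr q) \<partial>M)"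
  proof (intro nn_integral_mono_AE)
    show "AE \<omega> in M. ennreal (norm (B 1 \<omega>) powr q) \<le> ennreal ((norm (B 1 \<omega> - B (1 / 2) \<omega>) + norm (B (1 / 2) \<omega> - B 0 \<omega>)) powr q)"
      using B_0
    proof eventually_elim
      case (elim \<omega>)
      then have "norm (B 1 \<omega>) \<le> norm (B 1 \<omega> - B (1 / 2) \<omega>) + norm (B (1 / 2) \<omega> - B 0 \<omega>)"
        using norm_triangle_ineq[of "B 1 \<omega> - B (1 / 2) \<omega>" "B (1 / 2) \<omega>"] by simp
      then show ?case
        using assms by (intro ennreal_leI powr_mono2) auto
    qed
  qed
  also have "\<dots> < \<infinity>"
    using assms nn_integral_increment_powr_finite[of q "1 / 2" 1] nn_integral_increment_powr_finite[of q 0 "1 / 2"]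
    by (intro nn_integral_powr_add_finite) auto
  finally show ?thesis .
qed

end

section \<open>Couplings of cadlag processes\<close>

text \<open>Passing to \<open>path\<close> changes a trajectory outside [0,1]; the one-sided limits
  in \<open>cadlag\<close> only see nearby times inside that interval.\<close>

lemma cadlag_cong:
  assumes "\<And>t. 0 \<le> t \<Longrightarrow> t \<le> 1 \<Longrightarrow> f t = g t" "cadlag f"
  shows "cadlag g"
  unfolding cadlag_def
proof (intro conjI ballI)
  fix t :: real assume t: "t \<in> {0..<1}"
  have "eventually (\<lambda>s. s < 1) (at_right t)"
    using t by (intro eventually_at_right_less eventually_at_rightI[of t 1]) auto
  then have "eventually (\<lambda>s. f s = g s) (at_right t)"
    using eventually_at_right_less[of t] by eventually_elim (use t assms in auto)
  moreover have "(f \<longlongrightarrow> f t) (at_right t)"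
    using assms(2) t by (auto simp: cadlag_def)
  ultimately show "(g \<longlongrightarrow> g t) (at_right t)"
    using t assms(1)[of t] by (metis atLeastLessThan_iff less_imp_le tendsto_cong)
next
  fix t :: real assume t: "t \<in> {0<..1}"
  have "eventually (\<lambda>s. 0 < s \<and> s < t) (at_left t)"
    using t by (intro eventually_at_leftI[of 0 t]) auto
  then have "eventually (\<lambda>s. f s = g s) (at_left t)"
    by eventually_elim (use t assms in auto)
  moreover obtain l where "(f \<longlongrightarrow> l) (at_left t)"
    using assms(2) t unfolding cadlag_def by blast
  ultimately show "\<exists>l. (g \<longlongrightarrow> l) (at_left t)"
    by (auto simp: cong: tendsto_cong)
qed

lemma cadlag_continuous_image2:
  assumes "cadlag f" "cadlag g" and h: "\<And>x y. isCont (\<lambda>(x, y). h x y) (x, y)"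
  shows "cadlag (\<lambda>t. h (f t) (g t))"
proof -
  have lim: "((\<lambda>t. h (f t) (g t)) \<longlongrightarrow> h a b) F" if "(f \<longlongrightarrow> a) F" "(g \<longlongrightarrow> b) F" for a b F
    using isCont_tendsto_compose[OF h[of a b] tendsto_Pair[OF that]] by simp
  show ?thesis
    unfolding cadlag_def
  proof (intro conjI ballI)
    fix t :: real assume "t \<in> {0<..1}"
    moreover from this obtain a where "(f \<longlongrightarrow> a) (at_left t)"
      using assms(1) unfolding cadlag_def by blast
    moreover obtain b where "(g \<longlongrightarrow> b) (at_left t)"
      using assms(2) calculation(1) unfolding cadlag_def by blast
    ultimately show "\<exists>l. ((\<lambda>t. h (f t) (g t)) \<longlongrightarrow> l) (at_left t)"
      using lim by blast
  qed (use assms lim in \<open>auto simp: cadlag_def\<close>)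
qed

lemma cadlag_diff:
  fixes f g :: "real \<Rightarrow> 'b::real_normed_vector"
  assumes "cadlag f" "cadlag g"
  shows "cadlag (\<lambda>t. f t - g t)"
  using assms by (rule cadlag_continuous_image2) (simp add: case_prod_beta')

lemma cadlag_time_scale:
  assumes "cadlag f" and c: "0 < c" "c \<le> 1"
  shows "cadlag (\<lambda>t. f (t * c))"
  unfolding cadlag_def
proof (intro conjI ballI)
  fix t :: real assume t: "t \<in> {0..<1}"
  have tc: "t * c < 1" using t c mult_strict_mono[of t 1 c 1] mult_le_one[of t c] by (cases "c = 1") (auto simp: mult_less_cancel_left2 intro: le_less_trans)
  have "filterlim (\<lambda>s. s * c) (at_right (t * c)) (at_right t)"
    using c by (intro filterlim_at_withinI tendsto_intros eventually_at_rightI[of t "t + 1"]) auto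
  moreover have "(f \<longlongrightarrow> f (t * c)) (at_right (t * c))"
    using assms(1) t c tc by (auto simp: cadlag_def)
  ultimately show "((\<lambda>t. f (t * c)) \<longlongrightarrow> f (t * c)) (at_right t)"
    by (rule filterlim_compose[rotated])
next
  fix t :: real assume t: "t \<in> {0<..1}"
  have "filterlim (\<lambda>s. s * c) (at_left (t * c)) (at_left t)"
    using c by (intro filterlim_at_withinI tendsto_intros eventually_at_leftI[of "t - 1" t]) auto
  moreover have "t * c \<in> {0<..1}"
    using t c by (simp add: mult_le_one)
  then obtain l where "(f \<longlongrightarrow> l) (at_left (t * c))"
    using assms(1) unfolding cadlag_def by blast
  ultimately show "\<exists>l. ((\<lambda>t. f (t * c)) \<longlongrightarrow> l) (at_left t)"
    by (auto intro: filterlim_compose)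
qed

lemma continuous_on_imp_cadlag:
  assumes "continuous_on {0..1} f"
  shows "cadlag f"
  unfolding cadlag_def
proof (intro conjI ballI)
  fix t :: real assume t: "t \<in> {0..<1}"
  have "(f \<longlongrightarrow> f t) (at t within {0..1})"
    using assms t by (auto simp: continuous_on_def)
  then have "(f \<longlongrightarrow> f t) (at t within {t..1})"
    by (rule tendsto_within_subset) (use t in auto)
  then show "(f \<longlongrightarrow> f t) (at_right t)"
    using t by (simp add: at_within_Icc_at_right)
next
  fix t :: real assume t: "t \<in> {0<..1}"
  have "(f \<longlongrightarrow> f t) (at t within {0..1})"
    using assms t by (auto simp: continuous_on_def)
  then have "(f \<longlongrightarrow> f t) (at t within {0..t})"
    by (rule tendsto_within_subset) (use t in auto)
  then show "\<exists>l. (f \<longlongrightarrow> l) (at_left t)"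
    using t by (auto simp: at_within_Icc_at_left)
qed

section \<open>Suprema of cadlag paths over dyadic times\<close>

definition dyadic_max :: "nat \<Rightarrow> (real \<Rightarrow> 'b::real_normed_vector) \<Rightarrow> real" where
  "dyadic_max n z = (MAX k\<in>{..2 ^ n}. norm (z (real k / 2 ^ n)))"

lemma dyadic_max_ge: "k \<le> 2 ^ n \<Longrightarrow> norm (z (real k / 2 ^ n)) \<le> dyadic_max n z"
  unfolding dyadic_max_def by (intro Max_ge) auto

lemma dyadic_max_nonneg: "0 \<le> dyadic_max n z"
  by (rule order_trans[OF norm_ge_zero dyadic_max_ge[of 0]]) simp

text \<open>Each s < 1 is approached strictly from the right by (floor(s 2^n) + 1)/2^n, a dyadic
  time at most 1, so right-continuity transfers the bound; s = 1 is itself a grid point.\<close>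

lemma cadlag_norm_le:
  fixes z :: "real \<Rightarrow> 'b::real_normed_vector"
  assumes z: "cadlag z" and bound: "\<And>k n. k \<le> 2 ^ n \<Longrightarrow> norm (z (real k / 2 ^ n)) \<le> m"
    and s: "0 \<le> s" "s \<le> 1"
  shows "norm (z s) \<le> m"
proof (cases "s = 1")
  case True
  then show ?thesis
    using bound[of 1 0] by simp
next
  case False
  then have s: "0 \<le> s" "s < 1" using s by auto
  define k where "k n = nat \<lfloor>s * 2 ^ n\<rfloor> + 1" for n :: nat
  have k: "real (k n) = of_int \<lfloor>s * 2 ^ n\<rfloor> + 1" for n
    using s by (simp add: k_def)
  have k_gt: "s < real (k n) / 2 ^ n" for n
    unfolding k by (simp add: pos_less_divide_eq)
  have k_le: "real (k n) / 2 ^ n \<le> s + (1 / 2) ^ n" for n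
  proof -
    have "real (k n) \<le> s * 2 ^ n + 1" unfolding k by linarith
    then show ?thesis by (simp add: field_simps power_divide)
  qed
  have "k n \<le> 2 ^ n" for n
  proof -
    have "s * 2 ^ n < 2 ^ n" using s by simp
    then have "\<lfloor>s * 2 ^ n\<rfloor> < 2 ^ n" by (simp add: floor_less_iff)
    then show ?thesis using s by (simp add: k_def nat_less_iff Suc_le_eq)
  qed
  then have le: "norm (z (real (k n) / 2 ^ n)) \<le> m" for n
    by (rule bound)
  have lim: "(\<lambda>n. s + (1 / 2) ^ n) \<longlonglongrightarrow> s"
    using tendsto_add[OF tendsto_const[of s] LIMSEQ_realpow_zero[of "1 / 2"]] by simp
  have "(\<lambda>n. real (k n) / 2 ^ n) \<longlonglongrightarrow> s"
    by (rule tendsto_sandwich[OF _ _ tendsto_const lim])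
       (rule always_eventually, rule allI, rule less_imp_le[OF k_gt] k_le)+
  then have "filterlim (\<lambda>n. real (k n) / 2 ^ n) (at_right s) sequentially"
    using k_gt by (intro filterlim_at_withinI) (auto intro!: always_eventually simp: less_imp_neq[symmetric])
  moreover have "(z \<longlongrightarrow> z s) (at_right s)"
    using z s by (auto simp: cadlag_def)
  ultimately have "(\<lambda>n. z (real (k n) / 2 ^ n)) \<longlonglongrightarrow> z s"
    by (rule filterlim_compose[rotated])
  then have "(\<lambda>n. norm (z (real (k n) / 2 ^ n))) \<longlonglongrightarrow> norm (z s)"
    by (rule tendsto_norm)
  then show ?thesis
    by (rule LIMSEQ_le_const2) (auto intro: le)
qed

text \<open>A real-valued \<open>SUP\<close> is meaningful only for bounded families. A finite
  right-hand side supplies that boundedness, and an infinite one makes the claim trivial.\<close>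

lemma cadlag_sup_powr_le:
  fixes z :: "real \<Rightarrow> 'b::real_normed_vector"
  assumes z: "cadlag z" and q: "0 < q"
  shows "ennreal ((SUP s\<in>{0..1}. norm (z s)) powr q) \<le> (SUP n. ennreal (dyadic_max n z powr q))"
proof (cases "SUP n. ennreal (dyadic_max n z powr q)")
  case (real r)
  have dyadic: "dyadic_max n z \<le> r powr (1 / q)" for n
  proof -
    have "ennreal (dyadic_max n z powr q) \<le> ennreal r"
      unfolding real(2)[symmetric] by (rule SUP_upper) simp
    then have "(dyadic_max n z powr q) powr (1 / q) \<le> r powr (1 / q)"
      using real q by (intro powr_mono2) auto
    then show ?thesis
      using q dyadic_max_nonneg[of n z] by (simp add: powr_powr)
  qed
  have le: "norm (z s) \<le> r powr (1 / q)" if "s \<in> {0..1}" for s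
  proof (rule cadlag_norm_le[OF z])
    fix k n :: nat assume "k \<le> 2 ^ n"
    then show "norm (z (real k / 2 ^ n)) \<le> r powr (1 / q)"
      by (rule order_trans[OF dyadic_max_ge dyadic])
  qed (use that in auto)
  then have "(SUP s\<in>{0..1}. norm (z s)) \<le> r powr (1 / q)"
    by (intro cSUP_least) auto
  moreover have "0 \<le> (SUP s\<in>{0..1}. norm (z s))"
  proof (rule cSUP_upper2[where x=0])
    show "bdd_above ((\<lambda>s. norm (z s)) ` {0..1})"
      using le by (rule bdd_aboveI2)
  qed auto
  ultimately have "(SUP s\<in>{0..1}. norm (z s)) powr q \<le> (r powr (1 / q)) powr q"
    using q by (intro powr_mono2) auto
  then show ?thesis
    using real q by (simp add: powr_powr ennreal_leI)
qed (simp only: top_greatest)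

lemma dyadic_max_mono: "dyadic_max n z \<le> dyadic_max (Suc n) z"
  unfolding dyadic_max_def[of n]
proof (rule Max.boundedI)
  fix a assume "a \<in> (\<lambda>k. norm (z (real k / 2 ^ n))) ` {..2 ^ n}"
  then obtain k where k: "k \<le> 2 ^ n" "a = norm (z (real k / 2 ^ n))" by auto
  then show "a \<le> dyadic_max (Suc n) z"
    using dyadic_max_ge[of "2 * k" "Suc n" z] by simp
qed auto

lemma ennreal_powr_mono: "x \<le> y \<Longrightarrow> 0 \<le> p \<Longrightarrow> ennreal_powr x p \<le> ennreal_powr y p"
  by (auto simp: ennreal_powr_def top_unique intro!: ennreal_leI powr_mono2 enn2real_mono simp: top.not_eq_extremum)

lemma measurable_cadlag_space_component:
  assumes "0 \<le> s" "s \<le> 1"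
  shows "(\<lambda>x. x s) \<in> borel_measurable cadlag_space"
  unfolding cadlag_space_def path_space_def
  using assms by (intro measurable_restrict_space1 measurable_component_singleton) auto

text \<open>The supremum in the cost need not be shown measurable: it is dominated by the supremum over
  dyadic times.\<close>

lemma (in prob_space) wasserstein_proc_le:
  fixes X Y Y' :: "real \<Rightarrow> 'a \<Rightarrow> real ^ 'd"
  assumes X: "\<And>t. 0 \<le> t \<Longrightarrow> t \<le> 1 \<Longrightarrow> random_variable borel (X t)" "AE \<omega> in M. cadlag (\<lambda>t. X t \<omega>)"
    and Y: "\<And>t. 0 \<le> t \<Longrightarrow> t \<le> 1 \<Longrightarrow> random_variable borel (Y t)" "AE \<omega> in M. cadlag (\<lambda>t. Y t \<omega>)"
    and law: "distr M path_space (path Y) = distr M path_space (path Y')"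
    and q: "0 < q"
    and moment: "\<And>n. (\<integral>\<^sup>+\<omega>. ennreal (dyadic_max n (\<lambda>s. X s \<omega> - Y s \<omega>) powr q) \<partial>M) \<le> c"
  shows "wasserstein_proc q M X Y' \<le> ennreal_powr c (1 / max q 1)"
proof -
  let ?D = "cadlag_space \<Otimes>\<^sub>M cadlag_space :: ((real \<Rightarrow> real ^ 'd) \<times> (real \<Rightarrow> real ^ 'd)) measure"
  let ?d = "\<lambda>n z. dyadic_max n (\<lambda>s. fst z s - snd z s :: real ^ 'd)"
  have "AE \<omega> in M. cadlag (\<lambda>t. X t \<omega>) \<and> cadlag (\<lambda>t. Y t \<omega>)"
    using X(2) Y(2) by eventually_elim simp
  then obtain N where N: "N \<in> null_sets M" "{\<omega>\<in>space M. \<not> (cadlag (\<lambda>t. X t \<omega>) \<and> cadlag (\<lambda>t. Y t \<omega>))} \<subseteq> N"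
    by (auto simp: eventually_ae_filter)
  \<comment> \<open>\<open>cadlag_space\<close> admits only cadlag paths, whereas \<open>X\<close>
    and \<open>Y\<close> have them almost surely. The zero path is used on the exceptional null set,
    which leaves the law on \<open>path_space\<close> unchanged.\<close>
  define cpath where "cpath Z \<omega> = (if \<omega> \<in> N then (\<lambda>t\<in>{0..1}. 0) else path Z \<omega>)" for Z :: "real \<Rightarrow> 'a \<Rightarrow> real ^ 'd" and \<omega>
  have AE_N: "AE \<omega> in M. \<omega> \<notin> N"
    using N(1) by (rule AE_not_in)
  have N_sets: "N \<in> events" using N(1) by auto
  have path_meas: "path Z \<in> measurable M path_space" if "\<And>t. 0 \<le> t \<Longrightarrow> t \<le> 1 \<Longrightarrow> random_variable borel (Z t)"
    for Z :: "real \<Rightarrow> 'a \<Rightarrow> real ^ 'd"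
    using that unfolding path_def[abs_def] path_space_def by (intro measurable_restrict) auto
  have cpath_meas: "cpath Z \<in> measurable M path_space" if "\<And>t. 0 \<le> t \<Longrightarrow> t \<le> 1 \<Longrightarrow> random_variable borel (Z t)" for Z
  proof -
    have "(\<lambda>\<omega>. \<lambda>t\<in>{0..1}. 0) \<in> measurable M (path_space :: (real \<Rightarrow> real ^ 'd) measure)"
      unfolding path_space_def by (intro measurable_restrict) auto
    then show ?thesis
      unfolding cpath_def[abs_def] using path_meas[OF that] N_sets by (intro measurable_If_set) auto
  qed
  have cpath_cadlag: "cadlag (cpath Z \<omega>)" if "\<omega> \<in> space M" "\<omega> \<notin> N \<Longrightarrow> cadlag (\<lambda>t. Z t \<omega>)" for Z \<omega>
  proof (cases "\<omega> \<in> N")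
    case True
    have "cadlag (\<lambda>_. 0 :: real ^ 'd)"
      by (rule continuous_on_imp_cadlag) simp
    then show ?thesis
      by (rule cadlag_cong[rotated]) (use True in \<open>simp add: cpath_def\<close>)
  next
    case False
    then have "cadlag (\<lambda>t. Z t \<omega>)"
      by (rule that(2))
    then show ?thesis
      by (rule cadlag_cong[rotated]) (use False in \<open>simp add: cpath_def path_def\<close>)
  qed
  have cpath_X: "cpath X \<in> measurable M cadlag_space"
    unfolding cadlag_space_def
  proof (rule measurable_restrict_space2)
    show "cpath X \<in> space M \<rightarrow> {f. cadlag f}"
      using N(2) cpath_cadlag[of _ X] by blast
  qed (rule cpath_meas[OF X(1)])
  have cpath_Y: "cpath Y \<in> measurable M cadlag_space"
    unfolding cadlag_space_def
  proof (rule measurable_restrict_space2)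
    show "cpath Y \<in> space M \<rightarrow> {f. cadlag f}"
      using N(2) cpath_cadlag[of _ Y] by blast
  qed (rule cpath_meas[OF Y(1)])
  define \<pi> where "\<pi> = distr M (?D) (\<lambda>\<omega>. (cpath X \<omega>, cpath Y \<omega>))"
  have pair: "(\<lambda>\<omega>. (cpath X \<omega>, cpath Y \<omega>)) \<in> measurable M (?D)"
    using cpath_X cpath_Y by measurable
  have incl: "(\<lambda>x. x) \<in> measurable cadlag_space path_space"
    unfolding cadlag_space_def by (intro measurable_restrict_space1) simp
  have cpath_law: "distr M path_space (cpath Z) = distr M path_space (path Z)"
    if "\<And>t. 0 \<le> t \<Longrightarrow> t \<le> 1 \<Longrightarrow> random_variable borel (Z t)" for Z
    using AE_N cpath_meas[OF that] path_meas[OF that] by (intro distr_cong_AE) (auto simp: cpath_def)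
  have "\<pi> \<in> couplings cadlag_space (distr M path_space (path X)) (distr M path_space (path Y'))"
    unfolding couplings_def
  proof (intro CollectI conjI)
    show "prob_space \<pi>"
      unfolding \<pi>_def by (rule prob_space_distr[OF pair])
    have "distr \<pi> path_space fst = distr M path_space (cpath X)"
      unfolding \<pi>_def using measurable_compose[OF measurable_fst incl]
      by (subst distr_distr[OF _ pair]) (auto simp: comp_def)
    \<comment> \<open>The marginal serves as its own target measure in \<open>couplings\<close>;
      only its sigma-algebra matters there, which is that of \<open>path_space\<close>.\<close>
    then show "distr \<pi> (distr M path_space (path X)) fst = distr M path_space (path X)"
      using cpath_law[OF X(1)] by (simp cong: distr_cong)
    have "distr \<pi> path_space snd = distr M path_space (cpath Y)"
      unfolding \<pi>_def using measurable_compose[OF measurable_snd incl]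
      by (subst distr_distr[OF _ pair]) (auto simp: comp_def)
    then show "distr \<pi> (distr M path_space (path Y')) snd = distr M path_space (path Y')"
      using cpath_law[OF Y(1)] law by (simp cong: distr_cong)
  qed (simp add: \<pi>_def)
  then have "wasserstein_proc q M X Y' \<le>
    ennreal_powr (\<integral>\<^sup>+(x, y). ennreal ((SUP t\<in>{0..1}. norm (x t - y t)) powr q) \<partial>\<pi>) (1 / max q 1)"
    unfolding wasserstein_proc_def by (rule INF_lower)
  also have "\<dots> \<le> ennreal_powr c (1 / max q 1)"
  proof (rule ennreal_powr_mono)
    have comp: "(\<lambda>z. fst z (real k / 2 ^ n) - snd z (real k / 2 ^ n) :: real ^ 'd) \<in> borel_measurable (?D)"
      if "k \<le> 2 ^ n" for k n :: nat
    proof -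
      have "0 \<le> real k / 2 ^ n" "real k / 2 ^ n \<le> 1"
        using that by (auto simp: divide_le_eq_1)
      then show ?thesis
        by (intro borel_measurable_diff measurable_compose[OF measurable_fst measurable_cadlag_space_component]
            measurable_compose[OF measurable_snd measurable_cadlag_space_component])
    qed
    have dyadic_meas [measurable]: "(\<lambda>z. ?d n z) \<in> borel_measurable (?D)" for n
      unfolding dyadic_max_def
    proof (rule borel_measurable_Max)
      fix k :: nat assume "k \<in> {..2 ^ n}"
      then show "(\<lambda>z. norm (fst z (real k / 2 ^ n) - snd z (real k / 2 ^ n) :: real ^ 'd)) \<in> borel_measurable (?D)"
        using measurable_compose[OF comp[of k n] borel_measurable_norm] by simp
    qed simp
    have space_pi: "cadlag x \<and> cadlag y" if "(x, y) \<in> space \<pi>" for x y :: "real \<Rightarrow> real ^ 'd"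
      using that by (auto simp: \<pi>_def space_pair_measure cadlag_space_def space_restrict_space)
    have "(\<integral>\<^sup>+(x, y). ennreal ((SUP t\<in>{0..1}. norm (x t - y t)) powr q) \<partial>\<pi>)
      \<le> (\<integral>\<^sup>+z. (SUP n. ennreal (?d n z powr q)) \<partial>\<pi>)"
    proof (intro nn_integral_mono)
      fix z assume "z \<in> space \<pi>"
      then have "cadlag (\<lambda>s. fst z s - snd z s)"
        using space_pi[of "fst z" "snd z"] cadlag_diff[of "fst z" "snd z"] by simp
      then show "(case z of (x, y) \<Rightarrow> ennreal ((SUP t\<in>{0..1}. norm (x t - y t)) powr q))
        \<le> (SUP n. ennreal (?d n z powr q))"
        using cadlag_sup_powr_le[OF _ q, of "\<lambda>s. fst z s - snd z s"] by (simp add: case_prod_beta')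
    qed
    also have "\<dots> = (SUP n. \<integral>\<^sup>+z. ennreal (?d n z powr q) \<partial>\<pi>)"
    proof (rule nn_integral_monotone_convergence_SUP)
      show "incseq (\<lambda>n z. ennreal (?d n z powr q))"
        using q by (intro incseq_SucI le_funI ennreal_leI powr_mono2 dyadic_max_mono dyadic_max_nonneg) auto
    qed (auto simp: \<pi>_def)
    also have "\<dots> \<le> c"
    proof (rule SUP_least)
      fix n
      have "(\<integral>\<^sup>+z. ennreal (?d n z powr q) \<partial>\<pi>)
        = (\<integral>\<^sup>+\<omega>. ennreal (dyadic_max n (\<lambda>s. cpath X \<omega> s - cpath Y \<omega> s) powr q) \<partial>M)"
        unfolding \<pi>_def by (subst nn_integral_distr[OF pair]) auto
      also have "\<dots> = (\<integral>\<^sup>+\<omega>. ennreal (dyadic_max n (\<lambda>s. X s \<omega> - Y s \<omega>) powr q) \<partial>M)"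
      proof (intro nn_integral_cong_AE)
        show "AE \<omega> in M. ennreal (dyadic_max n (\<lambda>s. cpath X \<omega> s - cpath Y \<omega> s) powr q) = ennreal (dyadic_max n (\<lambda>s. X s \<omega> - Y s \<omega>) powr q)"
          using AE_N
        proof eventually_elim
          case (elim \<omega>)
          have "dyadic_max n (\<lambda>s. cpath X \<omega> s - cpath Y \<omega> s) = dyadic_max n (\<lambda>s. X s \<omega> - Y s \<omega>)"
            unfolding dyadic_max_def using elim
            by (intro arg_cong[where f=Max] image_cong refl) (auto simp: cpath_def path_def divide_le_eq_1)
          then show ?case by simp
        qed
      qed
      also have "\<dots> \<le> c" by (rule moment)
      finally show "(\<integral>\<^sup>+z. ennreal (?d n z powr q) \<partial>\<pi>) \<le> c" .
    qed
    finally show "(\<integral>\<^sup>+(x, y). ennreal ((SUP t\<in>{0..1}. norm (x t - y t)) powr q) \<partial>\<pi>) \<le> c" .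
  qed simp
  finally show ?thesis .
qed

section \<open>Characteristic functions and lower bounds\<close>

text \<open>Lebesgue measure is the image of a product measure indexed by \<open>Basis\<close>, and
  in these coordinates the integrand factorises into one-dimensional Gaussian characteristic
  functions.\<close>

lemma char_std_gaussian:
  fixes v :: "real ^ 'd"
  shows "(CLINT x|density lborel (std_gaussian_density 1). iexp (v \<bullet> x)) = complex_of_real (exp (- (norm v)\<^sup>2 / 2))"
proof -
  interpret product_sigma_finite "\<lambda>_ :: real ^ 'd. lborel :: real measure" ..
  define F where "F b y = std_normal_density y *\<^sub>R iexp ((v \<bullet> b) * y)" for b y
  have F_int: "integrable lborel (F b)" for b
    unfolding F_def
    by (rule Bochner_Integration.integrable_bound[OF integrable_normal_density[of 1 0]]) auto
  have F_val: "(\<integral>y. F b y \<partial>lborel) = complex_of_real (exp (- (v \<bullet> b)\<^sup>2 / 2))" for b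
  proof -
    have "(\<integral>y. F b y \<partial>lborel) = char std_normal_distribution (v \<bullet> b)"
      unfolding char_def F_def by (subst integral_density) auto
    then show ?thesis
      by (simp add: char_std_normal_distribution)
  qed
  have Basis: "(Basis :: (real ^ 'd) set) = range (\<lambda>i. axis i 1)"
    by (auto simp: Basis_vec_def)
  have inj: "inj (\<lambda>i :: 'd. axis i (1 :: real))"
    by (auto intro!: injI simp: axis_eq_axis)
  have "(CLINT x|density lborel (std_gaussian_density 1). iexp (v \<bullet> x)) = (CLINT x|lborel. std_gaussian_density 1 x *\<^sub>R iexp (v \<bullet> x))"
    by (subst integral_density) (auto simp: std_gaussian_density_nonneg)
  also have "\<dots> = (CLINT f|(\<Pi>\<^sub>M b\<in>Basis. lborel). \<Prod>b\<in>Basis. F b (f b))"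
  proof (subst lborel_eq, subst integral_distr)
    have eq: "std_gaussian_density 1 (\<Sum>b\<in>Basis. f b *\<^sub>R b) *\<^sub>R iexp (v \<bullet> (\<Sum>b\<in>Basis. f b *\<^sub>R b)) = (\<Prod>b\<in>Basis. F b (f b))"
      for f :: "real ^ 'd \<Rightarrow> real"
    proof -
      have nth: "(\<Sum>b\<in>Basis. f b *\<^sub>R b) $ i = f (axis i 1)" for i :: 'd
      proof -
        have "axis i 1 \<in> (Basis :: (real ^ 'd) set)" by (simp add: Basis)
        from inner_sum_left_Basis[OF this, of f] show ?thesis
          by (simp only: inner_axis) simp
      qed
      have "iexp (v \<bullet> (\<Sum>b\<in>Basis. f b *\<^sub>R b)) = (\<Prod>b\<in>Basis. iexp ((v \<bullet> b) * f b))"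
        by (simp add: inner_sum_right exp_sum sum_distrib_left ac_simps)
      moreover have "std_gaussian_density 1 (\<Sum>b\<in>Basis. f b *\<^sub>R b) = (\<Prod>b\<in>Basis. std_normal_density (f b))"
      proof -
        have "(\<Prod>b\<in>Basis. std_normal_density (f b)) = (\<Prod>i\<in>(UNIV :: 'd set). std_normal_density (f (axis i 1)))"
          unfolding Basis by (subst prod.reindex[OF inj]) simp
        then show ?thesis
          unfolding std_gaussian_density_def nth by simp
      qed
      ultimately show ?thesis
        by (simp add: F_def scaleR_conv_of_real prod.distrib)
    qed
    show "(CLINT f|(\<Pi>\<^sub>M b\<in>Basis. lborel). std_gaussian_density 1 (\<Sum>b\<in>Basis. f b *\<^sub>R b) *\<^sub>R iexp (v \<bullet> (\<Sum>b\<in>Basis. f b *\<^sub>R b)))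
      = (CLINT f|(\<Pi>\<^sub>M b\<in>Basis. lborel). \<Prod>b\<in>Basis. F b (f b))"
      by (simp only: eq)
  qed measurable
  also have "\<dots> = (\<Prod>b\<in>Basis. \<integral>y. F b y \<partial>lborel)"
    using F_int by (intro product_integral_prod) auto
  also have "\<dots> = complex_of_real (exp (\<Sum>b\<in>Basis. - (v \<bullet> b)\<^sup>2 / 2))"
    by (simp add: F_val exp_sum)
  also have "(\<Sum>b\<in>Basis. - (v \<bullet> b)\<^sup>2 / 2) = - (norm v)\<^sup>2 / 2"
  proof -
    have "(norm v)\<^sup>2 = (\<Sum>b\<in>Basis. (v \<bullet> b)\<^sup>2)"
      unfolding power2_norm_eq_inner by (subst euclidean_inner) (simp add: power2_eq_square)
    then show ?thesis
      by (simp add: sum_negf sum_divide_distrib)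
  qed
  finally show ?thesis .
qed

lemma (in brownian) char_B:
  fixes v :: "real ^ 'd"
  shows "(CLINT \<omega>|M. iexp (v \<bullet> B 1 \<omega>)) = complex_of_real (exp (- (norm v)\<^sup>2 / 2))"
proof -
  have [measurable]: "random_variable borel (B 1)" "random_variable borel (B 0)"
    by (auto intro!: random_variable_B)
  have "(CLINT \<omega>|M. iexp (v \<bullet> B 1 \<omega>)) = (CLINT \<omega>|M. iexp (v \<bullet> (B 1 \<omega> - B 0 \<omega>)))"
    using B_0 by (intro integral_cong_AE) auto
  also have "\<dots> = (CLINT x|distr M borel (\<lambda>\<omega>. B 1 \<omega> - B 0 \<omega>). iexp (v \<bullet> x))"
    by (subst integral_distr) auto
  also have "\<dots> = complex_of_real (exp (- (norm v)\<^sup>2 / 2))"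
    by (subst distr_increment) (auto simp: char_std_gaussian)
  finally show ?thesis .
qed

text \<open>The largest eigenvalue is the maximum of the quadratic form on the unit sphere.\<close>

lemma quadratic_form_le_max_eigenvalue:
  fixes A :: "real ^ 'd ^ 'd"
  assumes sym: "transpose A = A" and max: "\<And>m. eigenvalue A m \<Longrightarrow> m \<le> l"
  shows "u \<bullet> (A *v u) \<le> l * (norm u)\<^sup>2"
proof -
  have inner_sym: "x \<bullet> (A *v y) = y \<bullet> (A *v x)" for x y
    using dot_lmul_matrix[of x A y] vector_transpose_matrix[of x A] by (simp add: sym inner_commute)
  have "compact (sphere 0 1 :: (real ^ 'd) set)" "sphere 0 1 \<noteq> ({} :: (real ^ 'd) set)"
    by auto
  moreover have "continuous_on (sphere 0 1) (\<lambda>x. x \<bullet> (A *v x))"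
    by (intro continuous_on_inner continuous_on_id linear_continuous_on matrix_vector_mul_bounded_linear)
  ultimately obtain v where v: "v \<in> sphere 0 1" "\<And>x. x \<in> sphere 0 1 \<Longrightarrow> x \<bullet> (A *v x) \<le> v \<bullet> (A *v v)"
    using continuous_attains_sup[of "sphere 0 1" "\<lambda>x. x \<bullet> (A *v x)"] by blast
  define m where "m = v \<bullet> (A *v v)"
  have vv: "v \<bullet> v = 1" using v(1) by (simp add: dot_square_norm)
  \<comment> \<open>\<open>Q\<close> is nonnegative and vanishes at the maximiser \<open>v\<close>,
    which therefore minimises it; first-order optimality forces the residual \<open>z\<close> to
    vanish.\<close>
  define Q where "Q w = m * (w \<bullet> w) - w \<bullet> (A *v w)" for w
  have Q: "0 \<le> Q w" for w
  proof (cases "w = 0")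
    case False
    then have "(w /\<^sub>R norm w) \<bullet> (A *v (w /\<^sub>R norm w)) \<le> m"
      unfolding m_def by (intro v(2)) simp
    then have "(w \<bullet> (A *v w)) / (norm w)\<^sup>2 \<le> m"
      by (simp add: matrix_vector_mult_scaleR power2_eq_square divide_inverse mult_ac)
    then show ?thesis
      using False by (simp add: Q_def pos_divide_le_eq dot_square_norm)
  qed (simp add: Q_def)
  define z where "z = m *\<^sub>R v - A *v v"
  have expand: "Q (v + s *\<^sub>R z) = 2 * s * (z \<bullet> z) + s\<^sup>2 * Q z" for s
    using vv inner_sym[of z v]
    by (simp add: Q_def z_def[symmetric] m_def[symmetric] inner_add_left inner_add_right matrix_vector_right_distrib
        matrix_vector_mult_scaleR algebra_simps power2_eq_square)
       (simp add: z_def inner_diff_left inner_diff_right inner_commute[of "A *v v" v] algebra_simps)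
  have "z \<bullet> z = 0"
  proof (rule ccontr)
    assume "z \<bullet> z \<noteq> 0"
    then have zz: "0 < z \<bullet> z" by simp
    \<comment> \<open>Small enough that the quadratic term in the expansion of \<open>Q\<close> at v
      - s z is dominated by the negative linear one.\<close>
    define s where "s = (z \<bullet> z) / (1 + Q z)"
    have s: "0 < s" using zz Q[of z] by (simp add: s_def add_pos_nonneg)
    have "s * Q z \<le> z \<bullet> z"
      using zz Q[of z] by (simp add: s_def field_simps)
    then have "s * (s * Q z) \<le> s * (z \<bullet> z)"
      using s by (intro mult_left_mono) auto
    moreover have "0 \<le> - 2 * s * (z \<bullet> z) + s * (s * Q z)"
      using Q[of "v + (- s) *\<^sub>R z"] unfolding expand by (simp add: power2_eq_square)
    ultimately have "s * (z \<bullet> z) \<le> 0" by simp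
    then show False using s zz by (simp add: mult_le_0_iff)
  qed
  then have "A *v v = m *\<^sub>R v" by (simp add: z_def)
  then have "eigenvalue A m"
    unfolding eigenvalue_def using vv by (intro exI[of _ v]) auto
  then have "m * (u \<bullet> u) \<le> l * (u \<bullet> u)"
    by (intro mult_right_mono max) auto
  then show ?thesis
    using Q[of u] by (simp add: Q_def dot_square_norm)
qed

text \<open>Monotonicity of the L^q norms. The tangent line to y^q at the mean, obtained from
  Young's inequality, is integrated; an infinite q-th moment leaves nothing to prove.\<close>

lemma (in prob_space) nn_integral_le_ennreal_powr:
  fixes f :: "'a \<Rightarrow> real"
  assumes [measurable]: "f \<in> borel_measurable M" and nn: "\<And>x. 0 \<le> f x" and q: "1 \<le> q"
  shows "(\<integral>\<^sup>+x. ennreal (f x) \<partial>M) \<le> ennreal_powr (\<integral>\<^sup>+x. ennreal (f x powr q) \<partial>M) (1 / q)"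
proof (cases "\<integral>\<^sup>+x. ennreal (f x powr q) \<partial>M")
  case (real r)
  have int_q: "integrable M (\<lambda>x. f x powr q)"
    using real by (intro integrableI_nonneg) auto
  then have r: "r = (\<integral>x. f x powr q \<partial>M)"
    using real by (subst (asm) nn_integral_eq_integral) auto
  have int: "integrable M f"
  proof (rule Bochner_Integration.integrable_bound)
    show "integrable M (\<lambda>x. 1 + f x powr q)" using int_q by simp
    have "f x \<le> 1 + f x powr q" for x
      using nn[of x] powr_mono[of 1 q "f x"] q by (cases "f x \<le> 1") (auto simp: add_increasing2)
    then show "AE x in M. norm (f x) \<le> norm (1 + f x powr q)"
      using nn by (intro AE_I2) simp
  qed measurable
  define m where "m = (\<integral>x. f x \<partial>M)"
  have m: "0 \<le> m" using nn by (simp add: m_def)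
  have "m powr q \<le> r"
  proof (cases "m = 0")
    case False
    then have m: "0 < m" using m by simp
    have young: "m powr q + q * m powr (q - 1) * (y - m) \<le> y powr q" if "0 \<le> y" for y
    proof (cases "y = 0")
      case False
      then have y: "0 < y" using that by simp
      have "((y / m) powr q) powr (1 / q) * 1 powr (1 - 1 / q) \<le> 1 / q * (y / m) powr q + (1 - 1 / q) * 1"
        using q y m by (intro Youngs_inequality_0) auto
      then have "y / m \<le> 1 / q * (y powr q / m powr q) + (1 - 1 / q)"
        using q y m by (simp add: powr_powr powr_divide)
      then have "q * m powr q * (y / m) \<le> q * m powr q * (1 / q * (y powr q / m powr q) + (1 - 1 / q))"
        using q m by (intro mult_left_mono) auto
      moreover have "q * m powr q * (1 / q * (y powr q / m powr q) + (1 - 1 / q)) = y powr q + (q - 1) * m powr q"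
        using q m by (simp add: field_simps)
      moreover have "m powr q = m powr (q - 1) * m"
        using m by (simp add: powr_diff)
      ultimately show ?thesis
        using m by (simp add: algebra_simps)
    next
      case True
      have "m powr q = m powr (q - 1) * m"
        using m by (simp add: powr_diff)
      moreover have "1 * (m powr (q - 1) * m) \<le> q * (m powr (q - 1) * m)"
        using q m by (intro mult_right_mono) auto
      ultimately show ?thesis
        using True by (simp add: algebra_simps)
    qed
    have "(\<integral>x. m powr q + q * m powr (q - 1) * (f x - m) \<partial>M) \<le> (\<integral>x. f x powr q \<partial>M)"
      using int int_q young nn by (intro integral_mono) auto
    moreover have "(\<integral>x. m powr q + q * m powr (q - 1) * (f x - m) \<partial>M) = m powr q"
      using int by (simp add: m_def[symmetric] prob_space)
    ultimately show ?thesis by (simp add: r)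
  qed (use real in simp)
  then have "(m powr q) powr (1 / q) \<le> r powr (1 / q)"
    using q by (intro powr_mono2) auto
  then have "m \<le> r powr (1 / q)"
    using m q by (simp add: powr_powr)
  then have "ennreal m \<le> ennreal (r powr (1 / q))"
    by (rule ennreal_leI)
  then show ?thesis
    using int nn real by (simp add: ennreal_powr_def m_def nn_integral_eq_integral)
qed (simp add: ennreal_powr_def)

lemma (in prob_space) wasserstein_vec_ge_char:
  fixes \<xi> \<zeta> :: "'a \<Rightarrow> real ^ 'd"
  assumes [measurable]: "random_variable borel \<xi>" "random_variable borel \<zeta>" and q: "1 \<le> q" and u: "u \<noteq> 0"
  shows "ennreal (cmod ((CLINT \<omega>|M. iexp (u \<bullet> \<xi> \<omega>)) - (CLINT \<omega>|M. iexp (u \<bullet> \<zeta> \<omega>))) / norm u)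
    \<le> wasserstein_vec q M \<xi> \<zeta>"
  unfolding wasserstein_vec_def
proof (rule INF_greatest)
  fix \<pi> assume "\<pi> \<in> couplings borel (distr M borel \<xi>) (distr M borel \<zeta>)"
  then have \<pi>: "prob_space \<pi>" "sets \<pi> = sets (borel \<Otimes>\<^sub>M borel)"
    "distr \<pi> (distr M borel \<xi>) fst = distr M borel \<xi>" "distr \<pi> (distr M borel \<zeta>) snd = distr M borel \<zeta>"
    by (auto simp: couplings_def)
  interpret \<pi>: prob_space \<pi> by (rule \<pi>)
  note [measurable_cong] = \<pi>(2)
  have fst_eq: "distr \<pi> borel fst = distr M borel \<xi>" and snd_eq: "distr \<pi> borel snd = distr M borel \<zeta>"
    using \<pi>(3,4) by (simp_all cong: distr_cong)
  have [measurable]: "fst \<in> borel_measurable \<pi>" "snd \<in> borel_measurable \<pi>"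
    by measurable
  have xi: "(CLINT \<omega>|M. iexp (u \<bullet> \<xi> \<omega>)) = (CLINT z|\<pi>. iexp (u \<bullet> fst z))"
    using integral_distr[of \<xi> M borel "\<lambda>x. iexp (u \<bullet> x)"] integral_distr[of fst \<pi> borel "\<lambda>x. iexp (u \<bullet> x)"]
    by (simp add: fst_eq)
  have zeta: "(CLINT \<omega>|M. iexp (u \<bullet> \<zeta> \<omega>)) = (CLINT z|\<pi>. iexp (u \<bullet> snd z))"
    using integral_distr[of \<zeta> M borel "\<lambda>x. iexp (u \<bullet> x)"] integral_distr[of snd \<pi> borel "\<lambda>x. iexp (u \<bullet> x)"]
    by (simp add: snd_eq)
  have int: "integrable \<pi> (\<lambda>z. iexp (u \<bullet> fst z))" "integrable \<pi> (\<lambda>z. iexp (u \<bullet> snd z))"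
    by (auto intro!: \<pi>.integrable_const_bound[where B=1])
  have "ennreal (cmod ((CLINT \<omega>|M. iexp (u \<bullet> \<xi> \<omega>)) - (CLINT \<omega>|M. iexp (u \<bullet> \<zeta> \<omega>))))
    = ennreal (cmod (CLINT z|\<pi>. iexp (u \<bullet> fst z) - iexp (u \<bullet> snd z)))"
    using int by (simp add: xi zeta)
  also have "\<dots> \<le> (\<integral>\<^sup>+z. ennreal (cmod (iexp (u \<bullet> fst z) - iexp (u \<bullet> snd z))) \<partial>\<pi>)"
    using int by (intro integral_norm_bound_ennreal) auto
  also have "\<dots> \<le> (\<integral>\<^sup>+z. ennreal (norm u) * ennreal (norm (fst z - snd z)) \<partial>\<pi>)"
  proof (intro nn_integral_mono)
    fix z :: "(real ^ 'd) \<times> (real ^ 'd)"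
    have "iexp (u \<bullet> fst z) - iexp (u \<bullet> snd z) = iexp (u \<bullet> snd z) * (iexp (u \<bullet> (fst z - snd z)) - 1)"
      by (simp add: inner_diff_right algebra_simps flip: exp_add)
    then have "cmod (iexp (u \<bullet> fst z) - iexp (u \<bullet> snd z)) = cmod (iexp (u \<bullet> (fst z - snd z)) - 1)"
      by (simp add: norm_mult)
    also have "\<dots> \<le> norm u * norm (fst z - snd z)"
      using cmod_iexp_minus_one_le[of "u \<bullet> (fst z - snd z)"] Cauchy_Schwarz_ineq2[of u "fst z - snd z"] by simp
    finally show "ennreal (cmod (iexp (u \<bullet> fst z) - iexp (u \<bullet> snd z))) \<le> ennreal (norm u) * ennreal (norm (fst z - snd z))"
      by (simp add: ennreal_leI flip: ennreal_mult)
  qed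
  also have "\<dots> = ennreal (norm u) * (\<integral>\<^sup>+z. ennreal (norm (fst z - snd z)) \<partial>\<pi>)"
    by (rule nn_integral_cmult) measurable
  also have "\<dots> \<le> ennreal (norm u) * ennreal_powr (\<integral>\<^sup>+z. ennreal (norm (fst z - snd z) powr q) \<partial>\<pi>) (1 / q)"
    using q by (intro mult_left_mono \<pi>.nn_integral_le_ennreal_powr) auto
  finally have "ennreal (cmod ((CLINT \<omega>|M. iexp (u \<bullet> \<xi> \<omega>)) - (CLINT \<omega>|M. iexp (u \<bullet> \<zeta> \<omega>))))
    \<le> ennreal (norm u) * ennreal_powr (\<integral>\<^sup>+z. ennreal (norm (fst z - snd z) powr q) \<partial>\<pi>) (1 / q)" .
  then have "ennreal (1 / norm u) * ennreal (cmod ((CLINT \<omega>|M. iexp (u \<bullet> \<xi> \<omega>)) - (CLINT \<omega>|M. iexp (u \<bullet> \<zeta> \<omega>))))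
    \<le> ennreal (1 / norm u) * (ennreal (norm u) * ennreal_powr (\<integral>\<^sup>+z. ennreal (norm (fst z - snd z) powr q) \<partial>\<pi>) (1 / q))"
    by (rule mult_left_mono) simp
  then show "ennreal (cmod ((CLINT \<omega>|M. iexp (u \<bullet> \<xi> \<omega>)) - (CLINT \<omega>|M. iexp (u \<bullet> \<zeta> \<omega>))) / norm u)
    \<le> ennreal_powr (\<integral>\<^sup>+(x, y). ennreal (norm (x - y) powr q) \<partial>\<pi>) (1 / max q 1)"
    using q u by (simp add: case_prod_beta' max_absorb1 flip: ennreal_mult mult.assoc)
qed

section \<open>Small-time Gaussian approximation\<close>

text \<open>The exponent is the right derivative at t = 0 of the characteristic function in time, so
  no branch of the logarithm is involved. This identifies a given \<psi> with the expression
  obtained from the triplet.\<close>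

lemma levy_khintchine_exponent_unique:
  assumes "levy_khintchine_exponent M S \<psi>" "levy_khintchine_exponent M S \<psi>'"
  shows "\<psi> u = \<psi>' u"
proof -
  have D: "((\<lambda>t. exp (complex_of_real t * z)) has_vector_derivative z) (at 0 within {0..1})" for z
  proof -
    have "((\<lambda>w. exp (w * z)) has_field_derivative z) (at (complex_of_real 0))"
      by (auto intro!: derivative_eq_intros)
    then show ?thesis
      by (rule has_vector_derivative_real_field)
  qed
  have eq: "exp (complex_of_real t * \<psi> u) = exp (complex_of_real t * \<psi>' u)" if "t \<in> {0..1}" for t
    using assms that unfolding levy_khintchine_exponent_def by metis
  have D': "((\<lambda>t. exp (complex_of_real t * \<psi> u)) has_vector_derivative \<psi>' u) (at 0 within {0..1})"
    by (rule has_vector_derivative_transform[OF _ eq D]) auto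
  show ?thesis
    using D[of "\<psi> u"] D' vector_derivative_unique_within_closed_interval[of 0 1 0 "\<lambda>t. exp (complex_of_real t * \<psi> u)"]
    by simp
qed

locale levy_diffusion = pure_jump_levy_process M \<nu> S \<gamma> + brownian M B
  for M :: "'a measure" and \<nu> :: "(real ^ 'd) measure" and S B :: "real \<Rightarrow> 'a \<Rightarrow> real ^ 'd" and \<gamma> +
  fixes A :: "real ^ 'd ^ 'd"
begin

text \<open>The rescaled process: the first argument is the scale t, the second the time in
  [0,1].\<close>

definition X :: "real \<Rightarrow> real \<Rightarrow> 'a \<Rightarrow> real ^ 'd" where
  "X t s \<omega> = (A *v B (s * t) \<omega> + S (s * t) \<omega>) /\<^sub>R sqrt t"

abbreviation scaled_B :: "real \<Rightarrow> real \<Rightarrow> 'a \<Rightarrow> real ^ 'd" where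
  "scaled_B t s \<omega> \<equiv> A *v ((1 / sqrt t) *\<^sub>R B (s * t) \<omega>)"

abbreviation proc_distance :: "real \<Rightarrow> real \<Rightarrow> ennreal" where
  "proc_distance q t \<equiv> wasserstein_proc q M (X t) (\<lambda>s \<omega>. A *v B s \<omega>)"

abbreviation vec_distance :: "real \<Rightarrow> real \<Rightarrow> ennreal" where
  "vec_distance q t \<equiv> wasserstein_vec q M (X t 1) (\<lambda>\<omega>. A *v B 1 \<omega>)"

lemma random_variable_X:
  assumes "0 \<le> t" "t \<le> 1" "0 \<le> s" "s \<le> 1"
  shows "random_variable borel (X t s)"
proof -
  have "0 \<le> s * t" "s * t \<le> 1"
    using assms by (auto intro: mult_le_one)
  then have [measurable]: "random_variable borel (B (s * t))" "random_variable borel (S (s * t))"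
    by (auto intro: random_variable_B random_variable_S)
  show ?thesis
    unfolding X_def[abs_def] by measurable
qed

text \<open>S_1 is the difference of A B_1 + S_1 and A B_1, and the latter has moments of all
  orders; the quasi-triangle inequality for powers covers q < 1 as well.\<close>

lemma nn_integral_S_powr_finite:
  assumes q: "0 < q" and int: "integrable M (\<lambda>\<omega>. norm (A *v B 1 \<omega> + S 1 \<omega>) powr q)"
  shows "(\<integral>\<^sup>+\<omega>. ennreal (norm (S 1 \<omega>) powr q) \<partial>M) < \<infinity>"
proof -
  have [measurable]: "random_variable borel (B 1)" "random_variable borel (S 1)"
    by (auto intro!: random_variable_B random_variable_S)
  obtain K where K: "0 < K" "\<And>x. norm (A *v x) \<le> norm x * K"
    using bounded_linear.pos_bounded[OF matrix_vector_mul_bounded_linear[of A]] by blast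
  have "(\<integral>\<^sup>+\<omega>. ennreal ((norm (B 1 \<omega>) * K) powr q) \<partial>M) = (\<integral>\<^sup>+\<omega>. ennreal (K powr q) * ennreal (norm (B 1 \<omega>) powr q) \<partial>M)"
    using K by (intro nn_integral_cong) (simp add: powr_mult mult.commute flip: ennreal_mult)
  also have "\<dots> < \<infinity>"
    using nn_integral_B_powr_finite[OF q] by (simp add: nn_integral_cmult ennreal_mult_less_top)
  finally have B: "(\<integral>\<^sup>+\<omega>. ennreal ((norm (B 1 \<omega>) * K) powr q) \<partial>M) < \<infinity>" .
  have X: "(\<integral>\<^sup>+\<omega>. ennreal (norm (A *v B 1 \<omega> + S 1 \<omega>) powr q) \<partial>M) < \<infinity>"
    using int by (subst nn_integral_eq_integral) auto
  have "(\<integral>\<^sup>+\<omega>. ennreal (norm (S 1 \<omega>) powr q) \<partial>M)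
    \<le> (\<integral>\<^sup>+\<omega>. ennreal ((norm (A *v B 1 \<omega> + S 1 \<omega>) + norm (B 1 \<omega>) * K) powr q) \<partial>M)"
  proof (intro nn_integral_mono ennreal_leI powr_mono2)
    fix \<omega>
    show "norm (S 1 \<omega>) \<le> norm (A *v B 1 \<omega> + S 1 \<omega>) + norm (B 1 \<omega>) * K"
      using norm_triangle_ineq4[of "A *v B 1 \<omega> + S 1 \<omega>" "A *v B 1 \<omega>"] K(2)[of "B 1 \<omega>"] by simp
  qed (use q in auto)
  also have "\<dots> < \<infinity>"
    using X B q K by (intro nn_integral_powr_add_finite) auto
  finally show ?thesis .
qed

text \<open>With the same \<omega> in both components the Brownian parts cancel exactly, leaving S(t
  s)/sqrt t; the q-th moment of its grid maximum is t^(-q/2) times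
  \<open>grid_moment\<close>.\<close>

lemma wasserstein_proc_X_le:
  assumes t: "0 < t" "t \<le> 1 / 2" and q: "0 < q"
    and moment: "\<And>n. grid_moment q t n \<le> ennreal (C * t powr \<kappa>)"
  shows "proc_distance q t \<le> ennreal_powr (ennreal (C * t powr (\<kappa> - q / 2))) (1 / max q 1)"
proof (rule wasserstein_proc_le[where Y="\<lambda>s \<omega>. scaled_B t s \<omega>"])
  have st: "0 \<le> s * t" "s * t \<le> 1" if "0 \<le> s" "s \<le> 1" for s
    using that t by (auto intro: mult_le_one)
  show "random_variable borel (X t s)" if "0 \<le> s" "s \<le> 1" for s
    using that t by (intro random_variable_X) auto
  show "random_variable borel (\<lambda>\<omega>. scaled_B t s \<omega>)" if "0 \<le> s" "s \<le> 1" for s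
    using random_variable_B[OF st[OF that]] by measurable
  have cadlag_B: "AE \<omega> in M. cadlag (\<lambda>s. B (s * t) \<omega>)"
  proof -
    have "AE \<omega> in M. continuous_on {0..1} (\<lambda>t. B t \<omega>)"
      using brownian_motion by (simp add: brownian_motion_def)
    then show ?thesis
    proof eventually_elim
      case (elim \<omega>)
      from cadlag_time_scale[OF continuous_on_imp_cadlag[OF elim], of t] show ?case
        using t by simp
    qed
  qed
  have cadlag_S: "AE \<omega> in M. cadlag (\<lambda>s. S (s * t) \<omega>)"
  proof -
    have "AE \<omega> in M. cadlag (\<lambda>t. S t \<omega>)"
      using levy_process by (simp add: levy_process_def)
    then show ?thesis
    proof eventually_elim
      case (elim \<omega>)
      from cadlag_time_scale[OF elim, of t] show ?case
        using t by simp
    qed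
  qed
  have isCont_A: "isCont (\<lambda>z. A *v f z) z" if "isCont f z" for f :: "(real ^ 'd) \<times> (real ^ 'd) \<Rightarrow> real ^ 'd" and z
    using that by (rule bounded_linear.isCont[OF matrix_vector_mul_bounded_linear])
  show "AE \<omega> in M. cadlag (\<lambda>s. X t s \<omega>)"
    using cadlag_B cadlag_S
  proof eventually_elim
    case (elim \<omega>)
    then show ?case
      unfolding X_def
      by (rule cadlag_continuous_image2[where h="\<lambda>x y. (A *v x + y) /\<^sub>R sqrt t"])
         (auto simp: case_prod_beta' intro!: isCont_A continuous_intros)
  qed
  show "AE \<omega> in M. cadlag (\<lambda>s. scaled_B t s \<omega>)"
    using cadlag_B
  proof eventually_elim
    case (elim \<omega>)
    from elim elim show ?case
      by (rule cadlag_continuous_image2[where h="\<lambda>x y. A *v ((1 / sqrt t) *\<^sub>R x)"])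
         (auto simp: case_prod_beta' intro!: isCont_A continuous_intros)
  qed
  show "distr M path_space (path (\<lambda>s \<omega>. scaled_B t s \<omega>)) = distr M path_space (path (\<lambda>s \<omega>. A *v B s \<omega>))"
    using t by (intro distr_scaled_path) auto
  fix n
  have dyadic: "dyadic_max n (\<lambda>s. X t s \<omega> - scaled_B t s \<omega>) = grid_max t n \<omega> / sqrt t" for \<omega>
  proof -
    have diff: "X t s \<omega> - scaled_B t s \<omega> = S (t * s) \<omega> /\<^sub>R sqrt t" for s
      unfolding X_def mult.commute[of s t] matrix_vector_mult_scaleR scaleR_add_right divide_inverse mult_1_left
      by (rule add_diff_cancel_left')
    have norm_div: "norm (y /\<^sub>R sqrt t) = norm y / sqrt t" for y :: "real ^ 'd"
      using t(1) by (simp add: divide_inverse mult.commute)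
    have "dyadic_max n (\<lambda>s. X t s \<omega> - scaled_B t s \<omega>)
      = (MAX k\<in>{..2 ^ n}. norm (S (t * (real k / 2 ^ n)) \<omega>) / sqrt t)"
      unfolding diff dyadic_max_def norm_div by (rule refl)
    also have "\<dots> = grid_max t n \<omega> / sqrt t"
      unfolding grid_max_def using t(1)
      by (subst mono_Max_commute[where f="\<lambda>x. x / sqrt t"]) (auto intro!: monoI divide_right_mono simp: image_image)
    finally show ?thesis .
  qed
  have [measurable]: "random_variable borel (grid_max t n)" using t by simp
  have "(\<integral>\<^sup>+\<omega>. ennreal (dyadic_max n (\<lambda>s. X t s \<omega> - scaled_B t s \<omega>) powr q) \<partial>M)
    = (\<integral>\<^sup>+\<omega>. ennreal (t powr - (q / 2)) * ennreal (grid_max t n \<omega> powr q) \<partial>M)"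
  proof (intro nn_integral_cong)
    fix \<omega>
    have "(sqrt t) powr q = t powr (q / 2)"
      using t(1) powr_powr[of t "1 / 2" q] by (simp add: powr_half_sqrt)
    then have "(grid_max t n \<omega> / sqrt t) powr q = t powr - (q / 2) * grid_max t n \<omega> powr q"
      using t(1) grid_max_nonneg by (simp add: powr_divide powr_minus_divide)
    then show "ennreal (dyadic_max n (\<lambda>s. X t s \<omega> - scaled_B t s \<omega>) powr q)
      = ennreal (t powr - (q / 2)) * ennreal (grid_max t n \<omega> powr q)"
      by (simp add: dyadic ennreal_mult)
  qed
  also have "\<dots> = ennreal (t powr - (q / 2)) * grid_moment q t n"
    by (rule nn_integral_cmult) measurable
  also have "\<dots> \<le> ennreal (t powr - (q / 2)) * ennreal (C * t powr \<kappa>)"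
    by (intro mult_left_mono moment) simp
  also have "\<dots> = ennreal (C * t powr (\<kappa> - q / 2))"
    using t(1) powr_add[of t "- (q / 2)" \<kappa>] by (subst ennreal_mult'[symmetric]) (simp_all add: mult_ac)
  finally show "(\<integral>\<^sup>+\<omega>. ennreal (dyadic_max n (\<lambda>s. X t s \<omega> - scaled_B t s \<omega>) powr q) \<partial>M)
    \<le> ennreal (C * t powr (\<kappa> - q / 2))" .
qed (use q in auto)

text \<open>\<open>enn2real\<close> sends infinity to 0, so the order bound alone would say nothing
  about infinite distances; the first claim rules these out.\<close>

lemma wasserstein_proc_upper:
  assumes index: "blumenthal_getoor_index \<nu> < 2"
    and bs: "if finite_variation \<nu> then bs = 1 else blumenthal_getoor_index \<nu> < bs \<and> bs \<le> 2"
    and q: "0 < q" and int: "integrable M (\<lambda>\<omega>. norm (A *v B 1 \<omega> + S 1 \<omega>) powr q)"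
  shows "\<forall>\<^sub>F t in at_right 0. proc_distance q t < \<infinity>"
    and "(\<lambda>t. enn2real (proc_distance q t))
      \<in> O[at_right 0](\<lambda>t. t powr (min q 1 * (min (1 / q) (1 / bs) - 1 / 2)))"
proof -
  define e where "e = min q 1 * (min (1 / q) (1 / bs) - 1 / 2)"
  have "0 < bs"
    using bs one_le_blumenthal_getoor_index by (cases "finite_variation \<nu>") auto
  \<comment> \<open>Factoring q out of the bracket and using q/max(q, 1) = min(q, 1) gives the
    exponent of the statement.\<close>
  then have e: "(min 1 (q / bs) - q / 2) * (1 / max q 1) = e"
  proof -
    have "min 1 (q / bs) = q * min (1 / q) (1 / bs)"
      using q \<open>0 < bs\<close> by (auto simp: min_def field_simps)
    then have "(min 1 (q / bs) - q / 2) * (1 / max q 1) = q / max q 1 * (min (1 / q) (1 / bs) - 1 / 2)"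
      by (simp add: algebra_simps)
    moreover have "q / max q 1 = min q 1"
      using q by (auto simp: max_def min_def)
    ultimately show ?thesis by (simp add: e_def)
  qed
  obtain C where C: "0 \<le> C" "\<And>t n. 0 < t \<Longrightarrow> t \<le> 1 / 2 \<Longrightarrow>
    grid_moment q t n \<le> ennreal (C * t powr (min 1 (q / bs)))"
    using grid_max_moment[OF index bs q nn_integral_S_powr_finite[OF q int]] by blast
  have bound: "proc_distance q t \<le> ennreal (C powr (1 / max q 1) * t powr e)"
    if t: "0 < t" "t \<le> 1 / 2" for t
  proof -
    have "proc_distance q t
      \<le> ennreal_powr (ennreal (C * t powr (min 1 (q / bs) - q / 2))) (1 / max q 1)"
      using t q C(2)[OF t] by (rule wasserstein_proc_X_le)
    also have "\<dots> = ennreal ((C * t powr (min 1 (q / bs) - q / 2)) powr (1 / max q 1))"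
      using C by (simp add: ennreal_powr_def)
    also have "(C * t powr (min 1 (q / bs) - q / 2)) powr (1 / max q 1) = C powr (1 / max q 1) * t powr e"
      using C t by (simp only: powr_mult powr_powr e)
    finally show ?thesis .
  qed
  have small: "\<forall>\<^sub>F t :: real in at_right 0. 0 < t \<and> t \<le> 1 / 2"
    by (rule eventually_at_rightI[of 0 "1 / 2"]) auto
  from small show "\<forall>\<^sub>F t in at_right 0. proc_distance q t < \<infinity>"
  proof eventually_elim
    case (elim t)
    then show ?case
      using bound[of t] by (auto intro: le_less_trans)
  qed
  show "(\<lambda>t. enn2real (proc_distance q t)) \<in> O[at_right 0](\<lambda>t. t powr (min q 1 * (min (1 / q) (1 / bs) - 1 / 2)))"
    unfolding e_def[symmetric]
  proof (rule bigoI)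
    from small show "\<forall>\<^sub>F t in at_right 0. norm (enn2real (proc_distance q t))
      \<le> C powr (1 / max q 1) * norm (t powr e)"
    proof eventually_elim
      case (elim t)
      then have "enn2real (proc_distance q t) \<le> C powr (1 / max q 1) * t powr e"
        using bound[of t] by (intro enn2real_leI) auto
      then show ?case by simp
    qed
  qed
qed

text \<open>By Brownian scaling the Gaussian factor of X^t_1 equals the characteristic function of A
  B_1, so in the difference of the two functions it factors out and only exp(t \<psi>) - 1
  remains.\<close>

lemma char_X_1:
  assumes ind: "independent_processes M B S" and sym: "transpose A = A" and t: "0 < t" "t \<le> 1"
  shows "(CLINT \<omega>|M. iexp (u \<bullet> X t 1 \<omega>)) = complex_of_real (exp (- (norm (A *v u))\<^sup>2 / 2)) * exp (complex_of_real t * \<psi> (u /\<^sub>R sqrt t))"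
    and "(CLINT \<omega>|M. iexp (u \<bullet> (A *v B 1 \<omega>))) = complex_of_real (exp (- (norm (A *v u))\<^sup>2 / 2))"
proof -
  have [measurable]: "random_variable borel (B 1)" "random_variable borel (B t)" "random_variable borel (S t)"
    using t by (auto intro!: random_variable_B random_variable_S)
  have A_inner: "u \<bullet> (A *v x) = (A *v u) \<bullet> x" for x
    using dot_lmul_matrix[of u A x] vector_transpose_matrix[of u A] by (simp add: sym)
  show B1: "(CLINT \<omega>|M. iexp (u \<bullet> (A *v B 1 \<omega>))) = complex_of_real (exp (- (norm (A *v u))\<^sup>2 / 2))"
    by (simp only: A_inner char_B)
  define Y where "Y \<omega> = u \<bullet> ((A *v B t \<omega>) /\<^sub>R sqrt t)" for \<omega>
  define Z where "Z \<omega> = u \<bullet> (S t \<omega> /\<^sub>R sqrt t)" for \<omega>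
  have [measurable]: "random_variable borel Y" "random_variable borel Z"
    unfolding Y_def[abs_def] Z_def[abs_def] by measurable
  have eval [measurable]: "(\<lambda>p. p t) \<in> borel_measurable (path_space :: (real \<Rightarrow> real ^ 'd) measure)"
    unfolding path_space_def using t by (intro measurable_component_singleton) auto
  have "indep_var borel ((\<lambda>p. u \<bullet> ((A *v p t) /\<^sub>R sqrt t)) \<circ> path B) borel ((\<lambda>p. u \<bullet> (p t /\<^sub>R sqrt t)) \<circ> path S)"
    using ind unfolding independent_processes_def
  proof (rule indep_var_compose)
    show "(\<lambda>p :: real \<Rightarrow> real ^ 'd. u \<bullet> ((A *v p t) /\<^sub>R sqrt t)) \<in> borel_measurable path_space"
      by measurable
    show "(\<lambda>p :: real \<Rightarrow> real ^ 'd. u \<bullet> (p t /\<^sub>R sqrt t)) \<in> borel_measurable path_space"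
      by (intro borel_measurable_inner borel_measurable_scaleR borel_measurable_const eval)
  qed
  moreover have "(\<lambda>p. u \<bullet> ((A *v p t) /\<^sub>R sqrt t)) \<circ> path B = Y" "(\<lambda>p. u \<bullet> (p t /\<^sub>R sqrt t)) \<circ> path S = Z"
    using t by (auto simp: path_def Y_def Z_def)
  ultimately have "indep_var borel Y borel Z" by simp
  then have "char (distr M borel (\<lambda>\<omega>. Y \<omega> + Z \<omega>)) 1 = char (distr M borel Y) 1 * char (distr M borel Z) 1"
    by (rule char_distr_add)
  then have prod: "(CLINT \<omega>|M. iexp (Y \<omega> + Z \<omega>)) = (CLINT \<omega>|M. iexp (Y \<omega>)) * (CLINT \<omega>|M. iexp (Z \<omega>))"
    by (simp add: char_def integral_distr)
  \<comment> \<open>The path law is evaluated at time 1.\<close>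
  have scaled: "distr M borel (\<lambda>\<omega>. A *v ((1 / sqrt t) *\<^sub>R B t \<omega>)) = distr M borel (\<lambda>\<omega>. A *v B 1 \<omega>)"
  proof -
    have eval1: "(\<lambda>p. p 1) \<in> borel_measurable (path_space :: (real \<Rightarrow> real ^ 'd) measure)"
      unfolding path_space_def by (intro measurable_component_singleton) auto
    have path: "path V \<in> measurable M path_space" if "\<And>s. 0 \<le> s \<Longrightarrow> s \<le> 1 \<Longrightarrow> random_variable borel (V s)"
      for V :: "real \<Rightarrow> 'a \<Rightarrow> real ^ 'd"
      using that unfolding path_def[abs_def] path_space_def by (intro measurable_restrict) auto
    have path1: "path (\<lambda>s \<omega>. scaled_B t s \<omega>) \<in> measurable M path_space"
      using t by (intro path measurable_matrix_vector_mult borel_measurable_scaleR borel_measurable_const random_variable_B mult_le_one) auto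
    have path2: "path (\<lambda>s \<omega>. A *v B s \<omega>) \<in> measurable M path_space"
      by (intro path measurable_matrix_vector_mult random_variable_B) auto
    have "distr (distr M path_space (path (\<lambda>s \<omega>. scaled_B t s \<omega>))) borel (\<lambda>p. p 1)
      = distr (distr M path_space (path (\<lambda>s \<omega>. A *v B s \<omega>))) borel (\<lambda>p. p 1)"
      using distr_scaled_path[OF t] by simp
    then show ?thesis
      by (simp add: distr_distr[OF eval1 path1] distr_distr[OF eval1 path2] comp_def path_def)
  qed
  have "(CLINT \<omega>|M. iexp (Y \<omega>)) = (CLINT \<omega>|M. iexp (u \<bullet> (A *v ((1 / sqrt t) *\<^sub>R B t \<omega>))))"
    by (simp add: Y_def matrix_vector_mult_scaleR inverse_eq_divide)
  also have "\<dots> = (CLINT x|distr M borel (\<lambda>\<omega>. A *v ((1 / sqrt t) *\<^sub>R B t \<omega>)). iexp (u \<bullet> x))"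
    by (subst integral_distr) auto
  also have "\<dots> = (CLINT \<omega>|M. iexp (u \<bullet> (A *v B 1 \<omega>)))"
    unfolding scaled by (subst integral_distr) auto
  finally have Y: "(CLINT \<omega>|M. iexp (Y \<omega>)) = complex_of_real (exp (- (norm (A *v u))\<^sup>2 / 2))"
    by (simp add: B1)
  have "(CLINT \<omega>|M. iexp (Z \<omega>)) = (CLINT \<omega>|M. iexp ((u /\<^sub>R sqrt t) \<bullet> S t \<omega>))"
    by (simp add: Z_def)
  also have "\<dots> = exp (complex_of_real t * \<psi> (u /\<^sub>R sqrt t))"
    using t by (intro char_S) auto
  finally have Z: "(CLINT \<omega>|M. iexp (Z \<omega>)) = exp (complex_of_real t * \<psi> (u /\<^sub>R sqrt t))" .
  have "u \<bullet> X t 1 \<omega> = Y \<omega> + Z \<omega>" for \<omega>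
    by (simp add: X_def Y_def Z_def scaleR_add_right inner_add_right distrib_left)
  then show "(CLINT \<omega>|M. iexp (u \<bullet> X t 1 \<omega>)) = complex_of_real (exp (- (norm (A *v u))\<^sup>2 / 2)) * exp (complex_of_real t * \<psi> (u /\<^sub>R sqrt t))"
    by (simp only: prod Y Z)
qed

text \<open>The test frequency is sqrt t times \<open>u\<close>, which cancels the spatial scaling,
  so that \<psi> is evaluated at \<open>u\<close> itself.\<close>

lemma wasserstein_vec_X_ge:
  assumes "independent_processes M B S" "transpose A = A" and t: "0 < t" "t \<le> 1" and q: "1 \<le> q" and u: "u \<noteq> 0"
  shows "ennreal (exp (- t * (norm (A *v u))\<^sup>2 / 2) * cmod (exp (complex_of_real t * \<psi> u) - 1) / (sqrt t * norm u))
    \<le> vec_distance q t"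
proof -
  let ?u = "sqrt t *\<^sub>R u"
  have [measurable]: "random_variable borel (B 1)" "random_variable borel (X t 1)"
    using t by (auto intro!: random_variable_B random_variable_X)
  have norm_A: "(norm (A *v ?u))\<^sup>2 = t * (norm (A *v u))\<^sup>2"
    using t by (simp add: matrix_vector_mult_scaleR power_mult_distrib)
  have "(CLINT \<omega>|M. iexp (?u \<bullet> X t 1 \<omega>)) - (CLINT \<omega>|M. iexp (?u \<bullet> (A *v B 1 \<omega>)))
    = complex_of_real (exp (- t * (norm (A *v u))\<^sup>2 / 2)) * (exp (complex_of_real t * \<psi> u) - 1)"
    using t assms(1,2) by (simp only: char_X_1[OF assms(1,2) t] norm_A) (simp add: algebra_simps)
  then have "cmod ((CLINT \<omega>|M. iexp (?u \<bullet> X t 1 \<omega>)) - (CLINT \<omega>|M. iexp (?u \<bullet> (A *v B 1 \<omega>)))) / norm ?u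
    = exp (- t * (norm (A *v u))\<^sup>2 / 2) * cmod (exp (complex_of_real t * \<psi> u) - 1) / (sqrt t * norm u)"
    using t by (simp add: norm_mult)
  moreover have "ennreal (cmod ((CLINT \<omega>|M. iexp (?u \<bullet> X t 1 \<omega>)) - (CLINT \<omega>|M. iexp (?u \<bullet> (A *v B 1 \<omega>)))) / norm ?u)
    \<le> vec_distance q t"
    using q u t by (intro wasserstein_vec_ge_char) auto
  ultimately show ?thesis by simp
qed

lemma wasserstein_vec_lower_sqrt:
  assumes "independent_processes M B S" "transpose A = A" and q: "1 \<le> q" and u: "u \<noteq> 0"
  shows "\<forall>\<^sub>F t in at_right 0. ennreal (cmod (\<psi> u) / norm u / sqrt 2 * sqrt t) \<le> vec_distance q t"
proof -
  define \<kappa> :: real where "\<kappa> = 2 powr (- 1 / 4)"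
  have \<kappa>: "0 < \<kappa>" "\<kappa> < 1" "\<kappa> * \<kappa> = 1 / sqrt 2"
  proof -
    show "\<kappa> < 1"
      unfolding \<kappa>_def by (rule powr_less_one) auto
    have "\<kappa> * \<kappa> = 2 powr (- 1 / 2)"
      by (simp add: \<kappa>_def flip: powr_add)
    then show "\<kappa> * \<kappa> = 1 / sqrt 2"
      by (simp add: powr_minus_divide powr_half_sqrt)
  qed (simp add: \<kappa>_def)
  have "((\<lambda>t. exp (- t * (norm (A *v u))\<^sup>2 / 2)) \<longlongrightarrow> exp (- 0 * (norm (A *v u))\<^sup>2 / 2)) (at_right 0)"
    by (intro tendsto_intros) auto
  then have ev1: "\<forall>\<^sub>F t in at_right 0. \<kappa> < exp (- t * (norm (A *v u))\<^sup>2 / 2)"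
    using \<kappa> by (intro order_tendstoD(1)) auto
  have "((\<lambda>t. complex_of_real t * \<psi> u) \<longlongrightarrow> complex_of_real 0 * \<psi> u) (at_right 0)"
    by (intro tendsto_intros)
  then have lim: "((\<lambda>t. complex_of_real t * \<psi> u) \<longlongrightarrow> 0) (at_right 0)"
    by simp
  have ev2: "\<forall>\<^sub>F t in at_right 0. \<kappa> * cmod (complex_of_real t * \<psi> u) \<le> cmod (exp (complex_of_real t * \<psi> u) - 1)"
    using eventually_compose_filterlim[OF eventually_cmod_exp_minus_one_ge[OF \<kappa>(2)] lim] .
  have ev3: "\<forall>\<^sub>F t :: real in at_right 0. 0 < t \<and> t \<le> 1"
    by (rule eventually_at_rightI[of 0 1]) auto
  from ev1 ev2 ev3 show ?thesis
  proof eventually_elim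
    case (elim t)
    have "\<kappa> * (\<kappa> * (t * cmod (\<psi> u))) \<le> exp (- t * (norm (A *v u))\<^sup>2 / 2) * cmod (exp (complex_of_real t * \<psi> u) - 1)"
      using elim \<kappa> by (intro mult_mono) (auto simp: norm_mult)
    then have "\<kappa> * (\<kappa> * (t * cmod (\<psi> u))) / (sqrt t * norm u)
      \<le> exp (- t * (norm (A *v u))\<^sup>2 / 2) * cmod (exp (complex_of_real t * \<psi> u) - 1) / (sqrt t * norm u)"
      using elim by (intro divide_right_mono) auto
    moreover have "\<kappa> * (\<kappa> * (t * cmod (\<psi> u))) / (sqrt t * norm u) = cmod (\<psi> u) / norm u / sqrt 2 * sqrt t"
    proof -
      have "\<kappa> * (\<kappa> * (t * cmod (\<psi> u))) / (sqrt t * norm u) = (\<kappa> * \<kappa>) * (t / sqrt t) * (cmod (\<psi> u) / norm u)"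
        by simp
      also have "t / sqrt t = sqrt t"
        using elim by (simp add: real_div_sqrt)
      finally show ?thesis
        by (simp add: \<kappa> mult_ac)
    qed
    ultimately have "ennreal (cmod (\<psi> u) / norm u / sqrt 2 * sqrt t)
      \<le> ennreal (exp (- t * (norm (A *v u))\<^sup>2 / 2) * cmod (exp (complex_of_real t * \<psi> u) - 1) / (sqrt t * norm u))"
      by (intro ennreal_leI) simp
    also have "\<dots> \<le> vec_distance q t"
      using elim assms by (intro wasserstein_vec_X_ge) auto
    finally show ?case .
  qed
qed

text \<open>Testing at frequency \<open>u_r\<close> with \<open>r = t\<^sup>-\<^sup>1\<^sup>/\<^sup>2\<close>. As \<open>S\<close> has no Gaussian part, \<open>\<psi>(u) = o(|u|\<^sup>2)\<close> at
  infinity, hence \<open>t \<psi>(u_r)\<close> tends to 0 and \<open>exp (t \<psi>(u_r)) - 1\<close> is comparable to \<open>t \<psi>(u_r)\<close>.\<close>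

lemma wasserstein_vec_lower_powr:
  assumes "independent_processes M B S" "transpose A = A" and q: "1 \<le> q"
    and max: "\<And>m. eigenvalue (A ** A) m \<Longrightarrow> m \<le> l"
    and u: "\<And>r. 0 < r \<Longrightarrow> norm (u r) = r"
    and c: "\<And>r. 1 < r \<Longrightarrow> c \<le> r powr - \<delta> * cmod (\<psi> (u r))" "0 < c"
    and C: "C \<le> c * exp (- l / 2)"
  shows "\<forall>\<^sub>F t in at_right 0. ennreal (C / sqrt 2 * t powr (1 - \<delta> / 2)) \<le> vec_distance q t"
proof -
  \<comment> \<open>Here the whole factor goes into |exp z - 1|: the Gaussian factor does not tend
    to 1 in general, since t |u_r|^2 = 1, and is bounded below by exp(-l/2) instead.\<close>
  define \<kappa> :: real where "\<kappa> = 1 / sqrt 2"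
  have \<kappa>: "0 < \<kappa>" "\<kappa> < 1" by (auto simp: \<kappa>_def)
  obtain e where e: "0 < e" "\<And>z. cmod z < e \<Longrightarrow> \<kappa> * cmod z \<le> cmod (exp z - 1)"
    using eventually_cmod_exp_minus_one_ge[OF \<kappa>(2)] by (auto simp: eventually_nhds_metric dist_norm)
  \<comment> \<open>With e/2 in place of e, the modulus of t \<psi>(u_r) stays strictly below
    \<open>e\<close>.\<close>
  have "\<forall>\<^sub>F r in at_top. \<forall>u. norm u = r \<longrightarrow> cmod (\<psi> u) \<le> (e / 2) * r\<^sup>2"
    using e by (intro pure_jump_exponent_at_infinity) auto
  moreover have "filterlim (\<lambda>t. 1 / sqrt t) at_top (at_right 0)"
  proof -
    have "(sqrt \<longlongrightarrow> sqrt 0) (at_right 0)"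
      by (intro tendsto_real_sqrt tendsto_ident_at)
    then have "filterlim sqrt (at_right 0) (at_right 0)"
      by (auto simp: filterlim_at intro!: eventually_at_rightI[of 0 1])
    from filterlim_compose[OF filterlim_inverse_at_top_right this] show ?thesis
      by (simp add: inverse_eq_divide)
  qed
  ultimately have ev1: "\<forall>\<^sub>F t in at_right 0. \<forall>u. norm u = 1 / sqrt t \<longrightarrow> cmod (\<psi> u) \<le> (e / 2) * (1 / sqrt t)\<^sup>2"
    by (auto simp: filterlim_iff)
  have ev2: "\<forall>\<^sub>F t :: real in at_right 0. 0 < t \<and> t < 1"
    by (rule eventually_at_rightI[of 0 1]) auto
  from ev1 ev2 show ?thesis
  proof eventually_elim
    case (elim t)
    define r where "r = 1 / sqrt t"
    have r: "1 < r"
      using elim by (simp add: r_def)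
    have r_powr: "r powr \<delta> = t powr - (\<delta> / 2)"
      using elim by (simp add: r_def powr_divide powr_minus_divide powr_half_sqrt[symmetric] powr_powr)
    have ur: "norm (u r) = 1 / sqrt t" "u r \<noteq> 0"
      using u[of r] r elim by (auto simp: r_def)
    have "cmod (\<psi> (u r)) \<le> (e / 2) / t"
      using elim ur by (auto simp: power_divide)
    then have "cmod (complex_of_real t * \<psi> (u r)) < e"
      using elim e by (simp add: norm_mult field_simps)
    then have exp_ge: "\<kappa> * (t * cmod (\<psi> (u r))) \<le> cmod (exp (complex_of_real t * \<psi> (u r)) - 1)"
      using e(2)[of "complex_of_real t * \<psi> (u r)"] elim by (simp add: norm_mult)
    have "c * r powr \<delta> \<le> cmod (\<psi> (u r))"
      using c(1)[OF r] r by (simp add: powr_minus field_simps)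
    then have psi_ge: "c * t powr - (\<delta> / 2) \<le> cmod (\<psi> (u r))"
      by (simp add: r_powr)
    have A_inner: "(norm (A *v x))\<^sup>2 = x \<bullet> ((A ** A) *v x)" for x
      using dot_lmul_matrix[of x A "A *v x"] vector_transpose_matrix[of x A]
      by (simp add: assms(2) power2_norm_eq_inner matrix_vector_mul_assoc)
    have "(norm (A *v u r))\<^sup>2 \<le> l * (norm (u r))\<^sup>2"
      unfolding A_inner using max by (intro quadratic_form_le_max_eigenvalue) (simp add: matrix_transpose_mul assms(2))
    then have "t * (norm (A *v u r))\<^sup>2 \<le> l"
      using elim ur by (simp add: power_divide field_simps)
    then have exp_l: "exp (- l / 2) \<le> exp (- t * (norm (A *v u r))\<^sup>2 / 2)"
      by simp
    have "C / sqrt 2 * t powr (1 - \<delta> / 2) \<le> (c * exp (- l / 2)) / sqrt 2 * t powr (1 - \<delta> / 2)"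
      using C by (intro mult_right_mono divide_right_mono) auto
    also have "\<dots> = exp (- l / 2) * (\<kappa> * (t * (c * t powr - (\<delta> / 2))))"
    proof -
      have "t powr (1 - \<delta> / 2) = t * t powr - (\<delta> / 2)"
        using elim powr_add[of t 1 "- (\<delta> / 2)"] by simp
      then show ?thesis
        by (simp add: \<kappa>_def mult_ac)
    qed
    also have "\<dots> \<le> exp (- l / 2) * (\<kappa> * (t * cmod (\<psi> (u r))))"
      using elim \<kappa> psi_ge by (intro mult_left_mono) auto
    also have "\<dots> \<le> exp (- t * (norm (A *v u r))\<^sup>2 / 2) * cmod (exp (complex_of_real t * \<psi> (u r)) - 1)"
      using exp_l exp_ge elim \<kappa> by (intro mult_mono) auto
    also have "\<dots> = exp (- t * (norm (A *v u r))\<^sup>2 / 2) * cmod (exp (complex_of_real t * \<psi> (u r)) - 1) / (sqrt t * norm (u r))"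
      using elim ur by simp
    finally have "ennreal (C / sqrt 2 * t powr (1 - \<delta> / 2)) \<le> ennreal \<dots>"
      by (rule ennreal_leI)
    also have "\<dots> \<le> vec_distance q t"
      using elim assms(1,2) q ur by (intro wasserstein_vec_X_ge) auto
    finally show ?case .
  qed
qed

end

theorem theorem2p11:
  fixes M :: "'a measure"
    and Sig :: "real ^ 'd ^ 'd"
    and B S X :: "real \<Rightarrow> 'a \<Rightarrow> real ^ 'd"
    and Xt :: "real \<Rightarrow> real \<Rightarrow> 'a \<Rightarrow> real ^ 'd"
    and \<gamma> :: "real ^ 'd" and \<nu> :: "(real ^ 'd) measure"
    and \<psi> :: "real ^ 'd \<Rightarrow> complex"
  assumes "prob_space M"
    and "transpose Sig = Sig" and "\<forall>x. 0 \<le> x \<bullet> (Sig *v x)"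
    and "brownian_motion M B"
    and "levy_process M S"
    and "generating_triplet M S \<gamma> 0 \<nu>"
    and "levy_khintchine_exponent M S \<psi>"
    and "independent_processes M B S"
    and "X = (\<lambda>t \<omega>. Sig *v B t \<omega> + S t \<omega>)"
    and "Xt = (\<lambda>t s \<omega>. (Sig *v B (s * t) \<omega> + S (s * t) \<omega>) /\<^sub>R sqrt t)"
  shows
    \<comment> \<open>(a)\<close>
    "(\<forall>bs q. blumenthal_getoor_index \<nu> < 2 \<longrightarrow>
        (if finite_variation \<nu> then bs = 1 else blumenthal_getoor_index \<nu> < bs \<and> bs \<le> 2) \<longrightarrow>
        0 < q \<longrightarrow> integrable M (\<lambda>\<omega>. norm (X 1 \<omega>) powr q) \<longrightarrow>
        (\<forall>\<^sub>F t in at_right 0. wasserstein_proc q M (Xt t) (\<lambda>s \<omega>. Sig *v B s \<omega>) < \<infinity>) \<and>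
        (\<lambda>t. enn2real (wasserstein_proc q M (Xt t) (\<lambda>s \<omega>. Sig *v B s \<omega>)))
          \<in> O[at_right 0](\<lambda>t. t powr (min q 1 * (min (1 / q) (1 / bs) - 1 / 2))))
     \<and>
     \<comment> \<open>(b)\<close>
     (\<forall>u C q. u \<noteq> 0 \<longrightarrow> C = cmod (\<psi> u) / norm u \<longrightarrow> 0 < C \<longrightarrow> 1 \<le> q \<longrightarrow>
        (\<exists>r. r \<in> O[at_right 0](\<lambda>t. t powr (3 / 2)) \<and>
          (\<forall>\<^sub>F t in at_right 0.
             ennreal (C / sqrt 2 * sqrt t + r t)
               \<le> wasserstein_vec q M (Xt t 1) (\<lambda>\<omega>. Sig *v B 1 \<omega>))))
     \<and>
     \<comment> \<open>(c)\<close>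
     (\<forall>l \<delta> u c C q.
        eigenvalue (Sig ** Sig) l \<longrightarrow> (\<forall>m. eigenvalue (Sig ** Sig) m \<longrightarrow> m \<le> l) \<longrightarrow>
        1 \<le> \<delta> \<longrightarrow> \<delta> < 2 \<longrightarrow> (\<forall>r>0. norm (u r) = r) \<longrightarrow>
        c = (INF r\<in>{1<..}. r powr (- \<delta>) * cmod (\<psi> (u r))) \<longrightarrow> 0 < c \<longrightarrow>
        1 \<le> q \<longrightarrow> 0 < C \<longrightarrow> C < c * exp (- l / 2) \<longrightarrow>
        (\<forall>\<^sub>F t in at_right 0.
           ennreal (C / sqrt 2 * t powr (1 - \<delta> / 2))
             \<le> wasserstein_vec q M (Xt t 1) (\<lambda>\<omega>. Sig *v B 1 \<omega>)))"
proof -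
  have levy_meas: "levy_measure \<nu>"
    and triplet: "levy_khintchine_exponent M S (pure_jump_exponent \<gamma> \<nu>)"
    using assms(6) unfolding generating_triplet_def pure_jump_exponent_def[abs_def] jump_integrand_def by simp_all
  interpret levy_diffusion M \<nu> S B \<gamma> Sig
    using assms(1,4,5) levy_meas triplet
    by (intro levy_diffusion.intro pure_jump_levy_process.intro brownian.intro
        levy_jumps.intro pure_jump_levy_process_axioms.intro brownian_axioms.intro)
  have Xt: "Xt t = levy_diffusion.X S B Sig t" for t
    by (intro ext) (simp add: assms(10) X_def)
  have \<psi>_eq: "\<psi> u = pure_jump_exponent \<gamma> \<nu> u" for u
    using assms(7) triplet by (rule levy_khintchine_exponent_unique)
  show ?thesis
  proof (intro conjI allI impI)
    fix bs q
    assume a: "blumenthal_getoor_index \<nu> < 2"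
      "if finite_variation \<nu> then bs = 1 else blumenthal_getoor_index \<nu> < bs \<and> bs \<le> 2"
      "0 < q" "integrable M (\<lambda>\<omega>. norm (X 1 \<omega>) powr q)"
    then have int: "integrable M (\<lambda>\<omega>. norm (Sig *v B 1 \<omega> + S 1 \<omega>) powr q)"
      by (simp add: assms(9))
    show "\<forall>\<^sub>F t in at_right 0. wasserstein_proc q M (Xt t) (\<lambda>s \<omega>. Sig *v B s \<omega>) < \<infinity>"
      unfolding Xt by (rule wasserstein_proc_upper(1)[OF a(1-3) int])
    show "(\<lambda>t. enn2real (wasserstein_proc q M (Xt t) (\<lambda>s \<omega>. Sig *v B s \<omega>)))
      \<in> O[at_right 0](\<lambda>t. t powr (min q 1 * (min (1 / q) (1 / bs) - 1 / 2)))"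
      unfolding Xt by (rule wasserstein_proc_upper(2)[OF a(1-3) int])
  next
    fix u :: "real ^ 'd" and C q :: real
    assume a: "u \<noteq> 0" "C = cmod (\<psi> u) / norm u" "0 < C" "1 \<le> q"
    have "\<forall>\<^sub>F t in at_right 0. ennreal (C / sqrt 2 * sqrt t + 0) \<le> wasserstein_vec q M (Xt t 1) (\<lambda>\<omega>. Sig *v B 1 \<omega>)"
      using wasserstein_vec_lower_sqrt[OF assms(8,2) a(4,1)] by (simp add: a(2) \<psi>_eq Xt)
    then show "\<exists>r. r \<in> O[at_right 0](\<lambda>t. t powr (3 / 2)) \<and>
      (\<forall>\<^sub>F t in at_right 0. ennreal (C / sqrt 2 * sqrt t + r t) \<le> wasserstein_vec q M (Xt t 1) (\<lambda>\<omega>. Sig *v B 1 \<omega>))"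
      by (intro exI[of _ "\<lambda>_. 0"]) simp
  next
    fix l \<delta> :: real and u :: "real \<Rightarrow> real ^ 'd" and c C q :: real
    assume a: "eigenvalue (Sig ** Sig) l" "\<forall>m. eigenvalue (Sig ** Sig) m \<longrightarrow> m \<le> l" "1 \<le> \<delta>" "\<delta> < 2"
      "\<forall>r>0. norm (u r) = r" "c = (INF r\<in>{1<..}. r powr - \<delta> * cmod (\<psi> (u r)))" "0 < c" "1 \<le> q" "0 < C" "C < c * exp (- l / 2)"
    have "c \<le> r powr - \<delta> * cmod (pure_jump_exponent \<gamma> \<nu> (u r))" if "1 < r" for r
      unfolding a(6) \<psi>_eq using that by (intro cINF_lower bdd_belowI2[where m=0]) auto
    then show "\<forall>\<^sub>F t in at_right 0. ennreal (C / sqrt 2 * t powr (1 - \<delta> / 2)) \<le> wasserstein_vec q M (Xt t 1) (\<lambda>\<omega>. Sig *v B 1 \<omega>)"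
      unfolding Xt using a by (intro wasserstein_vec_lower_powr[OF assms(8,2) a(8)]) auto
  qed
qed

end
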